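(* Assume at least one agent satisfies (M), every agent satisfying (M) is of type P or type E, and one of the following holds: (1) At least one agent is of type E, and for all $\chi(0)\in\Delta_{A-1}^o$ and $i,j\in[A]$ the two statements $\liminf_{N\to\infty}F_i(\chi_i(0)N)/F_j(\chi_j(0)N)=0$ and $\limsup_{N\to\infty}F_i(\chi_i(0)N)/F_j(\chi_j(0)N)=\infty$ do not hold simultaneously. (2) No agent is of type E, every agent of type P satisfies $\limsup_{k\to\infty}\frac1kF_i(k)\sum_{l=k}^\infty\frac1{F_i(l)}<\infty$, and $\lim_{N\to\infty}F_i(\chi_i(0)N)/F_j(\chi_j(0)N)\in[0,\infty]$ exists for all $\chi(0)\in\Delta_{A-1}^o$ and $i,j\in[A]$. Then each asymptotic attraction domain $D_i$ is, up to boundary points, a convex polytope, and these domains dissect the simplex up to boundaries: $\bigcup_{i=1}^A\overline{D_i}=\Delta_{A-1}$ (closure in $\Delta_{A-1}$). Moreover $D_i=\emptyset$ for every agent $i$ not satisfying (M).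
   Context: Fix $A\ge 2$, $[A]=\{1,\dots,A\}$, and feedback functions $F_i:\mathbb{N}\to(0,\infty)$. The generalized Pólya urn is the Markov chain $X(n)\in\mathbb{N}^A$, $n\in\mathbb{N}_0$, with $X_i(0)\ge1$ and $\mathbb{P}(X(n+1)=X(n)+e^{(i)}\mid X(n))=F_i(X_i(n))/\sum_{j}F_j(X_j(n))$. $N=\sum_iX_i(0)$; $\Delta_{A-1}=\{x\in[0,1]^A:\sum x_i=1\}$ with interior $\Delta_{A-1}^o$. For fixed $\chi(0)\in\Delta_{A-1}^o$ the process starts from $X_i(0)=\chi_i(0)N$ (rounded), and each $F_i$ is extended to a $C^1$ function on $(0,\infty)$ monotone on every $[n,n+1]$. $sMon_i(\chi(0),N)=\{\lim_{n\to\infty}\sum_{j\ne i}X_j(n)<\infty\}$. The asymptotic attraction domain of agent $i$ is $D_i=\{\chi(0)\in\Delta_{A-1}^o:\lim_{N\to\infty}\mathbb{P}(sMon_i(\chi(0),N))=1\}$. Condition (M) for $i$: $\sum_{k\ge1}1/F_i(k)<\infty$. Type P: (M) and $\lim_kF_i(k)\sum_{l\ge k}1/F_i(l)=\infty$. Type E: (M) and $\limsup_kF_i(k)\sum_{l\ge k}1/F_i(l)<\infty$. *)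

theory Defs
  imports "HOL-Probability.Probability"
begin

text \<open>Agents are the elements of a finite, well-ordered type 'n (so A = CARD('n)).
  Feedback functions: F :: 'n => real => real, where F i restricted to the positive
  naturals is the original feedback function and F i on (0,inf) is its C^1 extension.\<close>

definition C1_on :: "real set \<Rightarrow> (real \<Rightarrow> real) \<Rightarrow> bool" where
  "C1_on S f \<longleftrightarrow> (\<exists>f'. (\<forall>x\<in>S. (f has_real_derivative f' x) (at x)) \<and> continuous_on S f')"

definition monotone_pieces :: "(real \<Rightarrow> real) \<Rightarrow> bool" where
  "monotone_pieces f \<longleftrightarrow> (\<forall>n::nat. n \<ge> 1 \<longrightarrow>
     ((\<forall>x y. real n \<le> x \<longrightarrow> x \<le> y \<longrightarrow> y \<le> real n + 1 \<longrightarrow> f x \<le> f y) \<or>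
      (\<forall>x y. real n \<le> x \<longrightarrow> x \<le> y \<longrightarrow> y \<le> real n + 1 \<longrightarrow> f y \<le> f x)))"

definition admissible_feedback :: "('n \<Rightarrow> real \<Rightarrow> real) \<Rightarrow> bool" where
  "admissible_feedback F \<longleftrightarrow>
     (\<forall>i. (\<forall>k::nat. k \<ge> 1 \<longrightarrow> F i (real k) > 0) \<and> C1_on {0<..} (F i) \<and> monotone_pieces (F i))"

text \<open>Random mapping representation of the urn: given the state x and a uniform
  variable u in [0,1], agent j is drawn iff u*S lies in the j-th subinterval of length
  F_j(x_j), so that the draw probability is F_j(x_j)/S.\<close>
definition draw :: "('n::{finite,wellorder} \<Rightarrow> real \<Rightarrow> real) \<Rightarrow> ('n \<Rightarrow> nat) \<Rightarrow> real \<Rightarrow> 'n" where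
  "draw F x u = (LEAST j. u * (\<Sum>k\<in>UNIV. F k (real (x k))) < (\<Sum>k\<in>{..j}. F k (real (x k))))"

primrec urn :: "('n::{finite,wellorder} \<Rightarrow> real \<Rightarrow> real) \<Rightarrow> ('n \<Rightarrow> nat) \<Rightarrow> (nat \<Rightarrow> real) \<Rightarrow> nat \<Rightarrow> 'n \<Rightarrow> nat" where
  "urn F x0 \<omega> 0 = x0"
| "urn F x0 \<omega> (Suc n) = (let x = urn F x0 \<omega> n; j = draw F x (\<omega> n) in x(j := x j + 1))"

definition urn_space :: "(nat \<Rightarrow> real) measure" where
  "urn_space = PiM UNIV (\<lambda>_::nat. uniform_measure lborel {0..1::real})"

definition init_config :: "real^('n::finite) \<Rightarrow> nat \<Rightarrow> 'n \<Rightarrow> nat" where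
  "init_config c N = (\<lambda>i. nat \<lceil>c $ i * real N\<rceil>)"

definition sMon :: "('n::{finite,wellorder} \<Rightarrow> real \<Rightarrow> real) \<Rightarrow> 'n \<Rightarrow> real^('n::{finite,wellorder}) \<Rightarrow> nat \<Rightarrow> (nat \<Rightarrow> real) set" where
  "sMon F i c N = {\<omega> \<in> space urn_space.
      \<exists>B::nat. \<forall>n. (\<Sum>j\<in>UNIV - {i}. urn F (init_config c N) \<omega> n j) \<le> B}"

definition std_simplex :: "(real^('n::finite)) set" where
  "std_simplex = {x. (\<forall>i. 0 \<le> x $ i) \<and> (\<Sum>i\<in>UNIV. x $ i) = 1}"

definition std_simplex_interior :: "(real^('n::finite)) set" where
  "std_simplex_interior = {x. (\<forall>i. 0 < x $ i) \<and> (\<Sum>i\<in>UNIV. x $ i) = 1}"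

definition attraction_domain :: "('n::{finite,wellorder} \<Rightarrow> real \<Rightarrow> real) \<Rightarrow> 'n \<Rightarrow> (real^('n::{finite,wellorder})) set" where
  "attraction_domain F i = {c \<in> std_simplex_interior.
      ((\<lambda>N. measure urn_space (sMon F i c N)) \<longlongrightarrow> 1) sequentially}"

definition condM :: "(real \<Rightarrow> real) \<Rightarrow> bool" where
  "condM f \<longleftrightarrow> summable (\<lambda>k::nat. 1 / f (real (k + 1)))"

definition tail_sum :: "(real \<Rightarrow> real) \<Rightarrow> nat \<Rightarrow> real" where
  "tail_sum f k = (\<Sum>l. 1 / f (real (l + k)))"

definition typeP :: "(real \<Rightarrow> real) \<Rightarrow> bool" where
  "typeP f \<longleftrightarrow> condM f \<and> filterlim (\<lambda>k. f (real k) * tail_sum f k) at_top sequentially"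

definition typeE :: "(real \<Rightarrow> real) \<Rightarrow> bool" where
  "typeE f \<longleftrightarrow> condM f \<and> limsup (\<lambda>k. ereal (f (real k) * tail_sum f k)) < \<infinity>"

definition ratio_seq :: "('n \<Rightarrow> real \<Rightarrow> real) \<Rightarrow> real^'n \<Rightarrow> 'n \<Rightarrow> 'n \<Rightarrow> nat \<Rightarrow> ereal" where
  "ratio_seq F c i j N = ereal (F i (c $ i * real N) / F j (c $ j * real N))"

end

theory Submission
  imports Defs
begin

text \<open>For an agent \<open>i\<close> satisfying (M) let \<open>R_i k\<close> be the tail \<open>\<Sum>l\<ge>k. 1 / F i l\<close>. A supermartingale
  that depends only on the balls of \<open>i\<close> and \<open>j\<close> shows that \<open>j\<close> receives infinitely many balls with
  probability tending to 0 whenever \<open>R_i (c_i N) / R_j (c_j N)\<close> tends to 0, or whenever this ratio stays below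
  some \<open>q < 1\<close> and both agents are of type P. In particular agents of type E eliminate all others. Among the
  remaining agents the tails decay at least polynomially, so this comparison is strictly monotone in
  \<open>c_i / c_j\<close>, and by hypothesis any two of them are comparable for a dense set of ratios. Hence there is
  a critical ratio for each pair. The critical ratios are multiplicative, so the agents that are not beaten
  at every ratio carry weights \<open>w_i\<close>, and \<open>D_i\<close> is, up to boundary points, the set where \<open>c_i / w_i\<close>
  is maximal.\<close>

section \<open>The urn as a process on the sequence space\<close>

text \<open>A constant factor between two tails is decisive when single waiting times are negligible
  against the tail, which is type P: the difference of the explosion times then concentrates. For
  type E a single waiting time is of the order of the whole remaining tail, so the ratio of tails
  has to tend to 0; exponential decay provides this as soon as the ray is moved a little. The
  hypotheses, however, speak of ratios of \<open>F\<close> along single rays, not of tails. For type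
  E, \<open>F\<close> is of the order of the reciprocal tail, and the lost constants are again
  absorbed by moving the ray. In the second regime, pointwise limits along rays give no uniformity
  between neighbouring rays, while tails sum over whole blocks of integers; Baire's theorem yields
  enough uniformity on some cone. This is also why comparability is obtained for a dense set of
  ratios only. Nothing is decided at a critical ratio itself, so each domain is merely enclosed
  between a cell given by strict inequalities and the one given by weak inequalities, which is what
  a polytope up to boundary points amounts to.\<close>

abbreviation unif :: "real measure" where
  "unif \<equiv> uniform_measure lborel {0..1}"

definition add_ball :: "('n \<Rightarrow> nat) \<Rightarrow> 'n \<Rightarrow> 'n \<Rightarrow> nat" where
  "add_ball x j = x(j := x j + 1)"

lemma prob_space_unif: "prob_space unif"
  by (rule prob_space_uniform_measure) auto

interpretation unif: prob_space unif
  by (rule prob_space_unif)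

interpretation urn_seq: sequence_space unif
  by unfold_locales

lemma urn_space_eq: "urn_space = PiM UNIV (\<lambda>_::nat. unif)"
  by (simp add: urn_space_def)

lemma prob_space_urn_space: "prob_space urn_space"
  unfolding urn_space_eq by (rule urn_seq.P.prob_space_axioms)

lemma urn_Suc: "urn F x \<omega> (Suc n) = add_ball (urn F x \<omega> n) (draw F (urn F x \<omega> n) (\<omega> n))"
  by (simp add: add_ball_def Let_def)

text \<open>Pathwise Markov property at the first draw. It allows inductions that condition on the
  first draw and use the hypothesis for the shifted sequence from a new initial state.\<close>

lemma urn_case_nat:
  "urn F x (case_nat u \<omega>) (Suc n) = urn F (add_ball x (draw F x u)) \<omega> n"
proof (induction n)
  case 0
  show ?case by (simp add: add_ball_def Let_def)
next
  case (Suc n)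
  show ?case
    unfolding urn_Suc[of _ _ _ "Suc n"] Suc.IH by (simp add: urn_Suc del: urn.simps)
qed

text \<open>The predicate \<open>P u\<close> ranges over the finitely many predicates on agents, so
  any function of it, here \<open>LEAST\<close>, is measurable once every fibre of \<open>P\<close>
  is Borel.\<close>

lemma measurable_draw [measurable]: "draw F x \<in> measurable borel (count_space UNIV)"
proof -
  define P where "P u = (\<lambda>j. u * (\<Sum>k\<in>UNIV. F k (real (x k))) < (\<Sum>k\<in>{..j}. F k (real (x k))))" for u
  have "P \<in> measurable borel (count_space UNIV)"
  proof (subst measurable_count_space_eq2_countable, simp_all, intro allI)
    fix g :: "'a \<Rightarrow> bool"
    have "P -` {g} = (\<Inter>j\<in>UNIV. {u. P u j = g j})"
      by (auto simp: fun_eq_iff)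
    also have "\<dots> \<in> sets borel"
      unfolding P_def by (intro sets.finite_INT) auto
    finally show "P -` {g} \<in> sets borel" .
  qed
  then have "(\<lambda>u. (LEAST j. P u j)) \<in> measurable borel (count_space UNIV)"
    by (rule measurable_compose[where g = "\<lambda>p. (LEAST j. p j)"]) simp
  then show ?thesis
    by (simp add: P_def draw_def[abs_def])
qed

lemma sets_urn_space [measurable_cong]: "sets urn_space = sets (PiM UNIV (\<lambda>_::nat. borel))"
  unfolding urn_space_eq by (rule sets_PiM_cong) auto

lemma measurable_urn [measurable]:
  "(\<lambda>\<omega>. urn F x \<omega> n) \<in> measurable urn_space (count_space UNIV)"
proof (induction n)
  case 0
  show ?case by simp
next
  case (Suc n)
  have "(\<lambda>\<omega>. add_ball (urn F x \<omega> n) (draw F (urn F x \<omega> n) (\<omega> n))) \<in> measurable urn_space (count_space UNIV)"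
  proof (rule measurable_compose_countable[OF _ Suc])
    fix y
    have "(\<lambda>\<omega>. draw F y (\<omega> n)) \<in> measurable urn_space (count_space UNIV)"
      by measurable
    then show "(\<lambda>\<omega>. add_ball y (draw F y (\<omega> n))) \<in> measurable urn_space (count_space UNIV)"
      by (rule measurable_compose) simp
  qed
  then show ?case
    by (simp only: urn_Suc)
qed

lemma measurable_urn_component [measurable]:
  "(\<lambda>\<omega>. urn F x \<omega> n j) \<in> measurable urn_space (count_space UNIV)"
  by (rule measurable_compose[OF measurable_urn]) simp

section \<open>The law of a single draw\<close>

lemma prob_draw:
  fixes F :: "'n::{finite,wellorder} \<Rightarrow> real \<Rightarrow> real"
  assumes pos: "\<And>k. 0 < F k (real (x k))"
  shows "emeasure unif {u. draw F x u = j} = ennreal (F j (real (x j)) / (\<Sum>k\<in>UNIV. F k (real (x k))))"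
proof -
  define f where "f k = F k (real (x k))" for k
  define S where "S = (\<Sum>k\<in>UNIV. f k)"
  define a where "a = (\<Sum>k\<in>{..<j}. f k)"
  have fpos: "f k > 0" for k using pos by (simp add: f_def)
  have S: "S > 0" unfolding S_def by (intro sum_pos) (auto simp: fpos)
  have a0: "a \<ge> 0" unfolding a_def by (intro sum_nonneg) (simp add: fpos less_imp_le)
  have aj: "(\<Sum>k\<in>{..j}. f k) = a + f j"
  proof -
    have "{..j} = insert j {..<j}" by auto
    then show ?thesis by (simp add: a_def)
  qed
  have aS: "a + f j \<le> S"
    unfolding S_def aj[symmetric] by (intro sum_mono2) (auto simp: fpos less_imp_le)
  have mono: "(\<Sum>k\<in>{..i}. f k) \<le> a" if "i < j" for i
    unfolding a_def using that by (intro sum_mono2) (auto simp: fpos less_imp_le)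
  have draw_le: "draw F x u \<le> i" if "u * S < (\<Sum>k\<in>{..i}. f k)" for u i
    unfolding draw_def using that by (intro Least_le) (simp add: S_def f_def)
  have draw_prop: "u * S < (\<Sum>k\<in>{..draw F x u}. f k)" if "u < 1" for u
  proof -
    have "{..Max UNIV} = (UNIV :: 'n set)" by auto
    then have "(\<Sum>k\<in>{..Max UNIV}. f k) = S"
      by (simp add: S_def)
    then have "u * S < (\<Sum>k\<in>{..Max UNIV}. f k)"
      using that S by simp
    then show ?thesis
      unfolding draw_def S_def f_def by (rule LeastI)
  qed
  have iff: "draw F x u = j \<longleftrightarrow> a \<le> u * S \<and> u * S < a + f j" if u: "0 \<le> u" "u < 1" for u
  proof
    assume d: "draw F x u = j"
    have "a \<le> u * S"
    proof (rule ccontr)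
      assume "\<not> a \<le> u * S"
      then have *: "u * S < a" by simp
      with u S have "a \<noteq> 0" by (metis less_le_not_le mult_nonneg_nonneg less_imp_le)
      then have ne: "{..<j} \<noteq> {}" unfolding a_def by auto
      \<comment> \<open>The predecessor of \<open>j\<close> already satisfies the defining
        inequality of \<open>draw\<close>, which contradicts minimality of \<open>j\<close>.\<close>
      define i where "i = Max {..<j}"
      have "i < j" using Max_in[OF _ ne] by (auto simp: i_def)
      have "{..i} = {..<j}"
        using \<open>i < j\<close> by (auto simp: i_def)
      then have "u * S < (\<Sum>k\<in>{..i}. f k)" using * by (simp add: a_def)
      from draw_le[OF this] d \<open>i < j\<close> show False by simp
    qed
    moreover have "u * S < a + f j"
      using draw_prop[OF u(2)] d aj by simp
    ultimately show "a \<le> u * S \<and> u * S < a + f j" ..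
  next
    assume h: "a \<le> u * S \<and> u * S < a + f j"
    then have "draw F x u \<le> j" by (intro draw_le) (simp add: aj)
    moreover have "\<not> draw F x u < j"
      using mono[of "draw F x u"] draw_prop[OF u(2)] h by force
    ultimately show "draw F x u = j" by simp
  qed
  have meas: "{u. draw F x u = j} \<in> sets borel"
    using measurable_sets[OF measurable_draw, of "{j}" F x] by (simp add: vimage_def)
  have "emeasure unif {u. draw F x u = j} = emeasure lborel ({0..1} \<inter> {u. draw F x u = j})"
    using meas by (simp add: divide_ennreal_def)
  also have "\<dots> = emeasure lborel {a / S ..< (a + f j) / S}"
  proof (rule emeasure_eq_AE)
    show "AE u in lborel. (u \<in> {0..1} \<inter> {u. draw F x u = j}) = (u \<in> {a / S..<(a + f j) / S})"
    \<comment> \<open>At \<open>u = 1\<close> no agent satisfies the strict inequality in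
      \<open>draw\<close>, so \<open>LEAST\<close> is arbitrary there; this one point is a null
      set.\<close>
    proof (rule AE_mp[OF AE_lborel_singleton[of 1]], rule AE_I2, rule impI)
      fix u :: real assume "u \<noteq> 1"
      show "(u \<in> {0..1} \<inter> {u. draw F x u = j}) = (u \<in> {a / S..<(a + f j) / S})"
      proof
        assume "u \<in> {0..1} \<inter> {u. draw F x u = j}"
        then show "u \<in> {a / S..<(a + f j) / S}"
          using iff[of u] \<open>u \<noteq> 1\<close> S by (auto simp: field_simps)
      next
        assume u: "u \<in> {a / S..<(a + f j) / S}"
        have "0 \<le> u" using u a0 S by (auto intro: order_trans[of _ "a / S"])
        moreover have "u < 1"
        proof -
          have "u < (a + f j) / S" using u by simp
          also have "\<dots> \<le> 1" using aS S by simp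
          finally show ?thesis .
        qed
        ultimately show "u \<in> {0..1} \<inter> {u. draw F x u = j}"
          using iff[of u] u S by (auto simp: field_simps)
      qed
    qed
  qed (use meas in auto)
  also have "\<dots> = ennreal ((a + f j) / S - a / S)"
    using fpos[of j] S by (simp add: emeasure_lborel_Ico divide_right_mono)
  also have "(a + f j) / S - a / S = f j / S" by (simp add: add_divide_distrib)
  finally show ?thesis by (simp add: f_def S_def)
qed

lemma nn_integral_draw:
  fixes F :: "'n::{finite,wellorder} \<Rightarrow> real \<Rightarrow> real"
  assumes pos: "\<And>k. 0 < F k (real (x k))" and g: "\<And>j. 0 \<le> g j"
  shows "(\<integral>\<^sup>+ u. ennreal (g (draw F x u)) \<partial>unif)
    = ennreal ((\<Sum>j\<in>UNIV. F j (real (x j)) * g j) / (\<Sum>k\<in>UNIV. F k (real (x k))))"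
proof -
  define S where "S = (\<Sum>k\<in>UNIV. F k (real (x k)))"
  have S: "S > 0" unfolding S_def by (intro sum_pos) (auto simp: pos)
  have meas: "{u. draw F x u = j} \<in> sets borel" for j
    using measurable_sets[OF measurable_draw, of "{j}" F x] by (simp add: vimage_def)
  have "(\<integral>\<^sup>+ u. ennreal (g (draw F x u)) \<partial>unif)
      = (\<integral>\<^sup>+ u. (\<Sum>j\<in>UNIV. ennreal (g j) * indicator {u. draw F x u = j} u) \<partial>unif)"
  proof (rule nn_integral_cong)
    fix u
    have "(\<Sum>j\<in>UNIV. ennreal (g j) * indicator {u. draw F x u = j} u)
        = (\<Sum>j\<in>{draw F x u}. ennreal (g j) * indicator {u. draw F x u = j} u)"
      by (intro sum.mono_neutral_right) (auto simp: indicator_def)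
    then show "ennreal (g (draw F x u)) = (\<Sum>j\<in>UNIV. ennreal (g j) * indicator {u. draw F x u = j} u)"
      by simp
  qed
  also have "\<dots> = (\<Sum>j\<in>UNIV. ennreal (g j) * emeasure unif {u. draw F x u = j})"
    using meas by (subst nn_integral_sum) (auto simp: nn_integral_cmult_indicator)
  also have "\<dots> = (\<Sum>j\<in>UNIV. ennreal (F j (real (x j)) * g j / S))"
    using g by (intro sum.cong refl, subst prob_draw[where F = F and x = x, OF pos])
      (simp_all add: S_def[symmetric] ennreal_mult'[symmetric] mult.commute)
  also have "\<dots> = ennreal (\<Sum>j\<in>UNIV. F j (real (x j)) * g j / S)"
    using pos g S by (intro sum_ennreal) (simp add: less_imp_le)
  finally show ?thesis
    by (simp add: S_def sum_divide_distrib)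
qed

lemma urn_mono: "m \<le> n \<Longrightarrow> urn F x \<omega> m j \<le> urn F x \<omega> n j"
  by (induction rule: dec_induct) (auto simp: Let_def)

lemma sum_urn:
  fixes F :: "'n::{finite,wellorder} \<Rightarrow> real \<Rightarrow> real"
  shows "(\<Sum>j\<in>UNIV. urn F x \<omega> n j) = (\<Sum>j\<in>UNIV. x j) + n"
proof (induction n)
  case (Suc n)
  have "(\<Sum>j\<in>UNIV. add_ball y i j) = (\<Sum>j\<in>UNIV. y j) + 1" for y :: "'n \<Rightarrow> nat" and i
    by (subst (1 2) sum.remove[of UNIV i]) (auto simp: add_ball_def)
  then show ?case using Suc by (simp only: urn_Suc)
qed simp

text \<open>The optional stopping bound for a nonnegative superharmonic \<open>h\<close> that is at
  least 1 on the target. Ball counts never decrease, so having reached \<open>K\<close> by time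
  \<open>n\<close> means holding \<open>K\<close> at time \<open>n\<close>: an induction on
  \<open>n\<close> replaces stopping times. \<open>G\<close> is a closed set of states to which the
  hypotheses on \<open>h\<close> can be confined.\<close>

lemma prob_reach_le:
  fixes F :: "'n::{finite,wellorder} \<Rightarrow> real \<Rightarrow> real"
  assumes closed: "\<And>x j. x \<in> G \<Longrightarrow> add_ball x j \<in> G"
    and pos: "\<And>x k. x \<in> G \<Longrightarrow> 0 < F k (real (x k))"
    and nonneg: "\<And>x. x \<in> G \<Longrightarrow> 0 \<le> h x"
    and one: "\<And>x. x \<in> G \<Longrightarrow> K \<le> x j \<Longrightarrow> 1 \<le> h x"
    and super: "\<And>x. x \<in> G \<Longrightarrow>
      (\<Sum>k\<in>UNIV. F k (real (x k)) * h (add_ball x k)) \<le> (\<Sum>k\<in>UNIV. F k (real (x k))) * h x"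
    and x: "x \<in> G"
  shows "measure urn_space {\<omega> \<in> space urn_space. \<exists>n. K \<le> urn F x \<omega> n j} \<le> h x"
proof -
  interpret prob_space urn_space by (rule prob_space_urn_space)
  define A where "A x n = {\<omega> \<in> space urn_space. K \<le> urn F x \<omega> n j}" for x n
  have A [measurable]: "A x n \<in> sets urn_space" for x n
    unfolding A_def by measurable
  have step: "emeasure urn_space (A x n) \<le> ennreal (h x)" if "x \<in> G" for x n
    using that
  proof (induction n arbitrary: x)
    case 0
    show ?case
    proof (cases "K \<le> x j")
      case True
      then show ?thesis
        using one[OF 0] by (intro order_trans[OF emeasure_le_1]) simp
    next
      case False
      then have "A x 0 = {}" by (auto simp: A_def)
      then show ?thesis by simp
    qed
  next
    case (Suc n)
    have space: "space urn_space = UNIV"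
      by (auto simp: urn_space_eq space_PiM)
    have "emeasure urn_space (A x (Suc n)) = (\<integral>\<^sup>+ \<omega>. indicator (A x (Suc n)) \<omega> \<partial>urn_space)"
      by simp
    also have "\<dots> = (\<integral>\<^sup>+ \<omega>. indicator (A x (Suc n)) \<omega>
        \<partial>distr (unif \<Otimes>\<^sub>M urn_space) urn_space (\<lambda>(s, \<omega>). case_nat s \<omega>))"
      unfolding urn_space_eq urn_seq.PiM_iter ..
    also have "\<dots> = (\<integral>\<^sup>+ p. indicator (A x (Suc n)) (case p of (s, \<omega>) \<Rightarrow> case_nat s \<omega>)
        \<partial>(unif \<Otimes>\<^sub>M urn_space))"
      by (rule nn_integral_distr) (auto simp: urn_space_eq intro!: measurable_case_nat')
    also have "\<dots> = (\<integral>\<^sup>+ s. \<integral>\<^sup>+ \<omega>. indicator (A x (Suc n)) (case_nat s \<omega>) \<partial>urn_space \<partial>unif)"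
    proof (subst nn_integral_fst[symmetric])
      have "(\<lambda>(s, \<omega>). case_nat s \<omega>) \<in> measurable (unif \<Otimes>\<^sub>M urn_space) urn_space"
        unfolding urn_space_eq by measurable
      then show "(\<lambda>p. indicator (A x (Suc n)) (case p of (s, \<omega>) \<Rightarrow> case_nat s \<omega>) :: ennreal)
          \<in> borel_measurable (unif \<Otimes>\<^sub>M urn_space)"
        by (rule measurable_compose) measurable
    qed simp
    also have "\<dots> = (\<integral>\<^sup>+ s. emeasure urn_space (A (add_ball x (draw F x s)) n) \<partial>unif)"
    proof (rule nn_integral_cong)
      fix s
      have "indicator (A x (Suc n)) (case_nat s \<omega>) = (indicator (A (add_ball x (draw F x s)) n) \<omega> :: ennreal)" for \<omega>
        by (simp add: A_def space urn_case_nat indicator_def del: urn.simps)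
      then show "(\<integral>\<^sup>+ \<omega>. indicator (A x (Suc n)) (case_nat s \<omega>) \<partial>urn_space)
          = emeasure urn_space (A (add_ball x (draw F x s)) n)"
        by simp
    qed
    also have "\<dots> \<le> (\<integral>\<^sup>+ s. ennreal (h (add_ball x (draw F x s))) \<partial>unif)"
      by (intro nn_integral_mono Suc.IH closed Suc.prems)
    also have "\<dots> = ennreal ((\<Sum>k\<in>UNIV. F k (real (x k)) * h (add_ball x k)) / (\<Sum>k\<in>UNIV. F k (real (x k))))"
      using Suc.prems by (intro nn_integral_draw[where g = "\<lambda>k. h (add_ball x k)"] pos nonneg closed)
    also have "\<dots> \<le> ennreal (h x)"
    proof -
      have "(\<Sum>k\<in>UNIV. F k (real (x k))) > 0"
        using Suc.prems by (intro sum_pos) (auto simp: pos)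
      then show ?thesis
        using super[OF Suc.prems] by (intro ennreal_leI) (simp add: field_simps)
    qed
    finally show ?case .
  qed
  have bound: "measure urn_space (A x n) \<le> h x" for n
    using step[OF x, of n] nonneg[OF x] by (simp add: emeasure_eq_measure)
  have "incseq (A x)"
    by (auto simp: incseq_def A_def intro: order_trans urn_mono)
  then have "(\<lambda>n. measure urn_space (A x n)) \<longlonglongrightarrow> measure urn_space (\<Union>n. A x n)"
    by (intro finite_Lim_measure_incseq) auto
  then have "measure urn_space (\<Union>n. A x n) \<le> h x"
    by (rule LIMSEQ_le_const2) (use bound in auto)
  also have "(\<Union>n. A x n) = {\<omega> \<in> space urn_space. \<exists>n. K \<le> urn F x \<omega> n j}"
    by (auto simp: A_def)
  finally show ?thesis .
qed

section \<open>Tail sums\<close>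

text \<open>Positivity is assumed at positive integers only, because the value of a feedback
  function at 0 is unconstrained; hence the bounds \<open>k \<ge> 1\<close> in the facts
  below.\<close>

locale monopolistic =
  fixes f :: "real \<Rightarrow> real"
  assumes pos: "k \<ge> 1 \<Longrightarrow> 0 < f (real k)" and condM: "condM f"
begin

lemma summable_inverse: "summable (\<lambda>l. 1 / f (real (l + k)))"
proof -
  have "summable (\<lambda>l. 1 / f (real l))"
    using condM unfolding condM_def by (subst (asm) summable_iff_shift[of "\<lambda>l. 1 / f (real l)" 1])
  then show ?thesis
    by (subst summable_iff_shift[of "\<lambda>l. 1 / f (real l)" k])
qed

lemma tail_sum_split: "tail_sum f k = (\<Sum>l = k..<k + n. 1 / f (real l)) + tail_sum f (k + n)"
proof -
  have "tail_sum f k = (\<Sum>l. 1 / f (real (l + n + k))) + (\<Sum>l<n. 1 / f (real (l + k)))"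
    unfolding tail_sum_def by (rule suminf_split_initial_segment[OF summable_inverse])
  also have "(\<Sum>l<n. 1 / f (real (l + k))) = (\<Sum>l = k..<k + n. 1 / f (real l))"
    using sum.shift_bounds_nat_ivl[of "\<lambda>l. 1 / f (real l)" 0 k n]
    by (simp add: lessThan_atLeast0 add.commute)
  finally show ?thesis
    by (simp add: tail_sum_def add_ac)
qed

lemma tail_sum_diff: "k \<le> m \<Longrightarrow> tail_sum f k - tail_sum f m = (\<Sum>l = k..<m. 1 / f (real l))"
  using tail_sum_split[of k "m - k"] by simp

lemma tail_sum_Suc: "tail_sum f k = 1 / f (real k) + tail_sum f (Suc k)"
  using tail_sum_split[of k 1] by simp

lemma tail_sum_pos: "k \<ge> 1 \<Longrightarrow> 0 < tail_sum f k"
  unfolding tail_sum_def by (intro suminf_pos summable_inverse divide_pos_pos pos) auto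

lemma inverse_le_tail_sum: "k \<ge> 1 \<Longrightarrow> 1 / f (real k) \<le> tail_sum f k"
  using tail_sum_Suc[of k] tail_sum_pos[of "Suc k"] by simp

lemma tail_sum_antimono: "k \<ge> 1 \<Longrightarrow> k \<le> m \<Longrightarrow> tail_sum f m \<le> tail_sum f k"
proof -
  assume "k \<ge> 1" "k \<le> m"
  then have "0 \<le> (\<Sum>l = k..<m. 1 / f (real l))"
    by (intro sum_nonneg) (simp add: pos less_imp_le)
  then show ?thesis using tail_sum_diff[OF \<open>k \<le> m\<close>] by simp
qed

lemma partial_sums_tendsto_tail_sum: "(\<lambda>m. \<Sum>l = k..<m. 1 / f (real l)) \<longlonglongrightarrow> tail_sum f k"
proof -
  have "(\<lambda>n. \<Sum>l<n. 1 / f (real (l + k))) \<longlonglongrightarrow> tail_sum f k"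
    unfolding tail_sum_def by (rule summable_LIMSEQ[OF summable_inverse])
  moreover have "(\<Sum>l<n. 1 / f (real (l + k))) = (\<Sum>l = k..<n + k. 1 / f (real l))" for n
    using sum.shift_bounds_nat_ivl[of "\<lambda>l. 1 / f (real l)" 0 k n]
    by (simp add: lessThan_atLeast0)
  ultimately show ?thesis
    using LIMSEQ_offset[of "\<lambda>m. \<Sum>l = k..<m. 1 / f (real l)" k] by simp
qed

end

lemma admissible_pos: "admissible_feedback F \<Longrightarrow> k \<ge> 1 \<Longrightarrow> 0 < F i (real k)"
  by (auto simp: admissible_feedback_def)

lemma monopolisticI: "admissible_feedback F \<Longrightarrow> condM (F i) \<Longrightarrow> monopolistic (F i)"
  by unfold_locales (auto simp: admissible_pos)

section \<open>A supermartingale for the competition of two agents\<close>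

text \<open>Lets the factors \<open>1 - u\<close> gained by the winning agent be replaced by
  exponentials, whose product over all further balls is an explicit function of the tail
  sum.\<close>

lemma exp_neg_le:
  fixes u d :: real
  assumes "0 \<le> u" "u \<le> d" "d \<le> 1 / 2"
  shows "exp (- ((1 + 2 * d) * u)) \<le> 1 - u"
proof -
  have "u\<^sup>2 \<le> d * u"
    using assms by (simp add: power2_eq_square mult_right_mono)
  then have "- ((1 + 2 * d) * u) \<le> - u - 2 * u\<^sup>2"
    by (simp add: algebra_simps)
  also have "\<dots> \<le> ln (1 - u)"
    using assms by (intro ln_one_minus_pos_lower_bound) auto
  finally show ?thesis
    using assms by (subst (asm) ln_ge_iff) auto
qed

text \<open>In continuous time, with independent exponential clocks of rate \<open>F i k\<close>, the bound dominates
  \<open>E exp (\<theta> * (T_i - T_j))\<close>, where \<open>T_i\<close> is the explosion time of agent \<open>i\<close> and \<open>T_j\<close> is the time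
  at which agent \<open>j\<close> reaches \<open>K\<close> balls.\<close>

lemma prob_reach_le_competitor:
  fixes F :: "'n::{finite,wellorder} \<Rightarrow> real \<Rightarrow> real"
  assumes adm: "admissible_feedback F" and M: "condM (F i)" and ij: "i \<noteq> j"
    and x: "\<And>k. 1 \<le> x k" and \<theta>: "0 < \<theta>" and d: "d \<le> 1 / 2"
    and le: "\<And>k. x i \<le> k \<Longrightarrow> \<theta> / F i (real k) \<le> d"
  shows "measure urn_space {\<omega> \<in> space urn_space. \<exists>n. K \<le> urn F x \<omega> n j}
    \<le> exp (\<theta> * (1 + 2 * d) * tail_sum (F i) (x i)) * (\<Prod>k = x j..<K. 1 / (1 + \<theta> / F j (real k)))"
proof -
  interpret monopolistic "F i" by (rule monopolisticI[OF adm M])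
  note Fpos = admissible_pos[OF adm]
  define \<Phi> where "\<Phi> k = exp (\<theta> * (1 + 2 * d) * tail_sum (F i) k)" for k
  define \<Psi> where "\<Psi> m = (\<Prod>k = m..<K. 1 / (1 + \<theta> / F j (real k)))" for m
  \<comment> \<open>Setting \<open>h\<close> to 1 once \<open>j\<close> holds \<open>K\<close> balls
    freezes it there. Before that, a draw of \<open>i\<close> contributes at most
    \<open>(F i - \<theta>) * h\<close> and a draw of \<open>j\<close> at most
    \<open>(F j + \<theta>) * h\<close>, so the two corrections cancel.\<close>
  define h where "h y = (if K \<le> y j then 1 else \<Phi> (y i) * \<Psi> (y j))" for y
  define G where "G = {y. (\<forall>k. 1 \<le> y k) \<and> x i \<le> y i}"
  have d0: "0 \<le> d"
    using order_trans[OF _ le[of "x i"], of 0] \<theta> Fpos[of "x i" i] x[of i] by simp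
  have \<Phi>1: "1 \<le> \<Phi> k" if "1 \<le> k" for k
    using \<theta> d0 tail_sum_pos[OF that] by (simp add: \<Phi>_def)
  have \<Psi>0: "0 < \<Psi> m" if "1 \<le> m" for m
    unfolding \<Psi>_def using that \<theta> by (intro prod_pos) (simp add: Fpos add_pos_pos)
  have \<Phi>_Suc: "F i (real k) * \<Phi> (Suc k) \<le> (F i (real k) - \<theta>) * \<Phi> k" if "x i \<le> k" for k
  proof -
    have k1: "1 \<le> k" using that x[of i] by simp
    have "\<Phi> (Suc k) = \<Phi> k * exp (- ((1 + 2 * d) * (\<theta> / F i (real k))))"
      unfolding \<Phi>_def by (subst tail_sum_Suc[of k]) (simp add: exp_add[symmetric] field_simps)
    also have "\<dots> \<le> \<Phi> k * (1 - \<theta> / F i (real k))"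
      using le[OF that] d \<theta> Fpos[OF k1, of i]
      by (intro mult_left_mono exp_neg_le) (auto simp: \<Phi>_def)
    finally have "F i (real k) * \<Phi> (Suc k) \<le> F i (real k) * (\<Phi> k * (1 - \<theta> / F i (real k)))"
      using Fpos[OF k1, of i] by (intro mult_left_mono) auto
    also have "\<dots> = (F i (real k) - \<theta>) * \<Phi> k"
      using Fpos[OF k1, of i] by (simp add: field_simps)
    finally show ?thesis .
  qed
  have \<Psi>_Suc: "F j (real m) * \<Psi> (Suc m) = (F j (real m) + \<theta>) * \<Psi> m" if "1 \<le> m" "m < K" for m
  proof -
    have "\<Psi> m = 1 / (1 + \<theta> / F j (real m)) * \<Psi> (Suc m)"
      unfolding \<Psi>_def by (rule prod.atLeast_Suc_lessThan[OF that(2)])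
    then show ?thesis
      using \<theta> Fpos[OF that(1), of j] by (simp add: field_simps)
  qed
  have "measure urn_space {\<omega> \<in> space urn_space. \<exists>n. K \<le> urn F x \<omega> n j} \<le> h x"
  proof (rule prob_reach_le[where G = G])
    show "x \<in> G" using x by (simp add: G_def)
    fix y assume y: "y \<in> G"
    then have y1: "1 \<le> y k" for k by (simp add: G_def)
    show "add_ball y k \<in> G" for k
      using y by (auto simp: G_def add_ball_def le_SucI)
    show "0 < F k (real (y k))" for k
      using Fpos y1 by blast
    show "0 \<le> h y"
      using \<Phi>1[OF y1, of i] \<Psi>0[OF y1, of j] by (simp add: h_def)
    show "1 \<le> h y" if "K \<le> y j"
      using that by (simp add: h_def)
    show "(\<Sum>k\<in>UNIV. F k (real (y k)) * h (add_ball y k)) \<le> (\<Sum>k\<in>UNIV. F k (real (y k))) * h y"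
    proof (cases "K \<le> y j")
      case True
      then have "h (add_ball y k) = 1" for k
        by (auto simp: h_def add_ball_def)
      then show ?thesis using True by (simp add: h_def)
    next
      case False
      have other: "h (add_ball y k) = h y" if "k \<noteq> i" "k \<noteq> j" for k
        using that by (simp add: h_def add_ball_def)
      have hy: "h y = \<Phi> (y i) * \<Psi> (y j)" using False by (simp add: h_def)
      have hi: "F i (real (y i)) * h (add_ball y i) \<le> (F i (real (y i)) - \<theta>) * h y"
      proof -
        have "h (add_ball y i) = \<Phi> (Suc (y i)) * \<Psi> (y j)"
          using False ij by (simp add: h_def add_ball_def)
        then show ?thesis
          using mult_right_mono[OF \<Phi>_Suc[of "y i"], of "\<Psi> (y j)"] y \<Psi>0[OF y1, of j]
          by (simp add: hy G_def mult.assoc)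
      qed
      have hj: "F j (real (y j)) * h (add_ball y j) \<le> (F j (real (y j)) + \<theta>) * h y"
      proof -
        \<comment> \<open>Equality unless the new ball is the \<open>K\<close>-th; then the product
          is empty and \<open>h\<close> takes the value 1, which is at most
          \<open>\<Phi>\<close>.\<close>
        have "h (add_ball y j) \<le> \<Phi> (y i) * \<Psi> (Suc (y j))"
        proof (cases "K \<le> Suc (y j)")
          case True
          then have "\<Psi> (Suc (y j)) = 1" by (simp add: \<Psi>_def)
          then show ?thesis using True \<Phi>1[OF y1, of i] by (simp add: h_def add_ball_def)
        next
          case False
          then show ?thesis using ij by (simp add: h_def add_ball_def)
        qed
        then have "F j (real (y j)) * h (add_ball y j) \<le> F j (real (y j)) * (\<Phi> (y i) * \<Psi> (Suc (y j)))"
          using Fpos[OF y1[of j], of j] by (intro mult_left_mono) auto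
        also have "\<dots> = \<Phi> (y i) * (F j (real (y j)) * \<Psi> (Suc (y j)))"
          by (rule mult.left_commute)
        also have "\<dots> = (F j (real (y j)) + \<theta>) * h y"
          unfolding \<Psi>_Suc[OF y1 not_le_imp_less[OF False]] hy by (rule mult.left_commute)
        finally show ?thesis .
      qed
      have split: "(\<Sum>k\<in>UNIV. g k) = g i + g j + (\<Sum>k\<in>UNIV - {i, j}. g k)" for g :: "'n \<Rightarrow> real"
        using ij sum.subset_diff[of "{i, j}" UNIV g] by (simp add: add.commute)
      have "(\<Sum>k\<in>UNIV - {i, j}. F k (real (y k)) * h (add_ball y k)) = (\<Sum>k\<in>UNIV - {i, j}. F k (real (y k))) * h y"
        unfolding sum_distrib_right by (intro sum.cong) (auto simp: other)
      then show ?thesis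
        using hi hj by (simp add: split algebra_simps)
    qed
  qed
  also have "h x \<le> \<Phi> (x i) * \<Psi> (x j)"
  proof (cases "K \<le> x j")
    case True
    then have "\<Psi> (x j) = 1" by (simp add: \<Psi>_def)
    then show ?thesis using True \<Phi>1[OF x, of i] by (simp add: h_def)
  qed (simp add: h_def)
  finally show ?thesis
    by (simp add: \<Phi>_def \<Psi>_def)
qed

section \<open>Agents that almost surely stay bounded in the limit\<close>

definition unbounded_prob :: "('n::{finite,wellorder} \<Rightarrow> real \<Rightarrow> real) \<Rightarrow> ('n \<Rightarrow> nat) \<Rightarrow> 'n \<Rightarrow> real" where
  "unbounded_prob F x j = measure urn_space {\<omega> \<in> space urn_space. \<forall>K. \<exists>n. K \<le> urn F x \<omega> n j}"

definition dies :: "('n::{finite,wellorder} \<Rightarrow> real \<Rightarrow> real) \<Rightarrow> real^('n::{finite,wellorder}) \<Rightarrow> 'n \<Rightarrow> bool" where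
  "dies F c j \<longleftrightarrow> ((\<lambda>N. unbounded_prob F (init_config c N) j) \<longlongrightarrow> 0) sequentially"

lemma unbounded_prob_nonneg: "0 \<le> unbounded_prob F x j"
  by (simp add: unbounded_prob_def)

lemma unbounded_prob_le_reach:
  "unbounded_prob F x j \<le> measure urn_space {\<omega> \<in> space urn_space. \<exists>n. K \<le> urn F x \<omega> n j}"
proof -
  interpret prob_space urn_space by (rule prob_space_urn_space)
  show ?thesis
    unfolding unbounded_prob_def by (intro finite_measure_mono) auto
qed

lemma one_plus_sum_le_prod:
  fixes u :: "'b \<Rightarrow> real"
  assumes "finite A" "\<And>k. k \<in> A \<Longrightarrow> 0 \<le> u k"
  shows "1 + (\<Sum>k\<in>A. u k) \<le> (\<Prod>k\<in>A. 1 + u k)"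
  using assms
proof (induction A)
  case (insert a A)
  have "1 + (\<Sum>k\<in>insert a A. u k) \<le> (1 + u a) * (1 + (\<Sum>k\<in>A. u k))"
    using insert by (simp add: algebra_simps sum_nonneg)
  also have "\<dots> \<le> (1 + u a) * (\<Prod>k\<in>A. 1 + u k)"
    using insert by (intro mult_left_mono) auto
  finally show ?case using insert by simp
qed simp

text \<open>With \<open>\<theta>\<close> half the reciprocal of the tail of \<open>i\<close>, every
  \<open>\<theta> / F i k\<close> is at most 1/2, since a term is at most its tail; for
  \<open>d = 1 / 2\<close> the exponential factor becomes \<open>exp 1\<close>. The product is
  estimated through 1 plus the sum, which is useful for convergent and divergent sums alike.\<close>

lemma unbounded_prob_le_fraction:
  fixes F :: "'n::{finite,wellorder} \<Rightarrow> real \<Rightarrow> real"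
  assumes adm: "admissible_feedback F" and M: "condM (F i)" and ij: "i \<noteq> j"
    and x: "\<And>k. 1 \<le> x k"
  shows "unbounded_prob F x j
    \<le> exp 1 / (1 + (\<Sum>k = x j..<K. 1 / F j (real k)) / (2 * tail_sum (F i) (x i)))"
proof -
  interpret monopolistic "F i" by (rule monopolisticI[OF adm M])
  note Fpos = admissible_pos[OF adm]
  define \<theta> where "\<theta> = 1 / (2 * tail_sum (F i) (x i))"
  have R: "0 < tail_sum (F i) (x i)" by (rule tail_sum_pos[OF x])
  then have \<theta>: "0 < \<theta>" by (simp add: \<theta>_def)
  have le: "\<theta> / F i (real k) \<le> 1 / 2" if "x i \<le> k" for k
  proof -
    have k: "1 \<le> k" using that x[of i] by simp
    have "\<theta> / F i (real k) = \<theta> * (1 / F i (real k))" by simp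
    also have "\<dots> \<le> \<theta> * tail_sum (F i) (x i)"
      using \<theta> inverse_le_tail_sum[OF k] tail_sum_antimono[OF x that]
      by (intro mult_left_mono) auto
    also have "\<dots> = 1 / 2" using R by (simp add: \<theta>_def)
    finally show ?thesis .
  qed
  have nonneg: "0 \<le> \<theta> / F j (real k)" if "k \<in> {x j..<K}" for k
    using that \<theta> Fpos[of k j] x[of j] by simp
  have "unbounded_prob F x j \<le> exp (\<theta> * (1 + 2 * (1 / 2)) * tail_sum (F i) (x i))
      * (\<Prod>k = x j..<K. 1 / (1 + \<theta> / F j (real k)))"
    by (rule order_trans[OF unbounded_prob_le_reach prob_reach_le_competitor[OF adm M ij x \<theta> _ le]]) auto
  also have "\<theta> * (1 + 2 * (1 / 2)) * tail_sum (F i) (x i) = 1"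
    using R by (simp add: \<theta>_def)
  also have "(\<Prod>k = x j..<K. 1 / (1 + \<theta> / F j (real k))) = 1 / (\<Prod>k = x j..<K. 1 + \<theta> / F j (real k))"
    by (simp add: prod_dividef)
  also have "exp 1 * (1 / (\<Prod>k = x j..<K. 1 + \<theta> / F j (real k)))
      \<le> exp 1 * (1 / (1 + (\<Sum>k = x j..<K. \<theta> / F j (real k))))"
    using one_plus_sum_le_prod[of "{x j..<K}" "\<lambda>k. \<theta> / F j (real k)"] nonneg
    by (intro mult_left_mono divide_left_mono mult_pos_pos prod_pos add_pos_nonneg sum_nonneg) auto
  also have "(\<Sum>k = x j..<K. \<theta> / F j (real k)) = (\<Sum>k = x j..<K. 1 / F j (real k)) / (2 * tail_sum (F i) (x i))"
    by (simp add: \<theta>_def sum_divide_distrib mult.commute)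
  finally show ?thesis by simp
qed

text \<open>The partial sums of \<open>1 / F j\<close> are unbounded when (M) fails, so the fraction
  bound becomes arbitrarily small as \<open>K\<close> grows.\<close>

lemma unbounded_prob_eq_0:
  fixes F :: "'n::{finite,wellorder} \<Rightarrow> real \<Rightarrow> real"
  assumes adm: "admissible_feedback F" and M: "condM (F i)" and nM: "\<not> condM (F j)"
    and x: "\<And>k. 1 \<le> x k"
  shows "unbounded_prob F x j = 0"
proof -
  interpret monopolistic "F i" by (rule monopolisticI[OF adm M])
  note Fpos = admissible_pos[OF adm]
  have ij: "i \<noteq> j" using M nM by auto
  have R: "0 < tail_sum (F i) (x i)" by (rule tail_sum_pos[OF x])
  define s where "s K = (\<Sum>k = x j..<K. 1 / F j (real k))" for K
  have unbdd: "\<exists>K. B < s K" for B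
  proof (rule ccontr)
    assume "\<not> (\<exists>K. B < s K)"
    then have le: "s K \<le> B" for K by (auto simp: not_less)
    have "summable (\<lambda>l. 1 / F j (real (l + x j)))"
    proof (rule summableI_nonneg_bounded)
      show "0 \<le> 1 / F j (real (l + x j))" for l
        using Fpos[of "l + x j" j] x[of j] by (simp add: trans_le_add2 less_imp_le)
      show "(\<Sum>l<n. 1 / F j (real (l + x j))) \<le> B" for n
        using le[of "n + x j"] sum.shift_bounds_nat_ivl[of "\<lambda>l. 1 / F j (real l)" 0 "x j" n]
        by (simp add: s_def lessThan_atLeast0)
    qed
    then have "summable (\<lambda>l. 1 / F j (real l))"
      by (subst (asm) summable_iff_shift[of "\<lambda>l. 1 / F j (real l)" "x j"])
    then have "condM (F j)"
      unfolding condM_def by (subst summable_iff_shift[of "\<lambda>l. 1 / F j (real l)" 1])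
    with nM show False ..
  qed
  have "unbounded_prob F x j \<le> 0 + e" if e: "0 < e" for e
  proof -
    obtain K where K: "exp 1 / e * (2 * tail_sum (F i) (x i)) < s K" using unbdd by blast
    then have "exp 1 / e < s K / (2 * tail_sum (F i) (x i))"
      using R by (simp add: field_simps)
    then have *: "exp 1 / e < 1 + s K / (2 * tail_sum (F i) (x i))" by simp
    have "unbounded_prob F x j \<le> exp 1 / (1 + s K / (2 * tail_sum (F i) (x i)))"
      unfolding s_def by (rule unbounded_prob_le_fraction[OF adm M ij x])
    also have "\<dots> \<le> e"
    proof -
      have "0 < exp 1 / e" using e by simp
      with * have "0 < 1 + s K / (2 * tail_sum (F i) (x i))" by linarith
      then show ?thesis using * e by (simp add: field_simps)
    qed
    finally show ?thesis by simp
  qed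
  then have "unbounded_prob F x j \<le> 0" by (rule field_le_epsilon)
  then show ?thesis using unbounded_prob_nonneg[of F x j] by simp
qed

text \<open>The fraction bound in the limit of large \<open>K\<close>, now with convergent partial
  sums. It is informative when the ratio of tails tends to 0.\<close>

lemma unbounded_prob_le_ratio:
  fixes F :: "'n::{finite,wellorder} \<Rightarrow> real \<Rightarrow> real"
  assumes adm: "admissible_feedback F" and Mi: "condM (F i)" and Mj: "condM (F j)" and ij: "i \<noteq> j"
    and x: "\<And>k. 1 \<le> x k"
  shows "unbounded_prob F x j \<le> 2 * exp 1 * (tail_sum (F i) (x i) / tail_sum (F j) (x j))"
proof -
  interpret i: monopolistic "F i" by (rule monopolisticI[OF adm Mi])
  interpret j: monopolistic "F j" by (rule monopolisticI[OF adm Mj])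
  define r where "r = tail_sum (F i) (x i)"
  define s where "s = tail_sum (F j) (x j)"
  have r: "0 < r" unfolding r_def by (rule i.tail_sum_pos[OF x])
  have s: "0 < s" unfolding s_def by (rule j.tail_sum_pos[OF x])
  have "(\<lambda>K. exp 1 / (1 + (\<Sum>k = x j..<K. 1 / F j (real k)) / (2 * r))) \<longlonglongrightarrow> exp 1 / (1 + s / (2 * r))"
    unfolding s_def using r s
    by (intro tendsto_intros j.partial_sums_tendsto_tail_sum) (auto simp: s_def add_pos_pos less_imp_neq[THEN not_sym])
  then have "unbounded_prob F x j \<le> exp 1 / (1 + s / (2 * r))"
    by (rule LIMSEQ_le_const) (use unbounded_prob_le_fraction[OF adm Mi ij, of x] x in \<open>auto simp: r_def\<close>)
  also have "\<dots> \<le> exp 1 / (s / (2 * r))"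
    using r s by (intro divide_left_mono mult_pos_pos add_pos_pos) auto
  finally show ?thesis
    using r s by (simp add: r_def[symmetric] s_def[symmetric] mult_ac)
qed

lemma inverse_one_plus_le_exp:
  fixes u d :: real
  assumes "0 \<le> u" "u \<le> d" "d \<le> 1"
  shows "1 / (1 + u) \<le> exp (- ((1 - d) * u))"
proof -
  have "u\<^sup>2 \<le> d * u"
    using assms by (simp add: power2_eq_square mult_right_mono)
  then have "(1 - d) * u \<le> u - u\<^sup>2"
    by (simp add: algebra_simps)
  also have "\<dots> \<le> ln (1 + u)"
    using assms by (intro ln_one_plus_pos_lower_bound) auto
  finally have "exp ((1 - d) * u) \<le> 1 + u"
    using assms by (subst (asm) ln_ge_iff) auto
  then have "1 / (1 + u) \<le> 1 / exp ((1 - d) * u)"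
    using assms by (intro divide_left_mono) auto
  then show ?thesis
    by (simp add: exp_minus inverse_eq_divide)
qed

text \<open>A Chernoff bound: both factors are kept in exponential form, so the exponent is
  \<open>\<theta>\<close> times a perturbed difference of the two tails. The price is that all
  single terms from the initial counts on must be small compared with
  \<open>1 / \<theta>\<close>.\<close>

lemma unbounded_prob_le_exp:
  fixes F :: "'n::{finite,wellorder} \<Rightarrow> real \<Rightarrow> real"
  assumes adm: "admissible_feedback F" and Mi: "condM (F i)" and Mj: "condM (F j)" and ij: "i \<noteq> j"
    and x: "\<And>k. 1 \<le> x k" and \<theta>: "0 < \<theta>" and d: "d \<le> 1 / 2"
    and lei: "\<And>k. x i \<le> k \<Longrightarrow> \<theta> / F i (real k) \<le> d"
    and lej: "\<And>k. x j \<le> k \<Longrightarrow> \<theta> / F j (real k) \<le> d"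
  shows "unbounded_prob F x j
    \<le> exp (\<theta> * ((1 + 2 * d) * tail_sum (F i) (x i) - (1 - d) * tail_sum (F j) (x j)))"
proof -
  interpret j: monopolistic "F j" by (rule monopolisticI[OF adm Mj])
  define r where "r = tail_sum (F i) (x i)"
  have bound: "unbounded_prob F x j \<le> exp (\<theta> * (1 + 2 * d) * r) * exp (- ((1 - d) * (\<theta> * (\<Sum>k = x j..<K. 1 / F j (real k)))))" for K
  proof -
    have "unbounded_prob F x j \<le> exp (\<theta> * (1 + 2 * d) * r) * (\<Prod>k = x j..<K. 1 / (1 + \<theta> / F j (real k)))"
      unfolding r_def
      by (rule order_trans[OF unbounded_prob_le_reach prob_reach_le_competitor[OF adm Mi ij x \<theta> d lei]])
    also have "(\<Prod>k = x j..<K. 1 / (1 + \<theta> / F j (real k)))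
        \<le> (\<Prod>k = x j..<K. exp (- ((1 - d) * (\<theta> / F j (real k)))))"
    proof (intro prod_mono conjI)
      fix k assume k: "k \<in> {x j..<K}"
      then have "0 < F j (real k)" using x[of j] by (intro admissible_pos[OF adm]) simp
      then show "0 \<le> 1 / (1 + \<theta> / F j (real k))" using \<theta> by simp
      show "1 / (1 + \<theta> / F j (real k)) \<le> exp (- ((1 - d) * (\<theta> / F j (real k))))"
        using k lej[of k] d \<theta> \<open>0 < F j (real k)\<close> by (intro inverse_one_plus_le_exp) auto
    qed
    also have "\<dots> = exp (- ((1 - d) * (\<theta> * (\<Sum>k = x j..<K. 1 / F j (real k)))))"
      by (simp add: exp_sum[symmetric] sum_distrib_left sum_negf)
    finally show ?thesis by simp
  qed
  have "(\<lambda>K. exp (\<theta> * (1 + 2 * d) * r) * exp (- ((1 - d) * (\<theta> * (\<Sum>k = x j..<K. 1 / F j (real k))))))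
      \<longlonglongrightarrow> exp (\<theta> * (1 + 2 * d) * r) * exp (- ((1 - d) * (\<theta> * tail_sum (F j) (x j))))"
    by (intro tendsto_intros j.partial_sums_tendsto_tail_sum)
  then have "unbounded_prob F x j \<le> exp (\<theta> * (1 + 2 * d) * r) * exp (- ((1 - d) * (\<theta> * tail_sum (F j) (x j))))"
    by (rule LIMSEQ_le_const) (use bound in auto)
  then show ?thesis
    by (simp add: exp_add[symmetric] r_def algebra_simps)
qed

section \<open>Criteria along the initial configurations\<close>

lemma init_config_ge_1: "c \<in> std_simplex_interior \<Longrightarrow> 1 \<le> N \<Longrightarrow> 1 \<le> init_config c N k"
proof -
  assume "c \<in> std_simplex_interior" "1 \<le> N"
  then have "0 < c $ k * real N" by (simp add: std_simplex_interior_def)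
  then show ?thesis by (simp add: init_config_def Suc_le_eq)
qed

lemma dies_not_condM:
  assumes "admissible_feedback F" "condM (F i)" "\<not> condM (F j)" "c \<in> std_simplex_interior"
  shows "dies F c j"
  unfolding dies_def
  by (rule tendsto_eventually, rule eventually_mono[OF eventually_ge_at_top[of 1]])
    (intro unbounded_prob_eq_0[OF assms(1-3)] init_config_ge_1[OF assms(4)])

lemma dies_tail_ratio:
  assumes adm: "admissible_feedback F" and M: "condM (F i)" "condM (F j)" and ij: "i \<noteq> j"
    and c: "c \<in> std_simplex_interior"
    and lim: "(\<lambda>N. tail_sum (F i) (nat \<lceil>c $ i * real N\<rceil>) / tail_sum (F j) (nat \<lceil>c $ j * real N\<rceil>)) \<longlonglongrightarrow> 0"
  shows "dies F c j"
  unfolding dies_def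
proof (rule tendsto_sandwich[OF _ _ tendsto_const])
  show "(\<lambda>N. 2 * exp 1 * (tail_sum (F i) (nat \<lceil>c $ i * real N\<rceil>) / tail_sum (F j) (nat \<lceil>c $ j * real N\<rceil>))) \<longlonglongrightarrow> 0"
    using tendsto_mult_left[OF lim, of "2 * exp 1"] by simp
  show "\<forall>\<^sub>F N in sequentially. unbounded_prob F (init_config c N) j
      \<le> 2 * exp 1 * (tail_sum (F i) (nat \<lceil>c $ i * real N\<rceil>) / tail_sum (F j) (nat \<lceil>c $ j * real N\<rceil>))"
    using eventually_ge_at_top[of 1]
  proof eventually_elim
    case (elim N)
    show ?case
      using unbounded_prob_le_ratio[OF adm M ij init_config_ge_1[OF c elim]]
      by (simp add: init_config_def)
  qed
qed (simp add: unbounded_prob_nonneg)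

lemma filterlim_nat_ceiling: "0 < a \<Longrightarrow> filterlim (\<lambda>N. nat \<lceil>a * real N\<rceil>) at_top sequentially"
proof (unfold filterlim_at_top, intro allI)
  fix Z :: nat assume a: "0 < a"
  show "\<forall>\<^sub>F N in sequentially. Z \<le> nat \<lceil>a * real N\<rceil>"
    using eventually_ge_at_top[of "nat \<lceil>real Z / a\<rceil>"]
  proof eventually_elim
    case (elim N)
    then have "real Z / a \<le> real N" by linarith
    then have "real Z \<le> a * real N" using a by (simp add: field_simps)
    then show ?case by linarith
  qed
qed

text \<open>Under type P a single term is negligible against the tail, so the Chernoff bound is
  available with \<open>\<theta>\<close> equal to an arbitrarily large multiple \<open>b\<close> of
  the reciprocal tail of \<open>j\<close>. The gap between \<open>q\<close> and 1 then makes the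
  exponent at most \<open>- (b * ((1 - p) / 2))\<close>.\<close>

lemma dies_typeP:
  assumes adm: "admissible_feedback F" and P: "typeP (F i)" "typeP (F j)" and ij: "i \<noteq> j"
    and c: "c \<in> std_simplex_interior" and q: "q < 1"
    and le: "\<forall>\<^sub>F N in sequentially. tail_sum (F i) (nat \<lceil>c $ i * real N\<rceil>) \<le> q * tail_sum (F j) (nat \<lceil>c $ j * real N\<rceil>)"
  shows "dies F c j"
proof -
  have M: "condM (F i)" "condM (F j)" using P by (auto simp: typeP_def)
  interpret i: monopolistic "F i" by (rule monopolisticI[OF adm M(1)])
  interpret j: monopolistic "F j" by (rule monopolisticI[OF adm M(2)])
  have cpos: "0 < c $ k" for k using c by (simp add: std_simplex_interior_def)
  define p where "p = max q 0"
  have p: "0 \<le> p" "p < 1" "q \<le> p" using q by (auto simp: p_def)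
  \<comment> \<open>With this value, \<open>(1 + 2 * d) * p - (1 - d) \<le> p - 1 + 3 * d\<close>,
    and the right-hand side is \<open>- ((1 - p) / 2)\<close>: half of the gap survives the
    perturbation.\<close>
  define d where "d = (1 - p) / 6"
  have d: "0 < d" "d \<le> 1 / 6" using p by (auto simp: d_def)
  have small: "\<forall>\<^sub>F k in sequentially. b * (1 / f (real k)) \<le> d * tail_sum f k"
    if P: "typeP f" and mono: "monopolistic f" and b: "0 < b" for f b
  proof -
    interpret monopolistic f by (rule mono)
    have "\<forall>\<^sub>F k in sequentially. b / d \<le> f (real k) * tail_sum f k"
      using P unfolding typeP_def filterlim_at_top by blast
    then show ?thesis
      using eventually_ge_at_top[of 1]
    proof eventually_elim
      case (elim k)
      then show ?case using pos[of k] d by (simp add: field_simps)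
    qed
  qed
  have "\<forall>\<^sub>F N in sequentially. unbounded_prob F (init_config c N) j < e" if e: "0 < e" for e
  proof -
    obtain b where b: "0 < b" "exp (- (b * ((1 - p) / 2))) < e"
    proof -
      \<comment> \<open>Here \<open>b * ((1 - p) / 2)\<close> equals
        \<open>max 1 (1 - ln e)\<close>, which exceeds \<open>- ln e\<close>; the maximum keeps
        \<open>b\<close> positive also for large \<open>e\<close>.\<close>
      define b where "b = 2 * (max 1 (1 - ln e)) / (1 - p)"
      have "b > 0" using p by (simp add: b_def)
      moreover have "exp (- (b * ((1 - p) / 2))) < e"
      proof -
        have "- (b * ((1 - p) / 2)) < ln e"
          using p by (simp add: b_def)
        then have "exp (- (b * ((1 - p) / 2))) < exp (ln e)" by simp
        then show ?thesis using e by simp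
      qed
      ultimately show ?thesis by (rule that)
    qed
    obtain k0 where k0: "\<And>k. k0 \<le> k \<Longrightarrow> b * (1 / F i (real k)) \<le> d * tail_sum (F i) k"
        "\<And>k. k0 \<le> k \<Longrightarrow> b * (1 / F j (real k)) \<le> d * tail_sum (F j) k"
      using eventually_conj[OF small[OF P(1) i.monopolistic_axioms b(1)] small[OF P(2) j.monopolistic_axioms b(1)]]
      unfolding eventually_sequentially by blast
    have "\<forall>\<^sub>F N in sequentially. k0 \<le> nat \<lceil>c $ i * real N\<rceil>" "\<forall>\<^sub>F N in sequentially. k0 \<le> nat \<lceil>c $ j * real N\<rceil>"
      using filterlim_nat_ceiling[OF cpos] unfolding filterlim_at_top by blast+
    then show ?thesis
      using le eventually_ge_at_top[of 1]
    proof eventually_elim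
      case (elim N)
      define x where "x = init_config c N"
      have x: "1 \<le> x k" for k unfolding x_def using c elim(4) by (rule init_config_ge_1)
      define r where "r = tail_sum (F i) (x i)"
      define s where "s = tail_sum (F j) (x j)"
      have s: "0 < s" unfolding s_def by (rule j.tail_sum_pos[OF x])
      have r: "0 < r" unfolding r_def by (rule i.tail_sum_pos[OF x])
      have "r \<le> q * s" using elim(3) by (simp add: r_def s_def x_def init_config_def)
      also have "\<dots> \<le> p * s" using p s by (intro mult_right_mono) auto
      finally have rp: "r \<le> p * s" .
      also have "p * s \<le> 1 * s" using p s by (intro mult_right_mono) auto
      finally have rs: "r \<le> s" by simp
      have k0x: "k0 \<le> x i" "k0 \<le> x j" using elim(1,2) by (simp_all add: x_def init_config_def)
      have "unbounded_prob F x j \<le> exp (b / s * ((1 + 2 * d) * r - (1 - d) * s))"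
        unfolding r_def s_def
      proof (rule unbounded_prob_le_exp[OF adm M ij x])
        show "0 < b / tail_sum (F j) (x j)" using b s by (simp add: s_def)
        show "d \<le> 1 / 2" using d by simp
        show "b / tail_sum (F j) (x j) / F i (real k) \<le> d" if "x i \<le> k" for k
        proof -
          have "1 \<le> k" using that x[of i] by simp
          have "b * (1 / F i (real k)) \<le> d * tail_sum (F i) k" using k0x that by (intro k0) simp
          also have "\<dots> \<le> d * s"
            using d i.tail_sum_antimono[OF x that] rs by (intro mult_left_mono) (auto simp: r_def)
          finally show ?thesis using s i.pos[OF \<open>1 \<le> k\<close>] by (simp add: s_def[symmetric] field_simps)
        qed
        show "b / tail_sum (F j) (x j) / F j (real k) \<le> d" if "x j \<le> k" for k
        proof -
          have "1 \<le> k" using that x[of j] by simp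
          have "b * (1 / F j (real k)) \<le> d * tail_sum (F j) k" using k0x that by (intro k0) simp
          also have "\<dots> \<le> d * s"
            using d j.tail_sum_antimono[OF x that] by (intro mult_left_mono) (auto simp: s_def)
          finally show ?thesis using s j.pos[OF \<open>1 \<le> k\<close>] by (simp add: s_def[symmetric] field_simps)
        qed
      qed
      also have "\<dots> \<le> exp (- (b * ((1 - p) / 2)))"
      proof -
        have "(1 + 2 * d) * r - (1 - d) * s \<le> (1 + 2 * d) * (p * s) - (1 - d) * s"
          using rp d by (intro diff_right_mono mult_left_mono) auto
        also have "\<dots> = ((1 + 2 * d) * p - (1 - d)) * s" by (simp add: algebra_simps)
        also have "\<dots> \<le> (- ((1 - p) / 2)) * s"
        proof (intro mult_right_mono)
          have "d * p \<le> d" using p d by (simp add: mult_left_le)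
          then have "(1 + 2 * d) * p - (1 - d) \<le> p - 1 + 3 * d" by (simp add: algebra_simps)
          also have "\<dots> = - ((1 - p) / 2)" by (simp add: d_def field_simps)
          finally show "(1 + 2 * d) * p - (1 - d) \<le> - ((1 - p) / 2)" .
        qed (use s in auto)
        finally have "b / s * ((1 + 2 * d) * r - (1 - d) * s) \<le> b / s * ((- ((1 - p) / 2)) * s)"
          using b s by (intro mult_left_mono) auto
        also have "\<dots> = - (b * ((1 - p) / 2))" using s by simp
        finally show ?thesis by simp
      qed
      also have "\<dots> < e" by (rule b)
      finally show ?case by (simp add: x_def)
    qed
  qed
  note eventually_small = this
  show ?thesis
    unfolding dies_def
  proof (rule order_tendstoI)
    show "\<forall>\<^sub>F N in sequentially. a < unbounded_prob F (init_config c N) j" if "a < 0" for a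
      using that by (intro always_eventually allI less_le_trans[OF _ unbounded_prob_nonneg])
  qed (rule eventually_small)
qed

section \<open>From dying agents to attraction domains\<close>

lemma sMon_measurable: "sMon F i c N \<in> sets urn_space"
  unfolding sMon_def by measurable

lemma unbounded_measurable: "{\<omega> \<in> space urn_space. \<forall>K. \<exists>n. K \<le> urn F x \<omega> n j} \<in> sets urn_space"
  by measurable

text \<open>Outside \<open>sMon\<close> some agent other than \<open>i\<close> collects infinitely
  many balls, so a union bound over the finitely many competitors suffices.\<close>

lemma attraction_domainI:
  fixes F :: "'n::{finite,wellorder} \<Rightarrow> real \<Rightarrow> real"
  assumes c: "c \<in> std_simplex_interior" and d: "\<And>j. j \<noteq> i \<Longrightarrow> dies F c j"
  shows "c \<in> attraction_domain F i"
proof -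
  interpret prob_space urn_space by (rule prob_space_urn_space)
  have lower: "1 - (\<Sum>j\<in>UNIV - {i}. unbounded_prob F (init_config c N) j) \<le> measure urn_space (sMon F i c N)" for N
  proof -
    define U where "U j = {\<omega> \<in> space urn_space. \<forall>K. \<exists>n. K \<le> urn F (init_config c N) \<omega> n j}" for j
    have "space urn_space - sMon F i c N \<subseteq> (\<Union>j\<in>UNIV - {i}. U j)"
    proof
      fix \<omega> assume \<omega>: "\<omega> \<in> space urn_space - sMon F i c N"
      show "\<omega> \<in> (\<Union>j\<in>UNIV - {i}. U j)"
      proof (rule ccontr)
        assume "\<omega> \<notin> (\<Union>j\<in>UNIV - {i}. U j)"
        then have "\<exists>K. \<forall>n. urn F (init_config c N) \<omega> n j < K" if "j \<noteq> i" for j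
          using that \<omega> by (auto simp: U_def not_le)
        then obtain K where K: "\<And>j n. j \<noteq> i \<Longrightarrow> urn F (init_config c N) \<omega> n j < K j" by metis
        have "(\<Sum>j\<in>UNIV - {i}. urn F (init_config c N) \<omega> n j) \<le> (\<Sum>j\<in>UNIV - {i}. K j)" for n
          by (intro sum_mono less_imp_le[OF K]) auto
        then show False using \<omega> by (auto simp: sMon_def)
      qed
    qed
    then have "measure urn_space (space urn_space - sMon F i c N) \<le> measure urn_space (\<Union>j\<in>UNIV - {i}. U j)"
      by (intro finite_measure_mono) (auto simp: U_def unbounded_measurable)
    also have "\<dots> \<le> (\<Sum>j\<in>UNIV - {i}. measure urn_space (U j))"
      by (intro finite_measure_subadditive_finite) (auto simp: U_def unbounded_measurable)
    finally show ?thesis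
      by (simp add: prob_compl[OF sMon_measurable] U_def unbounded_prob_def)
  qed
  have "(\<lambda>N. 1 - (\<Sum>j\<in>UNIV - {i}. unbounded_prob F (init_config c N) j)) \<longlonglongrightarrow> 1 - (\<Sum>j\<in>UNIV - {i}. 0)"
    using d by (intro tendsto_intros) (auto simp: dies_def)
  then have lim: "(\<lambda>N. 1 - (\<Sum>j\<in>UNIV - {i}. unbounded_prob F (init_config c N) j)) \<longlonglongrightarrow> 1"
    by simp
  have "(\<lambda>N. measure urn_space (sMon F i c N)) \<longlonglongrightarrow> 1"
    by (rule tendsto_sandwich[OF always_eventually always_eventually lim tendsto_const]) (simp_all add: lower)
  then show ?thesis using c by (simp add: attraction_domain_def)
qed

lemma sMon_disjoint:
  fixes F :: "'n::{finite,wellorder} \<Rightarrow> real \<Rightarrow> real"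
  assumes "i \<noteq> j"
  shows "sMon F i c N \<inter> sMon F j c N = {}"
proof (rule ccontr)
  assume "sMon F i c N \<inter> sMon F j c N \<noteq> {}"
  then obtain \<omega> B C where B: "\<And>n. (\<Sum>k\<in>UNIV - {i}. urn F (init_config c N) \<omega> n k) \<le> B"
    and C: "\<And>n. (\<Sum>k\<in>UNIV - {j}. urn F (init_config c N) \<omega> n k) \<le> C"
    by (auto simp: sMon_def)
  have "n \<le> C + B" for n
  proof -
    have "n \<le> (\<Sum>k\<in>UNIV. urn F (init_config c N) \<omega> n k)" by (simp add: sum_urn)
    also have "\<dots> = urn F (init_config c N) \<omega> n i + (\<Sum>k\<in>UNIV - {i}. urn F (init_config c N) \<omega> n k)"
      by (rule sum.remove) auto
    also have "urn F (init_config c N) \<omega> n i \<le> (\<Sum>k\<in>UNIV - {j}. urn F (init_config c N) \<omega> n k)"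
      using assms by (intro member_le_sum) auto
    finally show ?thesis using B[of n] C[of n] by linarith
  qed
  from this[of "Suc (C + B)"] show False by simp
qed

text \<open>The total number of balls grows without bound, so on \<open>sMon\<close> agent
  \<open>i\<close> itself must be unbounded; the probability of \<open>sMon\<close> is therefore at
  most \<open>unbounded_prob\<close>.\<close>

lemma dies_not_attraction_domain:
  fixes F :: "'n::{finite,wellorder} \<Rightarrow> real \<Rightarrow> real"
  assumes "dies F c i"
  shows "c \<notin> attraction_domain F i"
proof
  interpret prob_space urn_space by (rule prob_space_urn_space)
  assume "c \<in> attraction_domain F i"
  then have lim: "(\<lambda>N. measure urn_space (sMon F i c N)) \<longlonglongrightarrow> 1" by (simp add: attraction_domain_def)
  have le: "measure urn_space (sMon F i c N) \<le> unbounded_prob F (init_config c N) i" for N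
    unfolding unbounded_prob_def
  proof (intro finite_measure_mono unbounded_measurable subsetI CollectI conjI allI)
    fix \<omega> K assume \<omega>: "\<omega> \<in> sMon F i c N"
    then show "\<omega> \<in> space urn_space" by (simp add: sMon_def)
    obtain B where B: "\<And>n. (\<Sum>k\<in>UNIV - {i}. urn F (init_config c N) \<omega> n k) \<le> B"
      using \<omega> by (auto simp: sMon_def)
    have "K + B \<le> (\<Sum>k\<in>UNIV. urn F (init_config c N) \<omega> (K + B) k)" by (simp add: sum_urn)
    also have "\<dots> = urn F (init_config c N) \<omega> (K + B) i + (\<Sum>k\<in>UNIV - {i}. urn F (init_config c N) \<omega> (K + B) k)"
      by (rule sum.remove) auto
    finally have "K \<le> urn F (init_config c N) \<omega> (K + B) i" using B[of "K + B"] by linarith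
    then show "\<exists>n. K \<le> urn F (init_config c N) \<omega> n i" ..
  qed
  have "1 \<le> (0 :: real)"
    using assms unfolding dies_def by (intro LIMSEQ_le[OF lim]) (auto simp: le)
  then show False by simp
qed

lemma attraction_domain_disjoint:
  fixes F :: "'n::{finite,wellorder} \<Rightarrow> real \<Rightarrow> real"
  assumes "i \<noteq> j"
  shows "attraction_domain F i \<inter> attraction_domain F j = {}"
proof (rule ccontr)
  interpret prob_space urn_space by (rule prob_space_urn_space)
  assume "attraction_domain F i \<inter> attraction_domain F j \<noteq> {}"
  then obtain c where "(\<lambda>N. measure urn_space (sMon F i c N)) \<longlonglongrightarrow> 1" "(\<lambda>N. measure urn_space (sMon F j c N)) \<longlonglongrightarrow> 1"
    by (auto simp: attraction_domain_def)
  from tendsto_add[OF this]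
  have "(\<lambda>N. measure urn_space (sMon F i c N) + measure urn_space (sMon F j c N)) \<longlonglongrightarrow> 1 + 1" .
  moreover have "measure urn_space (sMon F i c N) + measure urn_space (sMon F j c N) \<le> 1" for N
    by (subst finite_measure_Union[symmetric]) (auto simp: sMon_measurable sMon_disjoint[OF assms])
  ultimately have "1 + 1 \<le> (1 :: real)"
    by (intro LIMSEQ_le_const2) auto
  then show False by simp
qed

section \<open>Comparison of tail sums along rays\<close>

definition tail_at :: "(real \<Rightarrow> real) \<Rightarrow> real \<Rightarrow> nat \<Rightarrow> real" where
  "tail_at f a N = tail_sum f (nat \<lceil>a * real N\<rceil>)"

text \<open>A factor \<open>q\<close> uniformly below 1 is demanded, not just an eventual strict
  inequality: this is the input of the type P criterion. As \<open>q\<close> may be negative here,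
  \<open>beatsE\<close> normalises it.\<close>

definition beats :: "(real \<Rightarrow> real) \<Rightarrow> real \<Rightarrow> (real \<Rightarrow> real) \<Rightarrow> real \<Rightarrow> bool" where
  "beats f a g b \<longleftrightarrow> (\<exists>q<1. \<forall>\<^sub>F N in sequentially. tail_at f a N \<le> q * tail_at g b N)"

lemma nat_ceiling_ge_1: "0 < a \<Longrightarrow> 1 \<le> N \<Longrightarrow> 1 \<le> nat \<lceil>a * real N\<rceil>"
proof -
  assume "0 < a" "1 \<le> N"
  then have "0 < a * real N" by simp
  then show ?thesis by linarith
qed

context monopolistic
begin

lemma tail_at_pos: "0 < a \<Longrightarrow> 1 \<le> N \<Longrightarrow> 0 < tail_at f a N"
  unfolding tail_at_def by (intro tail_sum_pos nat_ceiling_ge_1)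

lemma tail_at_le:
  assumes "0 < a" "1 \<le> N" "a * real N \<le> b * real M"
  shows "tail_at f b M \<le> tail_at f a N"
  unfolding tail_at_def using assms
  by (intro tail_sum_antimono nat_ceiling_ge_1 nat_mono ceiling_mono)

end

lemma beatsE:
  assumes "beats f a g b" "monopolistic g" "0 < b"
  obtains q where "0 \<le> q" "q < 1" "\<forall>\<^sub>F N in sequentially. tail_at f a N \<le> q * tail_at g b N"
proof -
  interpret g: monopolistic g by fact
  obtain q where q: "q < 1" "\<forall>\<^sub>F N in sequentially. tail_at f a N \<le> q * tail_at g b N"
    using assms(1) by (auto simp: beats_def)
  have "\<forall>\<^sub>F N in sequentially. tail_at f a N \<le> max q 0 * tail_at g b N"
    using q(2) eventually_ge_at_top[of 1]
  proof eventually_elim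
    case (elim N)
    have "q * tail_at g b N \<le> max q 0 * tail_at g b N"
      using g.tail_at_pos[OF assms(3) elim(2)] by (intro mult_right_mono) auto
    with elim(1) show ?case by linarith
  qed
  then show ?thesis using q(1) by (intro that[of "max q 0"]) auto
qed

lemma beats_trans:
  assumes "beats f a g b" "beats g b h c" "monopolistic g" "0 < b"
  shows "beats f a h c"
proof -
  interpret g: monopolistic g by fact
  obtain q where q: "q < 1" "\<forall>\<^sub>F N in sequentially. tail_at f a N \<le> q * tail_at g b N"
    using assms(1) by (auto simp: beats_def)
  obtain r where r: "r < 1" "\<forall>\<^sub>F N in sequentially. tail_at g b N \<le> r * tail_at h c N"
    using assms(2) by (auto simp: beats_def)
  have "\<forall>\<^sub>F N in sequentially. tail_at f a N \<le> r * tail_at h c N"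
    using q(2) r(2) eventually_ge_at_top[of 1]
  proof eventually_elim
    case (elim N)
    have "q * tail_at g b N \<le> 1 * tail_at g b N"
      using g.tail_at_pos[OF assms(4) elim(3)] q(1) by (intro mult_right_mono) auto
    with elim show ?case by linarith
  qed
  with r(1) show ?thesis by (auto simp: beats_def)
qed

lemma beats_irrefl:
  assumes "monopolistic f" "0 < a"
  shows "\<not> beats f a f a"
proof
  interpret monopolistic f by fact
  assume "beats f a f a"
  then obtain q where q: "q < 1" "\<forall>\<^sub>F N in sequentially. tail_at f a N \<le> q * tail_at f a N"
    by (auto simp: beats_def)
  from q(2) have "\<forall>\<^sub>F N in sequentially. False"
    using eventually_ge_at_top[of 1]
  proof eventually_elim
    case (elim N)
    have "q * tail_at f a N < 1 * tail_at f a N"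
      using tail_at_pos[OF assms(2) elim(2)] q(1) by (intro mult_strict_right_mono) auto
    with elim show ?case by simp
  qed
  then show False by simp
qed

section \<open>Rounding along rays and change of scale\<close>

lemma filterlim_nat_floor: "0 < a \<Longrightarrow> filterlim (\<lambda>N. nat \<lfloor>a * real N\<rfloor>) at_top sequentially"
proof (unfold filterlim_at_top, intro allI)
  fix Z :: nat assume a: "0 < a"
  show "\<forall>\<^sub>F N in sequentially. Z \<le> nat \<lfloor>a * real N\<rfloor>"
    using eventually_ge_at_top[of "nat \<lceil>real Z / a\<rceil>"]
  proof eventually_elim
    case (elim N)
    then have "real Z / a \<le> real N" by linarith
    then have "real Z \<le> a * real N" using a by (simp add: field_simps)
    then show ?case by linarith
  qed
qed

lemma eventually_linear_le:
  fixes a b c :: real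
  assumes "a < b"
  shows "\<forall>\<^sub>F N in sequentially. a * real N + c \<le> b * real N"
  using eventually_ge_at_top[of "nat \<lceil>c / (b - a)\<rceil>"]
proof eventually_elim
  case (elim N)
  then have "c / (b - a) \<le> real N" by linarith
  then show ?case using assms by (simp add: field_simps)
qed

text \<open>Only integer multiples of a ray are compared by \<open>beats\<close>, so that a change of scale
  costs an arbitrarily small amount of slack.\<close>

lemma beats_scale:
  assumes fg: "beats f a g b" and f: "monopolistic f" and g: "monopolistic g"
    and pos: "0 < a" "0 < b" "0 < l" "0 < b'"
    and le: "l * a \<le> a'" "b' \<le> l * b" and less: "l * a < a' \<or> b' < l * b"
  shows "beats f a' g b'"
proof -
  interpret f: monopolistic f by fact
  interpret g: monopolistic g by fact
  obtain q where q: "0 \<le> q" "q < 1" "\<forall>\<^sub>F N in sequentially. tail_at f a N \<le> q * tail_at g b N"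
    using beatsE[OF fg g pos(2)] .
  \<comment> \<open>The comparison at index \<open>N\<close> is read off at an integer
    \<open>M N\<close> within distance 1 of \<open>l * N\<close>. Rounding up puts the error on the
    ray of \<open>f\<close>, rounding down on that of \<open>g\<close>; the direction is chosen so
    that the strict inequality absorbs it.\<close>
  have "\<exists>M. filterlim M at_top sequentially \<and>
      (\<forall>\<^sub>F N in sequentially. a * real (M N) \<le> a' * real N \<and> b' * real N \<le> b * real (M N))"
    using less
  proof
    assume less: "l * a < a'"
    show ?thesis
    proof (intro exI conjI)
      show "filterlim (\<lambda>N. nat \<lceil>l * real N\<rceil>) at_top sequentially"
        using pos by (intro filterlim_nat_ceiling)
      show "\<forall>\<^sub>F N in sequentially. a * real (nat \<lceil>l * real N\<rceil>) \<le> a' * real N \<and> b' * real N \<le> b * real (nat \<lceil>l * real N\<rceil>)"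
        using eventually_linear_le[OF less, of a]
      proof eventually_elim
        case (elim N)
        have "0 \<le> l * real N" using pos by simp
        then have M: "l * real N \<le> real (nat \<lceil>l * real N\<rceil>)" "real (nat \<lceil>l * real N\<rceil>) \<le> l * real N + 1" by linarith+
        have "a * real (nat \<lceil>l * real N\<rceil>) \<le> a * (l * real N + 1)"
          using M pos by (intro mult_left_mono) auto
        moreover have "b * (l * real N) \<le> b * real (nat \<lceil>l * real N\<rceil>)"
          using M pos by (intro mult_left_mono) auto
        moreover have "b' * real N \<le> l * b * real N"
          using le by (intro mult_right_mono) auto
        ultimately show ?case using elim by (simp add: algebra_simps)
      qed
    qed
  next
    assume less: "b' < l * b"
    show ?thesis
    proof (intro exI conjI)
      show "filterlim (\<lambda>N. nat \<lfloor>l * real N\<rfloor>) at_top sequentially"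
        using pos by (intro filterlim_nat_floor)
      show "\<forall>\<^sub>F N in sequentially. a * real (nat \<lfloor>l * real N\<rfloor>) \<le> a' * real N \<and> b' * real N \<le> b * real (nat \<lfloor>l * real N\<rfloor>)"
        using eventually_linear_le[OF less, of b]
      proof eventually_elim
        case (elim N)
        have "0 \<le> l * real N" using pos by simp
        then have M: "real (nat \<lfloor>l * real N\<rfloor>) \<le> l * real N" "l * real N \<le> real (nat \<lfloor>l * real N\<rfloor>) + 1" by linarith+
        have "a * real (nat \<lfloor>l * real N\<rfloor>) \<le> a * (l * real N)"
          using M pos by (intro mult_left_mono) auto
        moreover have "b * (l * real N) \<le> b * (real (nat \<lfloor>l * real N\<rfloor>) + 1)"
          using M pos by (intro mult_left_mono) auto
        moreover have "l * a * real N \<le> a' * real N"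
          using le by (intro mult_right_mono) auto
        ultimately show ?case using elim by (simp add: algebra_simps)
      qed
    qed
  qed
  then obtain M where M: "filterlim M at_top sequentially"
    "\<forall>\<^sub>F N in sequentially. a * real (M N) \<le> a' * real N \<and> b' * real N \<le> b * real (M N)" by blast
  have "\<forall>\<^sub>F N in sequentially. tail_at f a (M N) \<le> q * tail_at g b (M N)"
    using q(3) M(1) unfolding filterlim_iff by blast
  moreover have "\<forall>\<^sub>F N in sequentially. 1 \<le> M N"
    using M(1) unfolding filterlim_at_top by blast
  ultimately have "\<forall>\<^sub>F N in sequentially. tail_at f a' N \<le> q * tail_at g b' N"
    using M(2) eventually_ge_at_top[of 1]
  proof eventually_elim
    case (elim N)
    have "tail_at f a' N \<le> tail_at f a (M N)"
      using elim pos by (intro f.tail_at_le) auto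
    also have "\<dots> \<le> q * tail_at g b (M N)" by (rule elim)
    also have "\<dots> \<le> q * tail_at g b' N"
      using elim pos q by (intro mult_left_mono g.tail_at_le) auto
    finally show ?case .
  qed
  with q(2) show ?thesis by (auto simp: beats_def)
qed

text \<open>Since \<open>1 / f k\<close> is the decrement of the tail, the bound says that step
  \<open>k\<close> removes at least the fraction \<open>1 / (C * k)\<close> of it.\<close>

definition poly_tail :: "(real \<Rightarrow> real) \<Rightarrow> bool" where
  "poly_tail f \<longleftrightarrow> (\<exists>C>0. \<forall>\<^sub>F k in sequentially. f (real k) * tail_sum f k \<le> C * real k)"

context monopolistic
begin

text \<open>Each term between \<open>l\<close> and \<open>m\<close> is at least
  \<open>tail_sum f m / K\<close>, because the tail decreases. A bound \<open>K\<close> proportional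
  to \<open>m\<close> yields polynomial decay, a constant \<open>K\<close> exponential
  decay.\<close>

lemma tail_sum_contraction:
  assumes l: "1 \<le> l" "l \<le> m" and K: "0 < K"
    and le: "\<And>k. k \<in> {l..<m} \<Longrightarrow> f (real k) * tail_sum f k \<le> K"
  shows "(1 + (real m - real l) / K) * tail_sum f m \<le> tail_sum f l"
proof -
  have each: "tail_sum f m / K \<le> 1 / f (real k)" if k: "k \<in> {l..<m}" for k
  proof -
    have k1: "1 \<le> k" using k l by simp
    have "f (real k) * tail_sum f m \<le> f (real k) * tail_sum f k"
      using pos[OF k1] k k1 by (intro mult_left_mono tail_sum_antimono) auto
    also have "\<dots> \<le> K" by (rule le[OF k])
    finally show ?thesis using pos[OF k1] K by (simp add: field_simps)
  qed
  have "(real m - real l) / K * tail_sum f m = (\<Sum>k = l..<m. tail_sum f m / K)"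
    using l by (simp add: of_nat_diff)
  also have "\<dots> \<le> (\<Sum>k = l..<m. 1 / f (real k))" by (intro sum_mono each)
  also have "\<dots> = tail_sum f l - tail_sum f m" using tail_sum_diff[OF l(2)] by simp
  finally show ?thesis by (simp add: algebra_simps)
qed

lemma tail_at_contraction:
  assumes "poly_tail f" and ab: "0 < b" "b < a"
  obtains \<kappa> where "0 < \<kappa>" "\<kappa> < 1" "\<forall>\<^sub>F N in sequentially. tail_at f a N \<le> \<kappa> * tail_at f b N"
proof -
  obtain C where C: "0 < C" "\<forall>\<^sub>F k in sequentially. f (real k) * tail_sum f k \<le> C * real k"
    using assms(1) by (auto simp: poly_tail_def)
  obtain k0 where k0: "\<And>k. k0 \<le> k \<Longrightarrow> f (real k) * tail_sum f k \<le> C * real k"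
    using C(2) unfolding eventually_sequentially by blast
  \<comment> \<open>For large \<open>N\<close> the difference \<open>m - l\<close> is at least
    \<open>(a - b) * N / 2\<close> and \<open>m\<close> is at most \<open>2 * a * N\<close>; the
    quotient of these bounds, divided by \<open>C\<close>, is \<open>e\<close>.\<close>
  define e where "e = (a - b) / (4 * a * C)"
  have e: "0 < e" using ab C by (simp add: e_def)
  have "\<forall>\<^sub>F N in sequentially. tail_at f a N \<le> 1 / (1 + e) * tail_at f b N"
  proof -
    have "\<forall>\<^sub>F N in sequentially. k0 \<le> nat \<lceil>b * real N\<rceil>"
      using filterlim_nat_ceiling[OF ab(1)] unfolding filterlim_at_top by blast
    moreover have "\<forall>\<^sub>F N in sequentially. 0 * real N + 1 \<le> a * real N"
      "\<forall>\<^sub>F N in sequentially. 0 * real N + 2 \<le> (a - b) * real N"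
      by (rule eventually_linear_le, use ab in simp)+
    ultimately show ?thesis using eventually_ge_at_top[of 1]
    proof eventually_elim
      case (elim N)
      define l where "l = nat \<lceil>b * real N\<rceil>"
      define m where "m = nat \<lceil>a * real N\<rceil>"
      have l1: "1 \<le> l" unfolding l_def using ab elim by (intro nat_ceiling_ge_1) auto
      have "b * real N \<le> a * real N" using ab by (intro mult_right_mono) auto
      then have lm: "l \<le> m" unfolding l_def m_def by (intro nat_mono ceiling_mono)
      have m: "real m \<le> 2 * (a * real N)" using elim(2) unfolding m_def by linarith
      have mpos: "0 < m" using l1 lm by simp
      have "0 \<le> b * real N" using ab by simp
      then have "real l \<le> b * real N + 1" "a * real N \<le> real m" unfolding l_def m_def by linarith+
      then have ml: "(a - b) * real N / 2 \<le> real m - real l"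
        using elim(3) by (simp add: left_diff_distrib)
      have "f (real k) * tail_sum f k \<le> C * real m" if k: "k \<in> {l..<m}" for k
      proof -
        have "f (real k) * tail_sum f k \<le> C * real k" using k elim(1)[folded l_def] by (intro k0) simp
        also have "\<dots> \<le> C * real m" using k C by (intro mult_left_mono) auto
        finally show ?thesis .
      qed
      then have contr: "(1 + (real m - real l) / (C * real m)) * tail_sum f m \<le> tail_sum f l"
        using C mpos by (intro tail_sum_contraction l1 lm) auto
      have "e \<le> (real m - real l) / (C * real m)"
      proof -
        have "e * (C * real m) \<le> e * (C * (2 * (a * real N)))"
          using e C m by (intro mult_left_mono) auto
        also have "\<dots> = (a - b) * real N / 2" using ab C by (simp add: e_def field_simps)
        also have "\<dots> \<le> real m - real l" by (rule ml)
        finally show ?thesis using C mpos by (simp add: pos_le_divide_eq)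
      qed
      then have "(1 + e) * tail_sum f m \<le> (1 + (real m - real l) / (C * real m)) * tail_sum f m"
        using tail_sum_pos[of m] mpos by (intro mult_right_mono) auto
      also note contr
      finally have "(1 + e) * tail_sum f m \<le> tail_sum f l" .
      then show ?case using e unfolding tail_at_def l_def m_def by (simp add: field_simps)
    qed
  qed
  moreover have "0 < 1 / (1 + e)" "1 / (1 + e) < 1" using e by auto
  ultimately show ?thesis using that by blast
qed

lemma beats_self: "poly_tail f \<Longrightarrow> 0 < b \<Longrightarrow> b < a \<Longrightarrow> beats f a f b"
  by (erule (2) tail_at_contraction) (auto simp: beats_def)

end

section \<open>Weights from pairwise comparisons\<close>

text \<open>Pairs of rays are normalised to \<open>(x, 1 - x)\<close>. Comparability is asked for in
  every open interval rather than at every \<open>x\<close>, since at a critical ratio neither side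
  need win; rescaling fills the gaps.\<close>

definition dichotomy :: "(real \<Rightarrow> real) \<Rightarrow> (real \<Rightarrow> real) \<Rightarrow> bool" where
  "dichotomy f g \<longleftrightarrow> (\<forall>s t. 0 < s \<longrightarrow> s < t \<longrightarrow> t < 1 \<longrightarrow>
    (\<exists>x. s < x \<and> x < t \<and> (beats f x g (1 - x) \<or> beats g (1 - x) f x)))"

locale competitors =
  fixes F :: "'i \<Rightarrow> real \<Rightarrow> real" and A :: "'i set"
  assumes finite: "finite A" and nonempty: "A \<noteq> {}"
    and monopolistic: "i \<in> A \<Longrightarrow> monopolistic (F i)"
    and poly_tail: "i \<in> A \<Longrightarrow> poly_tail (F i)"
    and dichotomy: "i \<in> A \<Longrightarrow> j \<in> A \<Longrightarrow> i \<noteq> j \<Longrightarrow> dichotomy (F i) (F j)"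
begin

abbreviation beat :: "'i \<Rightarrow> real \<Rightarrow> 'i \<Rightarrow> real \<Rightarrow> bool" where
  "beat i a j b \<equiv> beats (F i) a (F j) b"

lemma beat_trans: "beat i a j b \<Longrightarrow> beat j b k c \<Longrightarrow> j \<in> A \<Longrightarrow> 0 < b \<Longrightarrow> beat i a k c"
  by (rule beats_trans[OF _ _ monopolistic])

lemma beat_scale:
  "beat i a j b \<Longrightarrow> i \<in> A \<Longrightarrow> j \<in> A \<Longrightarrow> 0 < a \<Longrightarrow> 0 < b \<Longrightarrow> 0 < l \<Longrightarrow> 0 < b' \<Longrightarrow>
    l * a \<le> a' \<Longrightarrow> b' \<le> l * b \<Longrightarrow> l * a < a' \<or> b' < l * b \<Longrightarrow> beat i a' j b'"
  by (rule beats_scale[OF _ monopolistic monopolistic])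

text \<open>A comparable \<open>x\<close> is picked between the normalisations of
  \<open>(a, b)\<close> and \<open>(a', b)\<close>. Scaling by \<open>b / (1 - x)\<close> restores
  the second ray to \<open>b\<close> and puts the first strictly between \<open>a\<close> and
  \<open>a'\<close>, which is the slack that \<open>beat_scale\<close> needs in either case.\<close>

lemma beat_total:
  assumes ij: "i \<in> A" "j \<in> A" and pos: "0 < a" "a < a'" "0 < b"
  shows "beat i a' j b \<or> beat j b i a"
proof (cases "i = j")
  case True
  interpret monopolistic "F i" by (rule monopolistic[OF ij(1)])
  show ?thesis
    using beats_self[OF poly_tail[OF ij(1)], of b a'] beats_self[OF poly_tail[OF ij(1)], of a b] assms(3-5) True
    by (cases "b < a'") auto
next
  case False
  have "0 < a / (a + b)" "a / (a + b) < a' / (a' + b)" "a' / (a' + b) < 1"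
    using pos by (auto simp: field_simps)
  then obtain x where x: "a / (a + b) < x" "x < a' / (a' + b)"
    and or: "beat i x j (1 - x) \<or> beat j (1 - x) i x"
    using dichotomy[OF ij False] unfolding dichotomy_def by meson
  have x0: "0 < x" using x(1) \<open>0 < a / (a + b)\<close> by linarith
  have x1: "x < 1" using x(2) \<open>a' / (a' + b) < 1\<close> by linarith
  have less: "b / (1 - x) * x < a'" "a < b / (1 - x) * x"
    using x x1 pos by (simp_all add: field_simps)
  have eq: "b / (1 - x) * (1 - x) = b" using x1 by simp
  have l: "0 < b / (1 - x)" using x1 pos by simp
  show ?thesis
    using or
  proof
    assume "beat i x j (1 - x)"
    then have "beat i a' j b"
      by (rule beat_scale[where l = "b / (1 - x)"]) (use ij x0 x1 pos less eq l in auto)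
    then show ?thesis ..
  next
    assume "beat j (1 - x) i x"
    then have "beat j b i a"
      by (rule beat_scale[where l = "b / (1 - x)"]) (use ij x0 x1 pos less eq l in auto)
    then show ?thesis ..
  qed
qed

text \<open>A total preorder on \<open>A\<close>. Its failure means that \<open>i\<close> does not
  beat \<open>j\<close> at any ratio, that is, an infinite critical ratio.\<close>

definition rival :: "'i \<Rightarrow> 'i \<Rightarrow> bool" where
  "rival i j \<longleftrightarrow> (\<exists>a>0. beat i a j 1)"

lemma rival_trans:
  assumes ij: "rival i j" and jk: "rival j k" and A: "i \<in> A" "j \<in> A" "k \<in> A"
  shows "rival i k"
proof -
  obtain a b where a: "0 < a" "beat i a j 1" and b: "0 < b" "beat j b k 1"
    using ij jk by (auto simp: rival_def)
  \<comment> \<open>The factor 2 supplies the strict slack required for rescaling.\<close>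
  have "beat i (2 * a * b) j b"
    using a(2) by (rule beat_scale[where l = b]) (use A a b in auto)
  then have "beat i (2 * a * b) k 1" by (rule beat_trans[OF _ b(2) A(2) b(1)])
  then show ?thesis using a b by (auto simp: rival_def intro!: exI[of _ "2 * a * b"])
qed

lemma rival_total: "i \<in> A \<Longrightarrow> j \<in> A \<Longrightarrow> rival i j \<or> rival j i"
  using beat_total[of i j 1 2 1] unfolding rival_def by (meson zero_less_numeral zero_less_one one_less_numeral_iff semiring_norm(76))

lemma rival_maximum: "\<exists>m\<in>A. \<forall>j\<in>A. rival m j"
proof -
  have "\<exists>m\<in>B. \<forall>j\<in>B. rival m j" if "finite B" "B \<noteq> {}" "B \<subseteq> A" for B
    using that
  proof (induction rule: finite_ne_induct)
    case (singleton x)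
    then show ?case using rival_total[of x x] by auto
  next
    case (insert x B)
    then obtain m where m: "m \<in> B" "\<forall>j\<in>B. rival m j" by auto
    have mA: "m \<in> A" "x \<in> A" using m insert by auto
    show ?case
    proof (cases "rival m x")
      case True
      then show ?thesis using m by auto
    next
      case False
      then have xm: "rival x m" using rival_total[OF mA] by simp
      have "rival x j" if "j \<in> B" for j
        using rival_trans[OF xm _ mA(2,1)] m that insert.prems by auto
      then show ?thesis using rival_total[OF mA(2) mA(2)] by auto
    qed
  qed
  from this[OF finite nonempty] show ?thesis by simp
qed

text \<open>A maximal agent \<open>m\<close> of the preorder is the common yardstick:
  \<open>I\<close> collects the agents that beat \<open>m\<close> at some ratio, and
  \<open>w i\<close> is the critical share of \<open>i\<close> against one unit of \<open>m\<close>.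
  Two agents of \<open>I\<close> are compared through a share \<open>t\<close> of \<open>m\<close>
  with \<open>b / w j < t < a / w i\<close>.\<close>

theorem weights:
  obtains I w where "I \<subseteq> A" "I \<noteq> {}" "\<And>i. i \<in> I \<Longrightarrow> 0 < w i"
    "\<And>i j a b. i \<in> I \<Longrightarrow> j \<in> I \<Longrightarrow> 0 < a \<Longrightarrow> 0 < b \<Longrightarrow> b / w j < a / w i \<Longrightarrow> beat i a j b"
    "\<And>i j a b. i \<in> I \<Longrightarrow> j \<in> A \<Longrightarrow> j \<notin> I \<Longrightarrow> 0 < a \<Longrightarrow> 0 < b \<Longrightarrow> beat i a j b"
proof -
  obtain m where m: "m \<in> A" and max: "\<And>j. j \<in> A \<Longrightarrow> rival m j" using rival_maximum by blast
  define I where "I = {i \<in> A. rival i m}"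
  define W where "W i = {a. 0 < a \<and> beat i a m 1}" for i
  define w where "w i = Inf (W i)" for i
  have W_ne: "W i \<noteq> {}" if "i \<in> I" for i
    using that by (auto simp: I_def W_def rival_def)
  have W_bdd: "bdd_below (W i)" for i
    by (rule bdd_belowI[of _ 0]) (auto simp: W_def)
  have w_pos: "0 < w i" if i: "i \<in> I" for i
  proof -
    have iA: "i \<in> A" using i by (simp add: I_def)
    obtain c where c: "0 < c" "beat m c i 1" using max[OF iA] by (auto simp: rival_def)
    \<comment> \<open>Weights are bounded away from 0, for otherwise \<open>m\<close> would beat
      \<open>i\<close> and \<open>i\<close> would beat \<open>m\<close> at shares that make
      \<open>m\<close> beat itself.\<close>
    have "1 / (2 * c) \<le> a" if "a \<in> W i" for a
    proof (rule ccontr)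
      assume "\<not> 1 / (2 * c) \<le> a"
      then have less: "a * c * 2 < 1" using c by (simp add: field_simps)
      have a: "0 < a" "beat i a m 1" using that by (auto simp: W_def)
      have ac: "0 < a * c" using a c by simp
      have "beat m (a * c * 2) i a"
        using c(2) by (rule beat_scale[where l = a]) (use a c iA m ac in auto)
      from beat_trans[OF this a(2) iA a(1)]
      have "beat m (a * c * 2) m 1" .
      then have "beat m 1 m 1"
        by (rule beat_scale[where l = 1]) (use m ac less in auto)
      then show False using beats_irrefl[OF monopolistic[OF m], of 1] by simp
    qed
    then have "1 / (2 * c) \<le> w i"
      unfolding w_def by (intro cInf_greatest W_ne i)
    then show ?thesis using c by (smt (verit) divide_pos_pos)
  qed
  have above: "beat i a m t" if i: "i \<in> I" and a: "0 < a" "0 < t" "w i < a / t" for i a t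
  proof -
    obtain x where x: "x \<in> W i" "x < a / t"
      using a(3) cInf_less_iff[OF W_ne[OF i] W_bdd] by (auto simp: w_def)
    have x': "0 < x" "beat i x m 1" using x by (auto simp: W_def)
    from x'(2) show ?thesis
      by (rule beat_scale[where l = t])
        (use i m a x' x in \<open>auto simp: I_def pos_less_divide_eq mult.commute\<close>)
  qed
  \<comment> \<open>Below the infimum \<open>j\<close> does not beat \<open>m\<close>, so
    \<open>m\<close> beats \<open>j\<close> by totality. The point \<open>x\<close> witnesses the
    failure, and the smaller \<open>y\<close> leaves room both for totality and for
    rescaling.\<close>
  have below: "beat m t j b" if j: "j \<in> I" and b: "0 < b" "0 < t" "b / t < w j" for j b t
  proof -
    obtain x where x: "b / t < x" "x < w j" using dense[OF b(3)] by blast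
    obtain y where y: "b / t < y" "y < x" using dense[OF x(1)] by blast
    have y0: "0 < y" using y b by (smt (verit) divide_pos_pos)
    have jA: "j \<in> A" using j by (simp add: I_def)
    have "x \<notin> W j" using x(2) cInf_lower[OF _ W_bdd, of x j] by (auto simp: w_def)
    then have "\<not> beat j x m 1" using y y0 by (auto simp: W_def)
    then have "beat m 1 j y" using beat_total[OF jA m y0 y(2), of 1] by simp
    then show ?thesis
      by (rule beat_scale[where l = t])
        (use jA m b y y0 in \<open>auto simp: pos_divide_less_eq mult.commute\<close>)
  qed
  show ?thesis
  proof (rule that[of I w])
    show "I \<subseteq> A" by (auto simp: I_def)
    show "I \<noteq> {}" using m max by (auto simp: I_def)
    show "0 < w i" if "i \<in> I" for i by (rule w_pos[OF that])
    show "beat i a j b" if ij: "i \<in> I" "j \<in> I" and ab: "0 < a" "0 < b" "b / w j < a / w i" for i j a b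
    proof -
      obtain t where t: "b / w j < t" "t < a / w i" using dense[OF ab(3)] by blast
      have t0: "0 < t" using t ab w_pos[OF ij(2)] by (smt (verit) divide_pos_pos)
      have "w i < a / t" "b / t < w j"
        using t t0 w_pos[OF ij(1)] w_pos[OF ij(2)] by (simp_all add: field_simps)
      then have "beat i a m t" "beat m t j b"
        using above[OF ij(1) ab(1) t0] below[OF ij(2) ab(2) t0] by auto
      then show ?thesis by (rule beat_trans[OF _ _ m t0])
    qed
    show "beat i a j b" if i: "i \<in> I" and j: "j \<in> A" "j \<notin> I" and ab: "0 < a" "0 < b" for i j a b
    proof -
      \<comment> \<open>Any \<open>t\<close> with \<open>w i < a / t\<close> would do; this one
        gives \<open>a / t = 2 * w i\<close>.\<close>
      define t where "t = a / (2 * w i)"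
      have t0: "0 < t" using ab w_pos[OF i] by (simp add: t_def)
      have "w i < a / t" using ab w_pos[OF i] by (simp add: t_def field_simps)
      then have im: "beat i a m t" by (rule above[OF i ab(1) t0])
      have nr: "\<not> rival j m" using j by (auto simp: I_def)
      \<comment> \<open>An agent outside \<open>I\<close> does not beat \<open>m\<close> at any
        ratio, so \<open>m\<close> beats it at every share; \<open>t * y = 2 * b\<close> exceeds
        \<open>b\<close>, as rescaling requires.\<close>
      define y where "y = 2 * b / t"
      have y: "0 < y" using ab t0 by (simp add: y_def)
      have "\<not> beat j (2 * y) m 1" using nr y by (auto simp: rival_def)
      then have "beat m 1 j y" using beat_total[OF j(1) m y, of "2 * y" 1] y by simp
      then have "beat m t j b"
        by (rule beat_scale[where l = t]) (use j m t0 y ab in \<open>auto simp: y_def\<close>)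
      with im show ?thesis by (rule beat_trans[OF _ _ m t0])
    qed
  qed
qed

end

section \<open>Agents of type E\<close>

definition exp_tail :: "(real \<Rightarrow> real) \<Rightarrow> bool" where
  "exp_tail f \<longleftrightarrow> (\<exists>C>0. \<forall>\<^sub>F k in sequentially. f (real k) * tail_sum f k \<le> C)"

lemma limsup_finite_bound:
  fixes u :: "nat \<Rightarrow> real"
  assumes "limsup (\<lambda>k. ereal (u k)) < \<infinity>"
  obtains C where "0 < C" "\<forall>\<^sub>F k in sequentially. u k \<le> C"
proof -
  obtain n where n: "limsup (\<lambda>k. ereal (u k)) < ereal (real n)"
    using assms less_PInf_Ex_of_nat by auto
  have "\<forall>\<^sub>F k in sequentially. ereal (u k) < ereal (real n)"
    using n by (rule Limsup_lessD)
  then have "\<forall>\<^sub>F k in sequentially. u k \<le> real n + 1"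
    by (rule eventually_mono) simp
  then show ?thesis by (intro that[of "real n + 1"]) auto
qed

lemma typeE_exp_tail: "typeE f \<Longrightarrow> exp_tail f"
  unfolding typeE_def exp_tail_def by (erule conjE, erule limsup_finite_bound) blast

lemma exp_tail_poly_tail:
  assumes "exp_tail f"
  shows "poly_tail f"
proof -
  obtain C where C: "0 < C" "\<forall>\<^sub>F k in sequentially. f (real k) * tail_sum f k \<le> C"
    using assms by (auto simp: exp_tail_def)
  have "\<forall>\<^sub>F k in sequentially. f (real k) * tail_sum f k \<le> C * real k"
    using C(2) eventually_ge_at_top[of 1]
  proof eventually_elim
    case (elim k)
    have "C * 1 \<le> C * real k" using elim C by (intro mult_left_mono) auto
    with elim show ?case by simp
  qed
  with C(1) show ?thesis by (auto simp: poly_tail_def)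
qed

context monopolistic
begin

text \<open>Between the indices of the two rays lie linearly many steps, and with a constant bound
  \<open>C\<close> the contraction factor \<open>1 + (m - l) / C\<close> grows with them. Hence
  moving the ray outward beats any prescribed factor.\<close>

lemma exp_tail_at_ratio:
  assumes "exp_tail f" and ab: "0 < b" "b < a" and \<kappa>: "0 < \<kappa>"
  shows "\<forall>\<^sub>F N in sequentially. tail_at f a N \<le> \<kappa> * tail_at f b N"
proof -
  obtain C where C: "0 < C" "\<forall>\<^sub>F k in sequentially. f (real k) * tail_sum f k \<le> C"
    using assms(1) by (auto simp: exp_tail_def)
  obtain k0 where k0: "\<And>k. k0 \<le> k \<Longrightarrow> f (real k) * tail_sum f k \<le> C"
    using C(2) unfolding eventually_sequentially by blast
  have "\<forall>\<^sub>F N in sequentially. k0 \<le> nat \<lceil>b * real N\<rceil>"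
    using filterlim_nat_ceiling[OF ab(1)] unfolding filterlim_at_top by blast
  moreover have "\<forall>\<^sub>F N in sequentially. 0 * real N + (1 + C / \<kappa>) \<le> (a - b) * real N"
    by (rule eventually_linear_le) (use ab in simp)
  ultimately show ?thesis using eventually_ge_at_top[of 1]
  proof eventually_elim
    case (elim N)
    define l where "l = nat \<lceil>b * real N\<rceil>"
    define m where "m = nat \<lceil>a * real N\<rceil>"
    have l1: "1 \<le> l" unfolding l_def using ab elim by (intro nat_ceiling_ge_1) auto
    have "b * real N \<le> a * real N" using ab by (intro mult_right_mono) auto
    then have lm: "l \<le> m" unfolding l_def m_def by (intro nat_mono ceiling_mono)
    have mpos: "0 < tail_sum f m" using l1 lm by (intro tail_sum_pos) simp
    have "0 \<le> b * real N" using ab by simp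
    then have "real l \<le> b * real N + 1" "a * real N \<le> real m" unfolding l_def m_def by linarith+
    then have "C / \<kappa> \<le> real m - real l"
      using elim(2) by (simp add: left_diff_distrib)
    then have "1 / \<kappa> \<le> (real m - real l) / C"
      using C \<kappa> by (simp add: field_simps)
    then have "1 / \<kappa> * tail_sum f m \<le> (1 + (real m - real l) / C) * tail_sum f m"
      using mpos by (intro mult_right_mono) auto
    also have "\<dots> \<le> tail_sum f l"
      using elim(1)[folded l_def] by (intro tail_sum_contraction l1 lm C k0) auto
    finally show ?case
      using \<kappa> unfolding tail_at_def l_def m_def by (simp add: field_simps)
  qed
qed

lemma exp_tail_upper:
  assumes "exp_tail f"
  obtains \<rho> A where "0 < \<rho>" "0 < A" "\<forall>\<^sub>F k in sequentially. tail_sum f k \<le> A * exp (- \<rho> * real k)"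
proof -
  obtain C where C: "0 < C" "\<forall>\<^sub>F k in sequentially. f (real k) * tail_sum f k \<le> C"
    using assms(1) by (auto simp: exp_tail_def)
  have "\<forall>\<^sub>F k in sequentially. f (real k) * tail_sum f k \<le> C \<and> 1 \<le> k"
    using C(2) eventually_ge_at_top[of 1] by (rule eventually_conj)
  then obtain k0 where k0: "\<And>k. k0 \<le> k \<Longrightarrow> f (real k) * tail_sum f k \<le> C \<and> 1 \<le> k"
    unfolding eventually_sequentially by blast
  \<comment> \<open>\<open>exp \<rho> = 1 + 1 / C\<close> is the contraction factor of a single
    step.\<close>
  define \<rho> where "\<rho> = ln (1 + 1 / C)"
  have \<rho>: "0 < \<rho>" unfolding \<rho>_def using C by (intro ln_gt_zero) simp
  have exp\<rho>: "exp \<rho> = 1 + 1 / C" using C by (simp add: \<rho>_def add_pos_pos)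
  define A where "A = tail_sum f k0 * exp (\<rho> * real k0)"
  have A: "0 < A" unfolding A_def using k0[of k0] by (intro mult_pos_pos tail_sum_pos) auto
  have "tail_sum f k \<le> A * exp (- \<rho> * real k)" if "k0 \<le> k" for k
    using that
  proof (induction rule: dec_induct)
    case base
    show ?case by (simp add: A_def mult.assoc exp_add[symmetric])
  next
    case (step k)
    have "exp \<rho> * tail_sum f (Suc k) \<le> tail_sum f k"
      using tail_sum_contraction[of k "Suc k" C] k0[OF step(1)] C exp\<rho> by simp
    also have "\<dots> \<le> A * exp (- \<rho> * real k)" by (rule step.IH)
    also have "\<dots> = exp \<rho> * (A * exp (- \<rho> * real (Suc k)))"
      by (simp add: exp_add[symmetric] algebra_simps)
    finally show ?case by simp
  qed
  then show ?thesis
    using that[OF \<rho> A] unfolding eventually_sequentially by blast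
qed

text \<open>The fraction of the tail lost in step \<open>k\<close> is
  \<open>1 / (f k * tail_sum f k)\<close>, which tends to 0 under type P. \<open>D\<close> is chosen
  so that a loss of at most \<open>1 / D\<close> leaves at least the factor
  \<open>exp (- \<sigma>)\<close>; the tail thus decays more slowly than any exponential.\<close>

lemma typeP_lower:
  assumes "typeP f" "0 < \<sigma>"
  obtains A where "0 < A" "\<forall>\<^sub>F k in sequentially. A * exp (- \<sigma> * real k) \<le> tail_sum f k"
proof -
  define D where "D = 1 / (1 - exp (- \<sigma>))"
  have D: "0 < 1 - exp (- \<sigma>)" using assms by simp
  have "\<forall>\<^sub>F k in sequentially. D \<le> f (real k) * tail_sum f k \<and> 1 \<le> k"
    using assms(1) unfolding typeP_def filterlim_at_top
    by (intro eventually_conj eventually_ge_at_top) blast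
  then obtain k0 where k0: "\<And>k. k0 \<le> k \<Longrightarrow> D \<le> f (real k) * tail_sum f k \<and> 1 \<le> k"
    unfolding eventually_sequentially by blast
  define A where "A = tail_sum f k0 * exp (\<sigma> * real k0)"
  have A: "0 < A" unfolding A_def using k0[of k0] by (intro mult_pos_pos tail_sum_pos) auto
  have "A * exp (- \<sigma> * real k) \<le> tail_sum f k" if "k0 \<le> k" for k
    using that
  proof (induction rule: dec_induct)
    case base
    show ?case by (simp add: A_def mult.assoc exp_add[symmetric])
  next
    case (step k)
    have k1: "1 \<le> k" using k0[OF step(1)] by simp
    have "1 / f (real k) \<le> (1 - exp (- \<sigma>)) * tail_sum f k"
      using k0[OF step(1)] pos[OF k1] D by (simp add: D_def field_simps)
    then have "exp (- \<sigma>) * tail_sum f k \<le> tail_sum f (Suc k)"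
      using tail_sum_Suc[of k] unfolding left_diff_distrib by linarith
    moreover have "exp (- \<sigma>) * (A * exp (- \<sigma> * real k)) \<le> exp (- \<sigma>) * tail_sum f k"
      using step.IH by (intro mult_left_mono) auto
    moreover have "A * exp (- \<sigma> * real (Suc k)) = exp (- \<sigma>) * (A * exp (- \<sigma> * real k))"
      by (simp add: exp_add[symmetric] algebra_simps)
    ultimately show ?case by linarith
  qed
  then show ?thesis
    using that[OF A] unfolding eventually_sequentially by blast
qed

end

lemma exp_tail_typeP_ratio:
  assumes f: "monopolistic f" "exp_tail f" and g: "monopolistic g" "typeP g" and ab: "0 < a" "0 < b"
  shows "(\<lambda>N. tail_at f a N / tail_at g b N) \<longlonglongrightarrow> 0"
proof -
  interpret f: monopolistic f by (rule f)
  interpret g: monopolistic g by (rule g)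
  obtain \<rho> A where \<rho>: "0 < \<rho>" "0 < A" and le: "\<forall>\<^sub>F k in sequentially. tail_sum f k \<le> A * exp (- \<rho> * real k)"
    using f.exp_tail_upper[OF f(2)] .
  \<comment> \<open>Along its ray the tail of \<open>g\<close> then decays at most at rate
    \<open>\<sigma> * b\<close>, half of the rate \<open>\<rho> * a\<close> of \<open>f\<close>; the
    remaining half is the constant \<open>c\<close> below.\<close>
  define \<sigma> where "\<sigma> = \<rho> * a / (2 * b)"
  have \<sigma>: "0 < \<sigma>" using \<rho> ab by (simp add: \<sigma>_def)
  obtain B where B: "0 < B" and ge: "\<forall>\<^sub>F k in sequentially. B * exp (- \<sigma> * real k) \<le> tail_sum g k"
    using g.typeP_lower[OF g(2) \<sigma>] .
  define c where "c = \<rho> * a / 2"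
  have c: "0 < c" using \<rho> ab by (simp add: c_def)
  have "\<forall>\<^sub>F N in sequentially. tail_sum f (nat \<lceil>a * real N\<rceil>) \<le> A * exp (- \<rho> * real (nat \<lceil>a * real N\<rceil>))"
    using le filterlim_nat_ceiling[OF ab(1)] unfolding filterlim_iff by blast
  moreover have "\<forall>\<^sub>F N in sequentially. B * exp (- \<sigma> * real (nat \<lceil>b * real N\<rceil>)) \<le> tail_sum g (nat \<lceil>b * real N\<rceil>)"
    using ge filterlim_nat_ceiling[OF ab(2)] unfolding filterlim_iff by blast
  ultimately have upper: "\<forall>\<^sub>F N in sequentially. tail_at f a N / tail_at g b N \<le> A / B * exp \<sigma> * exp (- c) ^ N"
    using eventually_ge_at_top[of 1]
  proof eventually_elim
    case (elim N)
    have gpos: "0 < tail_at g b N" using ab elim by (intro g.tail_at_pos)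
    have fpos: "0 < tail_at f a N" using ab elim by (intro f.tail_at_pos)
    have "0 \<le> a * real N" "0 \<le> b * real N" using ab by auto
    then have N: "a * real N \<le> real (nat \<lceil>a * real N\<rceil>)" "real (nat \<lceil>b * real N\<rceil>) \<le> b * real N + 1" by linarith+
    have "tail_at f a N \<le> A * exp (- \<rho> * real (nat \<lceil>a * real N\<rceil>))"
      using elim(1) by (simp add: tail_at_def)
    also have "\<dots> \<le> A * exp (- \<rho> * (a * real N))"
      using N(1) \<rho> by (intro mult_left_mono) auto
    finally have fle: "tail_at f a N \<le> A * exp (- \<rho> * (a * real N))" .
    have "B * exp (- \<sigma> * (b * real N + 1)) \<le> B * exp (- \<sigma> * real (nat \<lceil>b * real N\<rceil>))"
      using N(2) \<sigma> B by (intro mult_left_mono) auto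
    also have "\<dots> \<le> tail_at g b N" using elim(2) by (simp add: tail_at_def)
    finally have gge: "B * exp (- \<sigma> * (b * real N + 1)) \<le> tail_at g b N" .
    have "tail_at f a N / tail_at g b N \<le> (A * exp (- \<rho> * (a * real N))) / (B * exp (- \<sigma> * (b * real N + 1)))"
      using fle gge fpos B by (intro frac_le) auto
    also have "\<dots> = A / B * exp (- \<rho> * (a * real N) - (- \<sigma> * (b * real N + 1)))"
      by (simp only: exp_diff times_divide_times_eq)
    also have "- \<rho> * (a * real N) - (- \<sigma> * (b * real N + 1)) = \<sigma> + real N * (- c)"
      using ab by (simp add: \<sigma>_def c_def field_simps)
    also have "exp (\<sigma> + real N * (- c)) = exp \<sigma> * exp (- c) ^ N"
      by (simp only: exp_add exp_of_nat_mult)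
    finally show ?case by (simp add: mult.assoc)
  qed
  have lower: "\<forall>\<^sub>F N in sequentially. 0 \<le> tail_at f a N / tail_at g b N"
    using eventually_ge_at_top[of 1]
    by eventually_elim (intro divide_nonneg_nonneg less_imp_le[OF f.tail_at_pos] less_imp_le[OF g.tail_at_pos] ab)
  have "(\<lambda>N. exp (- c) ^ N) \<longlonglongrightarrow> 0"
    using c by (intro LIMSEQ_power_zero) simp
  then have "(\<lambda>N. A / B * exp \<sigma> * exp (- c) ^ N) \<longlonglongrightarrow> 0"
    using tendsto_mult_left[of _ 0 _ "A / B * exp \<sigma>"] by fastforce
  then show ?thesis
    by (rule tendsto_sandwich[OF lower upper tendsto_const])
qed

section \<open>Feedback functions at real arguments\<close>

lemma monotone_pieces_bounds:
  assumes f: "monotone_pieces f" and x: "1 \<le> x"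
  defines "k \<equiv> nat \<lfloor>x\<rfloor>"
  shows "min (f (real k)) (f (real (Suc k))) \<le> f x" "f x \<le> max (f (real k)) (f (real (Suc k)))"
proof -
  have k: "1 \<le> k" "real k \<le> x" "x \<le> real k + 1" using x unfolding k_def by linarith+
  have "(\<forall>x y. real k \<le> x \<longrightarrow> x \<le> y \<longrightarrow> y \<le> real k + 1 \<longrightarrow> f x \<le> f y) \<or>
      (\<forall>x y. real k \<le> x \<longrightarrow> x \<le> y \<longrightarrow> y \<le> real k + 1 \<longrightarrow> f y \<le> f x)"
    using f k(1) unfolding monotone_pieces_def by blast
  then have "f (real k) \<le> f x \<and> f x \<le> f (real k + 1) \<or> f (real k + 1) \<le> f x \<and> f x \<le> f (real k)"
    using k by auto
  moreover have "real (Suc k) = real k + 1" by simp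
  ultimately show "min (f (real k)) (f (real (Suc k))) \<le> f x" "f x \<le> max (f (real k)) (f (real (Suc k)))"
    by (metis min.coboundedI1 min.coboundedI2, metis max.coboundedI1 max.coboundedI2)
qed

lemma admissible_monotone_pieces: "admissible_feedback F \<Longrightarrow> monotone_pieces (F i)"
  by (simp add: admissible_feedback_def)

lemma admissible_pos_real:
  assumes "admissible_feedback F" "1 \<le> x"
  shows "0 < F i x"
proof -
  have "1 \<le> nat \<lfloor>x\<rfloor>" using assms(2) by linarith
  then have "0 < min (F i (real (nat \<lfloor>x\<rfloor>))) (F i (real (Suc (nat \<lfloor>x\<rfloor>))))"
    by (simp add: admissible_pos[OF assms(1)] del: of_nat_Suc)
  then show ?thesis
    using monotone_pieces_bounds(1)[OF admissible_monotone_pieces[OF assms(1)] assms(2)]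
    by (rule less_le_trans)
qed

context monopolistic
begin

lemma inverse_tail_le:
  assumes mp: "monotone_pieces f" and x: "1 \<le> x"
  shows "1 / tail_sum f (nat \<lfloor>x\<rfloor>) \<le> f x"
proof -
  define k where "k = nat \<lfloor>x\<rfloor>"
  have k: "1 \<le> k" using x unfolding k_def by linarith
  have ge: "1 / tail_sum f l \<le> f (real l)" if "1 \<le> l" for l
    using inverse_le_tail_sum[OF that] tail_sum_pos[OF that] pos[OF that] by (simp add: field_simps)
  have "1 / tail_sum f k \<le> 1 / tail_sum f (Suc k)"
    using k tail_sum_pos[of k] tail_sum_pos[of "Suc k"] tail_sum_antimono[of k "Suc k"]
    by (intro divide_left_mono mult_pos_pos) auto
  then have "1 / tail_sum f k \<le> min (f (real k)) (f (real (Suc k)))"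
    using ge[OF k] ge[of "Suc k"] by (auto simp del: of_nat_Suc)
  then show ?thesis
    using monotone_pieces_bounds(1)[OF mp x] unfolding k_def by linarith
qed

text \<open>The counterpart of \<open>inverse_tail_le\<close>. Together they show that for type E
  the function and its reciprocal tail are of the same order, which turns ratios of feedback
  functions into ratios of tails.\<close>

lemma exp_tail_le_inverse:
  assumes "exp_tail f" and mp: "monotone_pieces f"
  obtains C x0 where "0 < C" "1 \<le> x0" "\<And>x. x0 \<le> x \<Longrightarrow> f x \<le> C / tail_sum f (Suc (nat \<lfloor>x\<rfloor>))"
proof -
  obtain C where C: "0 < C" "\<forall>\<^sub>F k in sequentially. f (real k) * tail_sum f k \<le> C"
    using assms(1) by (auto simp: exp_tail_def)
  obtain k0 where k0: "\<And>k. k0 \<le> k \<Longrightarrow> f (real k) * tail_sum f k \<le> C"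
    using C(2) unfolding eventually_sequentially by blast
  have "f x \<le> C / tail_sum f (Suc (nat \<lfloor>x\<rfloor>))" if "real (Suc k0) \<le> x" for x
  proof -
    define k where "k = nat \<lfloor>x\<rfloor>"
    have x: "1 \<le> x" using that by simp
    have k: "1 \<le> k" "k0 \<le> k" using that unfolding k_def by linarith+
    have le: "f (real l) \<le> C / tail_sum f l" if "k \<le> l" for l
      using k0[of l] tail_sum_pos[of l] that k by (simp add: field_simps)
    have "C / tail_sum f k \<le> C / tail_sum f (Suc k)"
      using k C tail_sum_pos[of k] tail_sum_pos[of "Suc k"] tail_sum_antimono[of k "Suc k"]
      by (intro divide_left_mono mult_pos_pos) auto
    then have "max (f (real k)) (f (real (Suc k))) \<le> C / tail_sum f (Suc k)"
      using le[of k] le[of "Suc k"] by (auto simp del: of_nat_Suc)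
    then show ?thesis
      using monotone_pieces_bounds(2)[OF mp x] unfolding k_def by linarith
  qed
  then show ?thesis by (intro that[OF C(1), of "real (Suc k0)"]) auto
qed

end

text \<open>Passing from functions to tails costs the factor \<open>C / c\<close>. Moving the ray of
  \<open>f\<close> outward gains any factor; \<open>c / (2 * C)\<close> is requested, so 1/2
  remains.\<close>

lemma exp_tail_beats:
  assumes f: "monopolistic f" "monotone_pieces f" "exp_tail f"
    and g: "monopolistic g" "monotone_pieces g"
    and c: "0 < c" and ge: "\<forall>\<^sub>F n in sequentially. c * g (b * real n) \<le> f (a * real n)"
    and pos: "0 < a" "a < a'" "0 < b'" "b' < b"
  shows "beats f a' g b'"
proof -
  interpret f: monopolistic f by (rule f)
  interpret g: monopolistic g by (rule g)
  obtain C x0 where C: "0 < C" "1 \<le> x0" "\<And>x. x0 \<le> x \<Longrightarrow> f x \<le> C / tail_sum f (Suc (nat \<lfloor>x\<rfloor>))"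
    using f.exp_tail_le_inverse[OF f(3,2)] by blast
  \<comment> \<open>The move from \<open>a\<close> to \<open>z\<close> covers the rounding of
    \<open>a * n\<close>, the move from \<open>z\<close> to \<open>a'\<close> provides the
    gain.\<close>
  obtain z where z: "a < z" "z < a'" using dense[OF pos(2)] by blast
  have z0: "0 < z" using z pos by simp
  have "0 < c / (2 * C)" using c C by simp
  from f.exp_tail_at_ratio[OF f(3) z0 z(2) this]
  have "\<forall>\<^sub>F n in sequentially. tail_at f a' n \<le> c / (2 * C) * tail_at f z n" .
  moreover have "\<forall>\<^sub>F n in sequentially. a * real n + 1 \<le> z * real n" "\<forall>\<^sub>F n in sequentially. b' * real n + 1 \<le> b * real n"
    "\<forall>\<^sub>F n in sequentially. 0 * real n + x0 \<le> a * real n"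
    "\<forall>\<^sub>F n in sequentially. 0 * real n + 1 \<le> b * real n"
    by (rule eventually_linear_le, use z pos in simp)+
  ultimately have "\<forall>\<^sub>F n in sequentially. tail_at f a' n \<le> 1 / 2 * tail_at g b' n"
    using ge eventually_ge_at_top[of 1]
  proof eventually_elim
    case (elim n)
    define k where "k = Suc (nat \<lfloor>a * real n\<rfloor>)"
    define l where "l = nat \<lfloor>b * real n\<rfloor>"
    have an: "x0 \<le> a * real n" and bn: "1 \<le> b * real n" using elim by auto
    have k1: "1 \<le> k" by (simp add: k_def)
    have l1: "1 \<le> l" using bn unfolding l_def by linarith
    have fk: "0 < tail_sum f k" by (rule f.tail_sum_pos[OF k1])
    have gl: "0 < tail_sum g l" by (rule g.tail_sum_pos[OF l1])
    have "c * (1 / tail_sum g l) \<le> c * g (b * real n)"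
      unfolding l_def using c by (intro mult_left_mono g.inverse_tail_le[OF g(2) bn]) auto
    also have "\<dots> \<le> f (a * real n)" by (rule elim)
    also have "\<dots> \<le> C / tail_sum f k" unfolding k_def by (rule C(3)[OF an])
    finally have 1: "c * tail_sum f k \<le> C * tail_sum g l"
      using fk gl by (simp add: field_simps)
    have "tail_at f z n \<le> tail_sum f k"
      unfolding tail_at_def using elim an C(2) by (intro f.tail_sum_antimono k1) (unfold k_def, linarith)
    then have "c * tail_at f z n \<le> c * tail_sum f k" using c by (intro mult_left_mono) auto
    moreover have "tail_sum g l \<le> tail_at g b' n"
    proof -
      have "0 < b' * real n" using pos elim by simp
      then show ?thesis
        unfolding tail_at_def using elim bn
        by (intro g.tail_sum_antimono nat_ceiling_ge_1 pos) (unfold l_def, linarith+)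
    qed
    then have "C * tail_sum g l \<le> C * tail_at g b' n" using C by (intro mult_left_mono) auto
    ultimately have "c * tail_at f z n \<le> C * tail_at g b' n" using 1 by linarith
    then have "c / (2 * C) * tail_at f z n \<le> 1 / 2 * tail_at g b' n"
      using C by (simp add: field_simps)
    with elim show ?case by linarith
  qed
  then show ?thesis unfolding beats_def by (intro exI[of _ "1 / 2"]) auto
qed

text \<open>Every \<open>x\<close> in the interval can serve as a starting point. A positive lower
  limit of the quotient lets \<open>f\<close> win slightly to the right of \<open>x\<close>, a
  finite upper limit lets \<open>g\<close> win slightly to the left.\<close>

lemma exp_tail_dichotomy:
  assumes f: "monopolistic f" "monotone_pieces f" "exp_tail f"
    and g: "monopolistic g" "monotone_pieces g" "exp_tail g"
    and pos: "\<And>x. 1 \<le> x \<Longrightarrow> 0 < f x" "\<And>x. 1 \<le> x \<Longrightarrow> 0 < g x"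
    and osc: "\<And>x. 0 < x \<Longrightarrow> x < 1 \<Longrightarrow>
      \<not> (liminf (\<lambda>n. ereal (f (x * real n) / g ((1 - x) * real n))) = 0
        \<and> limsup (\<lambda>n. ereal (f (x * real n) / g ((1 - x) * real n))) = \<infinity>)"
  shows "dichotomy f g"
  unfolding dichotomy_def
proof (intro allI impI)
  fix s t :: real assume st: "0 < s" "s < t" "t < 1"
  obtain x where x: "s < x" "x < t" using dense[OF st(2)] by blast
  define u where "u n = f (x * real n) / g ((1 - x) * real n)" for n
  have "\<forall>\<^sub>F n in sequentially. 0 * real n + 1 \<le> x * real n" "\<forall>\<^sub>F n in sequentially. 0 * real n + 1 \<le> (1 - x) * real n"
    by (rule eventually_linear_le, use x st in simp)+
  then have fg_pos: "\<forall>\<^sub>F n in sequentially. 0 < f (x * real n) \<and> 0 < g ((1 - x) * real n)"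
    by eventually_elim (auto intro: pos)
  have "liminf (\<lambda>n. ereal (u n)) \<noteq> 0 \<or> limsup (\<lambda>n. ereal (u n)) \<noteq> \<infinity>"
    using osc[of x] x st by (auto simp: u_def)
  then show "\<exists>x. s < x \<and> x < t \<and> (beats f x g (1 - x) \<or> beats g (1 - x) f x)"
  proof
    assume ne: "liminf (\<lambda>n. ereal (u n)) \<noteq> 0"
    have "0 \<le> liminf (\<lambda>n. ereal (u n))"
      using fg_pos by (intro Liminf_bounded) (auto elim!: eventually_mono simp: u_def)
    then have "0 < liminf (\<lambda>n. ereal (u n))" using ne by simp
    then obtain c where c: "0 < ereal c" "ereal c < liminf (\<lambda>n. ereal (u n))"
      using ereal_dense2 by blast
    have "\<forall>\<^sub>F n in sequentially. ereal c < ereal (u n)" using c(2) by (rule less_LiminfD)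
    then have ge: "\<forall>\<^sub>F n in sequentially. c * g ((1 - x) * real n) \<le> f (x * real n)"
      using fg_pos by eventually_elim (auto simp: u_def field_simps)
    obtain y where y: "x < y" "y < t" using dense[OF x(2)] by blast
    have "beats f y g (1 - y)"
      using c(1) x y st by (intro exp_tail_beats[OF f g(1,2) _ ge]) auto
    then show ?thesis using x y by (intro exI[of _ y]) auto
  next
    assume ne: "limsup (\<lambda>n. ereal (u n)) \<noteq> \<infinity>"
    then have "limsup (\<lambda>n. ereal (u n)) < \<infinity>" by simp
    then obtain C where C: "0 < C" "\<forall>\<^sub>F n in sequentially. u n \<le> C" by (rule limsup_finite_bound)
    have ge: "\<forall>\<^sub>F n in sequentially. 1 / C * f (x * real n) \<le> g ((1 - x) * real n)"
      using C(2) fg_pos by eventually_elim (use C(1) in \<open>auto simp: u_def field_simps\<close>)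
    obtain y where y: "s < y" "y < x" using dense[OF x(1)] by blast
    have "beats g (1 - y) f y"
      using C(1) x y st by (intro exp_tail_beats[OF g f(1,2) _ ge]) auto
    then show ?thesis using x y by (intro exI[of _ y]) auto
  qed
qed

section \<open>Agents of type P\<close>

text \<open>The closed sets \<open>E M\<close>, on which the sequence oscillates by at most
  \<open>e / 2\<close> from index \<open>M + n0\<close> on, exhaust the interval, so by Baire's
  theorem one of them contains a subinterval. There all later functions follow the continuous
  \<open>h (M + n0)\<close>, which is nearly constant close to \<open>y\<close>.\<close>

lemma pointwise_convergent_nearly_constant:
  fixes h :: "nat \<Rightarrow> real \<Rightarrow> real"
  assumes ab: "a < b" and e: "0 < e"
    and cont: "\<And>n. n0 \<le> n \<Longrightarrow> continuous_on {a..b} (h n)"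
    and conv: "\<And>x. x \<in> {a..b} \<Longrightarrow> convergent (\<lambda>n. h n x)"
  obtains c d y M where "a \<le> c" "c < d" "d \<le> b" "y \<in> {a..b}" "n0 \<le> M"
    "\<And>n x. M \<le> n \<Longrightarrow> c < x \<Longrightarrow> x < d \<Longrightarrow> \<bar>h n x - h M y\<bar> \<le> e"
proof -
  define S where "S = {a..b}"
  define E where "E M = {x \<in> S. \<forall>n\<ge>M + n0. \<forall>m\<ge>M + n0. \<bar>h n x - h m x\<bar> \<le> e / 2}" for M
  have closed_E: "closed (E M)" for M
  proof -
    have "E M = S \<inter> (\<Inter>n\<in>{M + n0..}. \<Inter>m\<in>{M + n0..}. {x \<in> S. \<bar>h n x - h m x\<bar> \<le> e / 2})"
      by (auto simp: E_def)
    also have "closed \<dots>"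
    proof (intro closed_Int closed_INT ballI)
      show "closed S" by (simp add: S_def)
      fix n m assume "n \<in> {M + n0..}" "m \<in> {M + n0..}"
      then have "continuous_on S (\<lambda>x. \<bar>h n x - h m x\<bar>)"
        unfolding S_def by (intro continuous_intros cont) auto
      then have "closed (S \<inter> (\<lambda>x. \<bar>h n x - h m x\<bar>) -` {..e / 2})"
        by (rule continuous_closed_preimage) (auto simp: S_def)
      also have "S \<inter> (\<lambda>x. \<bar>h n x - h m x\<bar>) -` {..e / 2} = {x \<in> S. \<bar>h n x - h m x\<bar> \<le> e / 2}"
        by auto
      finally show "closed {x \<in> S. \<bar>h n x - h m x\<bar> \<le> e / 2}" .
    qed
    finally show ?thesis .
  qed
  have cover: "\<exists>M. x \<in> E M" if x: "x \<in> S" for x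
  proof -
    have "Cauchy (\<lambda>n. h n x)"
      using conv[of x] x by (simp add: S_def convergent_Cauchy)
    then obtain M where M: "\<And>m n. M \<le> m \<Longrightarrow> M \<le> n \<Longrightarrow> dist (h m x) (h n x) < e / 2"
      using e unfolding Cauchy_def by (meson half_gt_zero)
    then have "x \<in> E M" using x M by (auto simp: E_def dist_real_def intro: less_imp_le)
    then show ?thesis ..
  qed
  have "\<exists>M. \<not> S \<subseteq> closure (S - E M)"
  proof (rule ccontr)
    assume "\<not> ?thesis"
    then have dense: "S \<subseteq> closure (S - E M)" for M by blast
    \<comment> \<open>If every complement were dense, countably many relatively open dense sets
      would have a dense intersection, yet this intersection is empty.\<close>
    have "S \<subseteq> closure (\<Inter>(range (\<lambda>M. S - E M)))"
    proof (rule Baire)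
      fix T assume "T \<in> range (\<lambda>M. S - E M)"
      then obtain M where T: "T = S - E M" by blast
      have "openin (top_of_set S) (S - E M)"
        using closed_E[of M] by (metis Diff_eq open_Compl openin_open_Int)
      then show "openin (top_of_set S) T \<and> S \<subseteq> closure T" using dense[of M] T by simp
    qed (auto simp: S_def)
    also have "\<Inter>(range (\<lambda>M. S - E M)) = {}" using cover by auto
    finally show False using ab by (simp add: S_def)
  qed
  then obtain M z where z: "z \<in> S" "z \<notin> closure (S - E M)" by blast
  then have "z \<in> - closure (S - E M)" by simp
  then obtain r where r: "0 < r" "ball z r \<subseteq> - closure (S - E M)"
    using openE[OF open_Compl[OF closed_closure]] by blast
  then have disj: "ball z r \<inter> (S - E M) = {}" using closure_subset[of "S - E M"] by blast
  define c where "c = max a (z - r)"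
  define d where "d = min b (z + r)"
  have cd: "a \<le> c" "c < d" "d \<le> b" using ab z r by (auto simp: c_def d_def S_def)
  have inE: "x \<in> E M" if "c < x" "x < d" for x
  proof -
    have "x \<in> ball z r" using that by (auto simp: c_def d_def dist_real_def)
    moreover have "x \<in> S" using that by (auto simp: c_def d_def S_def)
    ultimately show ?thesis using disj by blast
  qed
  define y where "y = (c + d) / 2"
  have y: "c < y" "y < d" using cd by (auto simp: y_def)
  have yS: "y \<in> {a..b}" using y cd by auto
  have "continuous (at y within {a..b}) (h (M + n0))"
    using cont[of "M + n0"] yS by (simp add: continuous_on_eq_continuous_within)
  then obtain \<delta> where \<delta>: "0 < \<delta>" "\<And>x. x \<in> {a..b} \<Longrightarrow> dist x y < \<delta> \<Longrightarrow> dist (h (M + n0) x) (h (M + n0) y) < e / 2"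
    using e unfolding continuous_within_eps_delta by (meson half_gt_zero)
  show ?thesis
  proof (rule that[of "max c (y - \<delta>)" "min d (y + \<delta>)" y "M + n0"])
    show "a \<le> max c (y - \<delta>)" "min d (y + \<delta>) \<le> b" using cd by auto
    show "max c (y - \<delta>) < min d (y + \<delta>)" using y \<delta>(1) cd by auto
    show "y \<in> {a..b}" "n0 \<le> M + n0" using yS by auto
    fix n x assume n: "M + n0 \<le> n" and "max c (y - \<delta>) < x" "x < min d (y + \<delta>)"
    then have x: "c < x" "x < d" "dist x y < \<delta>" by (auto simp: dist_real_def)
    have "\<bar>h n x - h (M + n0) x\<bar> \<le> e / 2" using inE[OF x(1,2)] n by (auto simp: E_def)
    moreover have "\<bar>h (M + n0) x - h (M + n0) y\<bar> < e / 2"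
      using \<delta>(2)[of x] x cd by (auto simp: dist_real_def)
    ultimately show "\<bar>h n x - h (M + n0) y\<bar> \<le> e" by linarith
  qed
qed

text \<open>The tails are cut into blocks of lengths \<open>u\<close> and \<open>v\<close>. Any term
  of one block is comparable with any term of the block of the same number \<open>t\<close>, so
  summing over all \<open>u * v\<close> pairs compares the block sums; each sum acquires the length
  of the other block as a weight.\<close>

lemma tail_sum_block_le:
  fixes u v :: nat
  assumes f: "monopolistic f" and g: "monopolistic g" and uv: "0 < u" "0 < v"
    and le: "\<And>t l m. n \<le> t \<Longrightarrow> u * t \<le> l \<Longrightarrow> l < u * Suc t \<Longrightarrow> v * t \<le> m \<Longrightarrow> m < v * Suc t \<Longrightarrow>
      A * (1 / g (real m)) \<le> B * (1 / f (real l))"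
  shows "real u * A * tail_sum g (v * n) \<le> real v * B * tail_sum f (u * n)"
proof -
  interpret f: monopolistic f by (rule f)
  interpret g: monopolistic g by (rule g)
  have split: "(\<Sum>k = w * n..<w * Suc t. \<phi> k) = (\<Sum>k = w * n..<w * t. \<phi> k) + (\<Sum>k = w * t..<w * Suc t. \<phi> k)"
    if "n \<le> t" for w t and \<phi> :: "nat \<Rightarrow> real"
    using that by (intro sum.atLeastLessThan_concat[symmetric]) auto
  have partial: "real u * A * (\<Sum>m = v * n..<v * t. 1 / g (real m)) \<le> real v * B * (\<Sum>l = u * n..<u * t. 1 / f (real l))"
    if "n \<le> t" for t
    using that
  proof (induction rule: dec_induct)
    case (step t)
    have "real u * A * (\<Sum>m = v * t..<v * Suc t. 1 / g (real m))
        = (\<Sum>l = u * t..<u * Suc t. \<Sum>m = v * t..<v * Suc t. A * (1 / g (real m)))"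
      by (simp add: sum_distrib_left algebra_simps)
    also have "\<dots> \<le> (\<Sum>l = u * t..<u * Suc t. \<Sum>m = v * t..<v * Suc t. B * (1 / f (real l)))"
      using step(1) by (intro sum_mono le[of t]) auto
    also have "\<dots> = real v * B * (\<Sum>l = u * t..<u * Suc t. 1 / f (real l))"
      by (simp add: sum_distrib_left algebra_simps)
    finally show ?case
      using step.IH by (simp only: split[OF step(1)] distrib_left)
  qed simp
  have lim: "filterlim (\<lambda>t. w * t) at_top sequentially" if "0 < w" for w :: nat
    using that by (intro filterlim_subseq) (auto simp: strict_mono_def)
  have "(\<lambda>t. real u * A * (\<Sum>m = v * n..<v * t. 1 / g (real m))) \<longlonglongrightarrow> real u * A * tail_sum g (v * n)"
    by (intro tendsto_mult_left filterlim_compose[OF g.partial_sums_tendsto_tail_sum lim] uv)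
  moreover have "(\<lambda>t. real v * B * (\<Sum>l = u * n..<u * t. 1 / f (real l))) \<longlonglongrightarrow> real v * B * tail_sum f (u * n)"
    by (intro tendsto_mult_left filterlim_compose[OF f.partial_sums_tendsto_tail_sum lim] uv)
  ultimately show ?thesis
    by (rule LIMSEQ_le) (use partial in blast)
qed

text \<open>Along \<open>u * n\<close> and \<open>v * n\<close> the tails are controlled only up to
  \<open>K\<close>, which may exceed 1. Moving the ray of \<open>f\<close> from \<open>b\<close> to
  \<open>x\<close> gains \<open>\<kappa>\<close>, enough because \<open>\<kappa> * K < 1\<close>.
  The rays are read at the indices \<open>(u + v) * n\<close>, and the last move from
  \<open>x\<close> to \<open>y\<close> pays for rescaling to all indices.\<close>

lemma beats_of_multiples:
  fixes u v :: nat
  assumes f: "monopolistic f" and g: "monopolistic g" and uv: "0 < u" "0 < v"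
    and b: "real u \<le> b * real (u + v)" "b < x" "x < y" "y < 1"
    and \<kappa>: "0 < \<kappa>" "\<forall>\<^sub>F N in sequentially. tail_at f x N \<le> \<kappa> * tail_at f b N"
    and K: "\<kappa> * K < 1" "\<forall>\<^sub>F n in sequentially. tail_sum f (u * n) \<le> K * tail_sum g (v * n)"
    and K0: "0 \<le> K"
  shows "beats f y g (1 - y)"
proof -
  interpret f: monopolistic f by (rule f)
  interpret g: monopolistic g by (rule g)
  define w where "w = real (u + v)"
  have w: "0 < w" using uv by (simp add: w_def)
  have b0: "0 < b" using b(1) uv w unfolding w_def[symmetric] by (metis less_le_trans of_nat_0_less_iff zero_less_mult_pos2)
  have scale: "tail_at \<phi> (a * w) n = tail_at \<phi> a ((u + v) * n)" for \<phi> a n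
    by (simp add: tail_at_def w_def mult.assoc)
  have "filterlim (\<lambda>n. (u + v) * n) at_top sequentially"
    using uv by (intro filterlim_subseq) (auto simp: strict_mono_def)
  then have "\<forall>\<^sub>F n in sequentially. tail_at f x ((u + v) * n) \<le> \<kappa> * tail_at f b ((u + v) * n)"
    using \<kappa>(2) unfolding filterlim_iff by blast
  then have "\<forall>\<^sub>F n in sequentially. tail_at f (x * w) n \<le> (\<kappa> * K) * tail_at g ((1 - x) * w) n"
    using K(2) eventually_ge_at_top[of 1]
  proof eventually_elim
    case (elim n)
    have un: "1 \<le> u * n" "1 \<le> v * n" using uv elim(3) by auto
    have "u * n \<le> nat \<lceil>(b * w) * real n\<rceil>"
    proof -
      have "real u * real n \<le> b * w * real n" using b(1) by (intro mult_right_mono) (auto simp: w_def)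
      then have "real (u * n) \<le> b * w * real n" by simp
      then show ?thesis by linarith
    qed
    then have 1: "tail_at f (b * w) n \<le> tail_sum f (u * n)"
      unfolding tail_at_def by (rule f.tail_sum_antimono[OF un(1)])
    have "nat \<lceil>((1 - x) * w) * real n\<rceil> \<le> v * n"
    proof -
      have "b * w \<le> x * w" using b w by (intro mult_right_mono) auto
      then have "(1 - x) * w \<le> real v" using b(1) by (simp add: w_def algebra_simps)
      then have "(1 - x) * w * real n \<le> real v * real n" by (intro mult_right_mono) auto
      then have "(1 - x) * w * real n \<le> real (v * n)" by simp
      then show ?thesis by linarith
    qed
    then have 2: "tail_sum g (v * n) \<le> tail_at g ((1 - x) * w) n"
      unfolding tail_at_def using b w elim(3)
      by (intro g.tail_sum_antimono nat_ceiling_ge_1 mult_pos_pos) auto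
    have "tail_at f (x * w) n \<le> \<kappa> * tail_at f (b * w) n" using elim(1) by (simp only: scale)
    also have "\<dots> \<le> \<kappa> * tail_sum f (u * n)" using 1 \<kappa> by (intro mult_left_mono) auto
    also have "\<dots> \<le> \<kappa> * (K * tail_sum g (v * n))" using elim(2) \<kappa> by (intro mult_left_mono) auto
    also have "\<dots> \<le> \<kappa> * (K * tail_at g ((1 - x) * w) n)" using 2 \<kappa> K0 by (intro mult_left_mono) auto
    finally show ?case by (simp add: mult.assoc)
  qed
  then have "beats f (x * w) g ((1 - x) * w)" using K(1) unfolding beats_def by blast
  then show ?thesis
    by (rule beats_scale[OF _ f g, where l = "1 / w"]) (use w b b0 in auto)
qed

text \<open>The map sending \<open>r\<close> to \<open>r / (r + 1)\<close> takes limits in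
  \<open>[0, \<infinity>]\<close> to finite ones, so an infinite limit of the quotient needs no
  separate treatment in the Baire argument.\<close>

lemma convergent_ratio_fraction:
  fixes a b :: "nat \<Rightarrow> real"
  assumes pos: "\<forall>\<^sub>F n in sequentially. 0 < a n \<and> 0 < b n"
    and lim: "((\<lambda>n. ereal (a n / b n)) \<longlongrightarrow> L) sequentially" and L: "0 \<le> L"
  shows "convergent (\<lambda>n. a n / (a n + b n))"
proof (cases L)
  case (real r)
  then have r: "0 \<le> r" using L by simp
  have "(\<lambda>n. a n / b n) \<longlonglongrightarrow> r" using lim real by simp
  then have "(\<lambda>n. (a n / b n) / (a n / b n + 1)) \<longlonglongrightarrow> r / (r + 1)"
    using r by (intro tendsto_intros) auto
  moreover have "\<forall>\<^sub>F n in sequentially. (a n / b n) / (a n / b n + 1) = a n / (a n + b n)"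
    using pos by eventually_elim (auto simp: field_simps)
  ultimately have "(\<lambda>n. a n / (a n + b n)) \<longlonglongrightarrow> r / (r + 1)"
    by (rule Lim_transform_eventually)
  then show ?thesis by (rule convergentI)
next
  case PInf
  then have "filterlim (\<lambda>n. a n / b n) at_top sequentially"
    using lim by (simp add: tendsto_PInfty_eq_at_top)
  then have "filterlim (\<lambda>n. 1 + a n / b n) at_top sequentially"
    by (intro filterlim_tendsto_add_at_top[OF tendsto_const])
  then have "(\<lambda>n. inverse (1 + a n / b n)) \<longlonglongrightarrow> 0"
    by (rule tendsto_inverse_0_at_top)
  then have "(\<lambda>n. 1 - inverse (1 + a n / b n)) \<longlonglongrightarrow> 1 - 0" by (intro tendsto_intros)
  moreover have "\<forall>\<^sub>F n in sequentially. 1 - inverse (1 + a n / b n) = a n / (a n + b n)"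
    using pos by eventually_elim (auto simp: field_simps add_pos_pos)
  ultimately have "(\<lambda>n. a n / (a n + b n)) \<longlonglongrightarrow> 1 - 0"
    by (rule Lim_transform_eventually)
  then show ?thesis by (rule convergentI)
qed (use L in auto)

text \<open>If no comparison were possible on an interval, then, by Baire's theorem, \<open>f l\<close> and \<open>g m\<close> would
  be nearly proportional for all large integers \<open>l\<close>, \<open>m\<close> in some cone, which bounds the ratio of the
  tail sums along a rational ray of this cone and excludes the oscillation of this ratio.\<close>

lemma ratio_limit_dichotomy:
  assumes f: "monopolistic f" "poly_tail f" "continuous_on {0<..} f"
    and g: "monopolistic g" "poly_tail g" "continuous_on {0<..} g"
    and pos: "\<And>x. 1 \<le> x \<Longrightarrow> 0 < f x" "\<And>x. 1 \<le> x \<Longrightarrow> 0 < g x"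
    and lim: "\<And>x. 0 < x \<Longrightarrow> x < 1 \<Longrightarrow>
      \<exists>L::ereal. 0 \<le> L \<and> ((\<lambda>n. ereal (f (x * real n) / g ((1 - x) * real n))) \<longlongrightarrow> L) sequentially"
  shows "dichotomy f g"
  unfolding dichotomy_def
proof (intro allI impI, rule ccontr)
  interpret f: monopolistic f by (rule f)
  interpret g: monopolistic g by (rule g)
  fix s t :: real assume st: "0 < s" "s < t" "t < 1"
    and none: "\<not> (\<exists>x. s < x \<and> x < t \<and> (beats f x g (1 - x) \<or> beats g (1 - x) f x))"
  \<comment> \<open>Baire's theorem is applied on \<open>[a, b]\<close>. On the right,
    \<open>x1\<close> provides the gain for the tail of \<open>f\<close> and \<open>x2\<close> the
    slack for rescaling; \<open>y1\<close> and \<open>y2\<close> do the same for \<open>g\<close> on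
    the left.\<close>
  obtain a where a: "s < a" "a < t" using dense[OF st(2)] by blast
  obtain b where b: "a < b" "b < t" using dense[OF a(2)] by blast
  obtain x1 where x1: "b < x1" "x1 < t" using dense[OF b(2)] by blast
  obtain x2 where x2: "x1 < x2" "x2 < t" using dense[OF x1(2)] by blast
  obtain y1 where y1: "s < y1" "y1 < a" using dense[OF a(1)] by blast
  obtain y2 where y2: "s < y2" "y2 < y1" using dense[OF y1(1)] by blast
  have "0 < b" using a b st by simp
  from f.tail_at_contraction[OF f(2) this x1(1)]
  obtain \<kappa>1 where \<kappa>1: "0 < \<kappa>1" "\<kappa>1 < 1" "\<forall>\<^sub>F N in sequentially. tail_at f x1 N \<le> \<kappa>1 * tail_at f b N" .
  have "0 < 1 - a" "1 - a < 1 - y1" using a y1 st by auto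
  from g.tail_at_contraction[OF g(2) this]
  obtain \<kappa>2 where \<kappa>2: "0 < \<kappa>2" "\<kappa>2 < 1" "\<forall>\<^sub>F N in sequentially. tail_at g (1 - y1) N \<le> \<kappa>2 * tail_at g (1 - a) N" .
  define \<kappa> where "\<kappa> = max \<kappa>1 \<kappa>2"
  have \<kappa>: "0 < \<kappa>" "\<kappa> < 1" using \<kappa>1 \<kappa>2 by (auto simp: \<kappa>_def)
  \<comment> \<open>The midpoint of 1 and \<open>1 / \<kappa>\<close>: below
    \<open>1 / \<kappa>\<close>, so that the gain outweighs it, and above 1, so that exceeding it in
    both directions contradicts near proportionality.\<close>
  define K where "K = (1 + 1 / \<kappa>) / 2"
  have K: "1 < K" "\<kappa> * K < 1" using \<kappa> by (auto simp: K_def field_simps)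
  have K1: "\<kappa>1 * K < 1" "\<kappa>2 * K < 1"
    using K mult_right_mono[OF max.cobounded1, of K \<kappa>1 \<kappa>2] mult_right_mono[OF max.cobounded2, of K \<kappa>2 \<kappa>1]
    unfolding \<kappa>_def by linarith+
  define \<mu> where "\<mu> = min a (1 - b)"
  have \<mu>: "0 < \<mu>" using a b st by (auto simp: \<mu>_def)
  \<comment> \<open>Makes \<open>e * (K + 1)\<close> equal to \<open>(K - 1) * \<mu> / 2\<close>,
    half of what the final estimate could tolerate.\<close>
  define e where "e = (K - 1) * \<mu> / (2 * (K + 1))"
  have e: "0 < e" using K \<mu> by (simp add: e_def)
  define h where "h n x = f (x * real n) / (f (x * real n) + g ((1 - x) * real n))" for n x
  obtain n0 where n0: "1 \<le> \<mu> * real n0"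
  proof
    show "1 \<le> \<mu> * real (nat \<lceil>1 / \<mu>\<rceil>)"
      using mult_left_mono[OF real_nat_ceiling_ge[of "1 / \<mu>"], of \<mu>] \<mu> by simp
  qed
  have big: "1 \<le> x * real n \<and> 1 \<le> (1 - x) * real n" if "n0 \<le> n" "x \<in> {a..b}" for n x
  proof -
    have "\<mu> \<le> x" "\<mu> \<le> 1 - x" using that(2) unfolding \<mu>_def by auto
    then have "\<mu> * real n0 \<le> x * real n" "\<mu> * real n0 \<le> (1 - x) * real n"
      using that(1) \<mu> by (auto intro!: mult_mono)
    then show ?thesis using n0 by linarith
  qed
  have h01: "0 \<le> h n x \<and> h n x \<le> 1" if "n0 \<le> n" "x \<in> {a..b}" for n x
    using pos(1)[of "x * real n"] pos(2)[of "(1 - x) * real n"] big[OF that]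
    by (auto simp: h_def intro!: divide_nonneg_nonneg add_nonneg_nonneg less_imp_le)
  have cont: "continuous_on {a..b} (h n)" if n: "n0 \<le> n" for n
  proof -
    have cf: "continuous_on {a..b} (\<lambda>x. f (x * real n))"
      using big[OF n] by (intro continuous_on_compose2[OF f(3)] continuous_intros) fastforce
    have cg: "continuous_on {a..b} (\<lambda>x. g ((1 - x) * real n))"
      using big[OF n] by (intro continuous_on_compose2[OF g(3)] continuous_intros) fastforce
    have "f (x * real n) + g ((1 - x) * real n) \<noteq> 0" if "x \<in> {a..b}" for x
      using pos(1)[of "x * real n"] pos(2)[of "(1 - x) * real n"] big[OF n that] by force
    then show ?thesis
      unfolding h_def by (intro continuous_on_divide continuous_on_add cf cg) auto
  qed
  have conv: "convergent (\<lambda>n. h n x)" if x: "x \<in> {a..b}" for x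
  proof -
    have x01: "0 < x" "x < 1" using x a b st by auto
    obtain L :: ereal where L: "0 \<le> L" "((\<lambda>n. ereal (f (x * real n) / g ((1 - x) * real n))) \<longlongrightarrow> L) sequentially"
      using lim[OF x01] by blast
    have "\<forall>\<^sub>F n in sequentially. 0 < f (x * real n) \<and> 0 < g ((1 - x) * real n)"
      using eventually_ge_at_top[of n0] by eventually_elim (use big x pos in blast)
    then show ?thesis
      unfolding h_def using L by (intro convergent_ratio_fraction)
  qed
  obtain c d y M where cd: "a \<le> c" "c < d" "d \<le> b" and y: "y \<in> {a..b}" and M: "n0 \<le> M"
    and near: "\<And>n x. M \<le> n \<Longrightarrow> c < x \<Longrightarrow> x < d \<Longrightarrow> \<bar>h n x - h M y\<bar> \<le> e"
    using pointwise_convergent_nearly_constant[OF b(1) e cont conv] by blast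
  define p where "p = h M y"
  have p: "0 \<le> p" "p \<le> 1" using h01[OF M y] by (auto simp: p_def)
  \<comment> \<open>A rational ray meets the integer pairs \<open>(u * n, v * n)\<close>, along
    which the tails can be cut into matching blocks.\<close>
  obtain r where r: "r \<in> \<rat>" "c < r" "r < d" using Rats_dense_in_real[OF cd(2)] by blast
  have r01: "0 < r" "r < 1" using r cd a b st by auto
  obtain u w :: nat where uw: "w \<noteq> 0" "r = real u / real w"
    using Rats_abs_nat_div_natE[OF r(1)] r01 by (metis abs_of_pos)
  have "0 < u" using uw r01 by (cases u) auto
  have "u < w" using r01(2) uw(1) unfolding uw(2) by simp
  define v where "v = w - u"
  have w: "w = u + v" and v: "0 < v" using \<open>u < w\<close> by (auto simp: v_def)
  have ruv: "r = real u / real (u + v)" using uw w by simp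
  have c_less: "c * real v < (1 - c) * real u"
    using r(2) v unfolding ruv by (simp add: pos_less_divide_eq algebra_simps)
  have d_less: "(1 - d) * real u < d * real v"
    using r(3) v unfolding ruv by (simp add: pos_divide_less_eq algebra_simps)
  have "\<forall>\<^sub>F t in sequentially. c * real v * real t + c * real v \<le> (1 - c) * real u * real t"
    "\<forall>\<^sub>F t in sequentially. (1 - d) * real u * real t + (1 - d) * real u \<le> d * real v * real t"
    by (rule eventually_linear_le, use c_less d_less in simp)+
  then have "\<forall>\<^sub>F t in sequentially. c * real v * real t + c * real v \<le> (1 - c) * real u * real t \<and>
      (1 - d) * real u * real t + (1 - d) * real u \<le> d * real v * real t \<and> Suc M \<le> t"
    using eventually_ge_at_top[of "Suc M"] by eventually_elim auto
  \<comment> \<open>From block \<open>t0\<close> on, all pairs \<open>(l, m)\<close> of equally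
    numbered blocks lie in the cone between \<open>c\<close> and \<open>d\<close>: they deviate from
    the ray by a bounded amount, while the cone widens linearly.\<close>
  then obtain t0 where t0: "\<And>t. t0 \<le> t \<Longrightarrow> c * real v * real t + c * real v \<le> (1 - c) * real u * real t \<and>
      (1 - d) * real u * real t + (1 - d) * real u \<le> d * real v * real t \<and> Suc M \<le> t"
    unfolding eventually_sequentially by blast
  have cone: "(1 - p - e) * (1 / g (real m)) \<le> (p + e) * (1 / f (real l)) \<and>
      (p - e) * (1 / f (real l)) \<le> (1 - p + e) * (1 / g (real m))"
    if t: "t0 \<le> t" and l: "u * t \<le> l" "l < u * Suc t" and m: "v * t \<le> m" "m < v * Suc t" for t l m
  proof -
    have Mt: "Suc M \<le> t" using t0[OF t] by simp
    have "t \<le> u * t" "t \<le> v * t" using \<open>0 < u\<close> v by simp_all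
    then have lm: "t \<le> l" "t \<le> m" using l(1) m(1) by linarith+
    have l1: "1 \<le> l" "1 \<le> m" "M \<le> l + m" using lm Mt by auto
    have fl: "0 < f (real l)" by (rule f.pos[OF l1(1)])
    have gm: "0 < g (real m)" by (rule g.pos[OF l1(2)])
    \<comment> \<open>With \<open>n = l + m\<close> and \<open>x = l / n\<close> the arguments
      \<open>x * n\<close> and \<open>(1 - x) * n\<close> are exactly \<open>l\<close> and
      \<open>m\<close>, so the estimate on the cone speaks about values at integers.\<close>
    define n where "n = l + m"
    define x where "x = real l / real n"
    have n: "0 < real n" using l1 by (simp add: n_def)
    have xn: "x * real n = real l" using n by (simp add: x_def)
    have xn': "(1 - x) * real n = real m" using xn by (simp add: left_diff_distrib n_def)
    have lr: "real u * real t \<le> real l" "real l < real u * (real t + 1)"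
    proof -
      have "real (u * t) \<le> real l" "real l < real (u * Suc t)"
        using l by (simp_all only: of_nat_le_iff of_nat_less_iff)
      then show "real u * real t \<le> real l" "real l < real u * (real t + 1)"
        by (simp_all add: algebra_simps)
    qed
    have mr: "real v * real t \<le> real m" "real m < real v * (real t + 1)"
    proof -
      have "real (v * t) \<le> real m" "real m < real (v * Suc t)"
        using m by (simp_all only: of_nat_le_iff of_nat_less_iff)
      then show "real v * real t \<le> real m" "real m < real v * (real t + 1)"
        by (simp_all add: algebra_simps)
    qed
    have c01: "0 < c" "0 < 1 - c" "0 < d" "0 < 1 - d" using cd a b st by auto
    have "c * real m < c * (real v * (real t + 1))" using mr c01 by (intro mult_strict_left_mono) auto
    also have "\<dots> \<le> (1 - c) * (real u * real t)" using t0[OF t] by (simp add: algebra_simps)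
    also have "\<dots> \<le> (1 - c) * real l" using lr c01 by (intro mult_left_mono) auto
    finally have cx: "c < x" using n by (simp add: x_def n_def pos_less_divide_eq algebra_simps)
    have "(1 - d) * real l < (1 - d) * (real u * (real t + 1))" using lr c01 by (intro mult_strict_left_mono) auto
    also have "\<dots> \<le> d * (real v * real t)" using t0[OF t] by (simp add: algebra_simps)
    also have "\<dots> \<le> d * real m" using mr c01 by (intro mult_left_mono) auto
    finally have xd: "x < d" using n by (simp add: x_def n_def pos_divide_less_eq algebra_simps)
    have hx: "h n x = f (real l) / (f (real l) + g (real m))"
      unfolding h_def xn xn' ..
    have "\<bar>h n x - p\<bar> \<le> e" unfolding p_def by (rule near[OF _ cx xd]) (use l1 in \<open>simp add: n_def\<close>)
    then have "f (real l) / (f (real l) + g (real m)) \<le> p + e" "p - e \<le> f (real l) / (f (real l) + g (real m))"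
      unfolding hx by linarith+
    then have "f (real l) \<le> (p + e) * (f (real l) + g (real m))" "(p - e) * (f (real l) + g (real m)) \<le> f (real l)"
      using fl gm by (simp_all add: pos_divide_le_eq pos_le_divide_eq)
    then have "(1 - p - e) * f (real l) \<le> (p + e) * g (real m)" "(p - e) * g (real m) \<le> (1 - p + e) * f (real l)"
      by (simp_all add: algebra_simps)
    then show ?thesis using fl gm by (simp add: divide_simps mult.commute)
  qed
  have tails1: "real u * (1 - p - e) * tail_sum g (v * n) \<le> real v * (p + e) * tail_sum f (u * n)" if n: "t0 \<le> n" for n
    by (rule tail_sum_block_le[OF f(1) g(1) \<open>0 < u\<close> v]) (use cone[OF order_trans[OF n]] in blast)
  have tails2: "real v * (p - e) * tail_sum f (u * n) \<le> real u * (1 - p + e) * tail_sum g (v * n)" if n: "t0 \<le> n" for n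
    by (rule tail_sum_block_le[OF g(1) f(1) v \<open>0 < u\<close>]) (use cone[OF order_trans[OF n]] in blast)
  have uv0: "0 < real (u + v)" using v by simp
  have "a < r" "r < b" using r cd by auto
  then have u_bounds: "a * real (u + v) \<le> real u" "real u \<le> b * real (u + v)"
    unfolding ruv pos_less_divide_eq[OF uv0] pos_divide_less_eq[OF uv0] by linarith+
  have tpos: "0 < tail_sum f (u * n)" "0 < tail_sum g (v * n)" if "1 \<le> n" for n
    using that \<open>0 < u\<close> v by (auto intro!: f.tail_sum_pos g.tail_sum_pos simp: Suc_le_eq)
  \<comment> \<open>Were the ratio of tails eventually at most \<open>K\<close>, then
    \<open>f\<close> would win at \<open>x2\<close>. So it exceeds \<open>K\<close> for some large
    \<open>n\<close>, and a single such \<open>n\<close> suffices.\<close>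
  have "\<not> (\<forall>\<^sub>F n in sequentially. tail_sum f (u * n) \<le> K * tail_sum g (v * n))"
  proof
    assume ev: "\<forall>\<^sub>F n in sequentially. tail_sum f (u * n) \<le> K * tail_sum g (v * n)"
    have "beats f x2 g (1 - x2)"
      by (rule beats_of_multiples[OF f(1) g(1) \<open>0 < u\<close> v u_bounds(2) x1(1) x2(1) _ \<kappa>1(1,3) K1(1) ev])
        (use x2 st K in auto)
    then show False using none x2 x1 a b by (meson less_trans)
  qed
  then have "\<exists>\<^sub>F n in sequentially. K * tail_sum g (v * n) < tail_sum f (u * n)"
    by (simp add: frequently_def not_less)
  then obtain n where n: "Suc t0 \<le> n" "K * tail_sum g (v * n) < tail_sum f (u * n)"
    by (meson frequently_sequentially)
  have first: "real v * (p - e) * K \<le> real u * (1 - p + e)"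
  proof (cases "0 \<le> p - e")
    case True
    have "real v * (p - e) * K * tail_sum g (v * n) = real v * (p - e) * (K * tail_sum g (v * n))" by simp
    also have "\<dots> \<le> real v * (p - e) * tail_sum f (u * n)"
      using True n(2) by (intro mult_left_mono) auto
    also have "\<dots> \<le> real u * (1 - p + e) * tail_sum g (v * n)" using n(1) by (intro tails2) simp
    finally show ?thesis using tpos[of n] n(1) by simp
  next
    case False
    then have "real v * (p - e) * K \<le> 0" using K by (intro mult_nonpos_nonneg mult_nonneg_nonpos) auto
    also have "0 \<le> real u * (1 - p + e)" using p e by simp
    finally show ?thesis .
  qed
  have "\<not> (\<forall>\<^sub>F n in sequentially. tail_sum g (v * n) \<le> K * tail_sum f (u * n))"
  proof
    assume ev: "\<forall>\<^sub>F n in sequentially. tail_sum g (v * n) \<le> K * tail_sum f (u * n)"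
    have "beats g (1 - y2) f (1 - (1 - y2))"
      by (rule beats_of_multiples[OF g(1) f(1) v \<open>0 < u\<close> _ _ _ _ \<kappa>2(1,3) K1(2) ev])
        (use y1 y2 st K u_bounds in \<open>auto simp: algebra_simps\<close>)
    then show False using none y2 y1 a b by auto
  qed
  then have "\<exists>\<^sub>F n in sequentially. K * tail_sum f (u * n) < tail_sum g (v * n)"
    by (simp add: frequently_def not_less)
  then obtain n' where n': "Suc t0 \<le> n'" "K * tail_sum f (u * n') < tail_sum g (v * n')"
    by (meson frequently_sequentially)
  have second: "real u * (1 - p - e) * K \<le> real v * (p + e)"
  proof (cases "0 \<le> 1 - p - e")
    case True
    have "real u * (1 - p - e) * K * tail_sum f (u * n') = real u * (1 - p - e) * (K * tail_sum f (u * n'))" by simp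
    also have "\<dots> \<le> real u * (1 - p - e) * tail_sum g (v * n')"
      using True n'(2) by (intro mult_left_mono) auto
    also have "\<dots> \<le> real v * (p + e) * tail_sum f (u * n')" using n'(1) by (intro tails1) simp
    finally show ?thesis using tpos[of n'] n'(1) by simp
  next
    case False
    then have "real u * (1 - p - e) * K \<le> 0" using K by (intro mult_nonpos_nonneg mult_nonneg_nonpos) auto
    also have "0 \<le> real v * (p + e)" using p e by simp
    finally show ?thesis .
  qed
  \<comment> \<open>\<open>W\<close> mixes \<open>u\<close> and \<open>v\<close> with weights
    \<open>1 - p\<close> and \<open>p\<close>. Since both are at least \<open>\<mu> * U\<close>, so
    is \<open>W\<close>; adding \<open>first\<close> and \<open>second\<close> bounds it by half of
    that.\<close>
  define W where "W = real v * p + real u * (1 - p)"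
  define U where "U = real u + real v"
  have U: "0 < U" using v by (simp add: U_def)
  have "(K - 1) * W \<le> e * (K + 1) * U"
    using add_mono[OF first second] unfolding W_def U_def by (simp add: algebra_simps)
  also have "\<dots> = (K - 1) * (\<mu> * U / 2)" using K by (simp add: e_def field_simps)
  finally have "W \<le> \<mu> * U / 2" using K by simp
  moreover have "\<mu> * U \<le> W"
  proof -
    have "\<mu> * U \<le> a * U" "\<mu> * U \<le> (1 - b) * U" using U by (auto simp: \<mu>_def intro!: mult_right_mono)
    then have "\<mu> * U \<le> real u" "\<mu> * U \<le> real v"
      using u_bounds by (simp_all add: U_def algebra_simps)
    then have "\<mu> * U * p \<le> real v * p" "\<mu> * U * (1 - p) \<le> real u * (1 - p)"
      using p by (auto intro!: mult_right_mono)
    then show ?thesis unfolding W_def by (simp add: algebra_simps)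
  qed
  moreover have "0 < \<mu> * U" using \<mu> U by simp
  ultimately show False by linarith
qed

section \<open>Dissection of the simplex\<close>

text \<open>The inequality between \<open>x j / w j\<close> and \<open>x i / w i\<close> is
  multiplied out, so the cell is visibly cut out by linear half-spaces.\<close>

definition weight_cell :: "'n set \<Rightarrow> ('n \<Rightarrow> real) \<Rightarrow> 'n \<Rightarrow> (real^('n::finite)) set" where
  "weight_cell I w i = {x \<in> std_simplex. \<forall>j\<in>I. x $ j * w i \<le> x $ i * w j}"

definition weight_cell_interior :: "'n set \<Rightarrow> ('n \<Rightarrow> real) \<Rightarrow> 'n \<Rightarrow> (real^('n::finite)) set" where
  "weight_cell_interior I w i = {x \<in> std_simplex_interior. \<forall>j\<in>I - {i}. x $ j * w i < x $ i * w j}"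

lemma bounded_std_simplex: "bounded (std_simplex :: (real^('n::finite)) set)"
proof (rule boundedI)
  fix x :: "real^'n" assume x: "x \<in> std_simplex"
  have "norm x \<le> (\<Sum>i\<in>UNIV. \<bar>x $ i\<bar>)" by (rule norm_le_l1_cart)
  also have "\<dots> = (\<Sum>i\<in>UNIV. x $ i)" using x by (intro sum.cong) (auto simp: std_simplex_def)
  also have "\<dots> = 1" using x by (simp add: std_simplex_def)
  finally show "norm x \<le> 1" .
qed

lemma polytope_weight_cell: "polytope (weight_cell I w i :: (real^('n::finite)) set)"
proof -
  have "weight_cell I w i = (\<Inter>k\<in>UNIV. {x. (- axis k 1) \<bullet> x \<le> 0}) \<inter> {x. (\<Sum>k\<in>UNIV. axis k 1) \<bullet> x = 1}
      \<inter> (\<Inter>j\<in>I. {x :: real^'n. (w i *\<^sub>R axis j 1 - w j *\<^sub>R axis i 1) \<bullet> x \<le> 0})"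
    by (auto simp: weight_cell_def std_simplex_def inner_sum_left inner_diff_left inner_axis' mult.commute)
  also have "polyhedron \<dots>"
    by (intro polyhedron_Int polyhedron_Inter ballI finite_imageI)
      (auto simp: polyhedron_halfspace_le polyhedron_hyperplane simp del: inner_minus_left)
  finally have "polyhedron (weight_cell I w i :: (real^'n) set)" .
  moreover have "bounded (weight_cell I w i :: (real^'n) set)"
    by (rule bounded_subset[OF bounded_std_simplex]) (auto simp: weight_cell_def)
  ultimately show ?thesis by (simp add: polytope_eq_bounded_polyhedron)
qed

context
  fixes I :: "'n::finite set" and w :: "'n \<Rightarrow> real"
  assumes w: "\<And>i. i \<in> I \<Longrightarrow> 0 < w i"
begin

lemma weight_cell_interior_nonempty:
  assumes i: "i \<in> I"
  shows "weight_cell_interior I w i \<noteq> {}"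
proof -
  \<comment> \<open>Proportional to the weights on \<open>I\<close>, where all comparisons would be
    ties, except that the share of \<open>i\<close> is doubled; shares outside \<open>I\<close> are
    arbitrary positive numbers.\<close>
  define z where "z k = (if k = i then 2 * w i else if k \<in> I then w k else 1)" for k
  define S where "S = (\<Sum>k\<in>UNIV. z k)"
  have z: "0 < z k" for k using w i by (simp add: z_def)
  have S: "0 < S" unfolding S_def by (intro sum_pos) (auto simp: z)
  have "(\<chi> k. z k / S) \<in> weight_cell_interior I w i"
    unfolding weight_cell_interior_def std_simplex_interior_def
  proof (intro CollectI conjI allI ballI)
    fix j assume j: "j \<in> I - {i}"
    have "z j * w i < z i * w j" using j w[OF i] w[of j] by (auto simp: z_def)
    then show "(\<chi> k. z k / S) $ j * w i < (\<chi> k. z k / S) $ i * w j"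
      using S by (simp add: divide_strict_right_mono)
  qed (use z S in \<open>auto simp: sum_divide_distrib[symmetric] S_def[symmetric]\<close>)
  then show ?thesis by blast
qed

text \<open>Any positive admixture of a strictly interior point makes all the inequalities strict.
  Both the relative interior and the closure of a cell are handled with it.\<close>

lemma weight_cell_mix:
  assumes x: "x \<in> weight_cell I w i" and y: "y \<in> weight_cell_interior I w i" and t: "0 < t" "t \<le> 1"
  shows "(1 - t) *\<^sub>R x + t *\<^sub>R y \<in> weight_cell_interior I w i"
proof -
  have x0: "0 \<le> x $ k" and xs: "(\<Sum>k\<in>UNIV. x $ k) = 1" for k
    using x by (auto simp: weight_cell_def std_simplex_def)
  have y0: "0 < y $ k" and ys: "(\<Sum>k\<in>UNIV. y $ k) = 1" for k
    using y by (auto simp: weight_cell_interior_def std_simplex_interior_def)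
  have "0 < (1 - t) * x $ k + t * y $ k" for k
    using x0[of k] y0[of k] t by (intro add_nonneg_pos) auto
  moreover have "(\<Sum>k\<in>UNIV. (1 - t) * x $ k + t * y $ k) = 1"
    by (simp add: sum.distrib sum_distrib_left[symmetric] xs ys)
  moreover have "((1 - t) * x $ j + t * y $ j) * w i < ((1 - t) * x $ i + t * y $ i) * w j" if "j \<in> I - {i}" for j
  proof -
    have "(1 - t) * (x $ j * w i) \<le> (1 - t) * (x $ i * w j)"
      using x t that by (intro mult_left_mono) (auto simp: weight_cell_def)
    moreover have "t * (y $ j * w i) < t * (y $ i * w j)"
      using y t that by (intro mult_strict_left_mono) (auto simp: weight_cell_interior_def)
    ultimately show ?thesis by (simp add: algebra_simps)
  qed
  ultimately show ?thesis
    by (simp add: weight_cell_interior_def std_simplex_interior_def)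
qed

lemma weight_cell_interior_subset: "weight_cell_interior I w i \<subseteq> weight_cell I w i"
proof
  fix x assume x: "x \<in> weight_cell_interior I w i"
  have "x $ j * w i \<le> x $ i * w j" if "j \<in> I" for j
    using x that by (cases "j = i") (auto simp: weight_cell_interior_def less_imp_le)
  then show "x \<in> weight_cell I w i"
    using x by (auto simp: weight_cell_def weight_cell_interior_def std_simplex_def std_simplex_interior_def less_imp_le)
qed

lemma rel_interior_weight_cell:
  assumes i: "i \<in> I"
  shows "rel_interior (weight_cell I w i) \<subseteq> weight_cell_interior I w i"
proof
  fix x assume x: "x \<in> rel_interior (weight_cell I w i)"
  obtain y where y: "y \<in> weight_cell_interior I w i"
    using weight_cell_interior_nonempty[OF i] by blast
  then have yP: "y \<in> weight_cell I w i" using weight_cell_interior_subset by blast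
  have "convex (weight_cell I w i)" by (rule polytope_imp_convex[OF polytope_weight_cell])
  then obtain e where e: "1 < e" "(1 - e) *\<^sub>R y + e *\<^sub>R x \<in> weight_cell I w i"
    using x yP convex_rel_interior_iff by blast
  \<comment> \<open>The segment from \<open>y\<close> through \<open>x\<close> can be extended
    beyond \<open>x\<close> inside the cell; \<open>x\<close> is the mixture of the extended point,
    with weight \<open>1 / e\<close>, and \<open>y\<close>.\<close>
  have "(1 - (1 - 1 / e)) *\<^sub>R ((1 - e) *\<^sub>R y + e *\<^sub>R x) + (1 - 1 / e) *\<^sub>R y \<in> weight_cell_interior I w i"
    using e by (intro weight_cell_mix y) auto
  moreover have "(1 - (1 - 1 / e)) *\<^sub>R ((1 - e) *\<^sub>R y + e *\<^sub>R x) + (1 - 1 / e) *\<^sub>R y = x"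
    using e(1) by (simp add: vec_eq_iff field_simps)
  ultimately show "x \<in> weight_cell_interior I w i" by simp
qed

lemma weight_cell_subset_closure:
  assumes i: "i \<in> I"
  shows "weight_cell I w i \<subseteq> closure (weight_cell_interior I w i)"
proof
  fix x assume x: "x \<in> weight_cell I w i"
  obtain y where y: "y \<in> weight_cell_interior I w i"
    using weight_cell_interior_nonempty[OF i] by blast
  have "(\<lambda>n. (1 - 1 / real (Suc n)) *\<^sub>R x + (1 / real (Suc n)) *\<^sub>R y) \<longlonglongrightarrow> (1 - 0) *\<^sub>R x + 0 *\<^sub>R y"
    by (intro tendsto_intros LIMSEQ_Suc[OF lim_1_over_n])
  moreover have "(1 - 1 / real (Suc n)) *\<^sub>R x + (1 / real (Suc n)) *\<^sub>R y \<in> weight_cell_interior I w i" for n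
    by (intro weight_cell_mix x y) auto
  ultimately show "x \<in> closure (weight_cell_interior I w i)"
    unfolding closure_sequential by (intro exI[of _ "\<lambda>n. (1 - 1 / real (Suc n)) *\<^sub>R x + (1 / real (Suc n)) *\<^sub>R y"]) simp
qed

lemma std_simplex_covered:
  assumes "I \<noteq> {}" "x \<in> std_simplex"
  shows "\<exists>i\<in>I. x \<in> weight_cell I w i"
proof -
  define m where "m = Max ((\<lambda>i. x $ i / w i) ` I)"
  have "m \<in> (\<lambda>i. x $ i / w i) ` I" unfolding m_def using assms(1) by (intro Max_in) auto
  then obtain i where i: "i \<in> I" "m = x $ i / w i" by blast
  have "x $ j / w j \<le> x $ i / w i" if "j \<in> I" for j
    unfolding i(2)[symmetric] m_def using that by (intro Max_ge) auto
  then have "x \<in> weight_cell I w i"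
    using assms(2) w i(1) by (auto simp: weight_cell_def divide_simps mult.commute)
  then show ?thesis using i(1) by blast
qed

lemma dissection:
  assumes I: "I \<noteq> {}"
    and lower: "\<And>i. i \<in> I \<Longrightarrow> weight_cell_interior I w i \<subseteq> D i"
    and upper: "\<And>i. i \<in> I \<Longrightarrow> D i \<subseteq> weight_cell I w i"
    and empty: "\<And>i. i \<notin> I \<Longrightarrow> D i = {}"
  shows "(\<forall>i. \<exists>P. polytope P \<and> rel_interior P \<subseteq> D i \<and> D i \<subseteq> P) \<and> (\<Union>i. closure (D i)) = std_simplex"
proof (intro conjI allI)
  fix i
  show "\<exists>P. polytope P \<and> rel_interior P \<subseteq> D i \<and> D i \<subseteq> P"
  proof (cases "i \<in> I")
    case True
    then show ?thesis
      using polytope_weight_cell rel_interior_weight_cell lower upper by (meson order_trans)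
  next
    case False
    then show ?thesis using empty by (intro exI[of _ "{}"]) (auto simp: polytope_empty)
  qed
next
  show "(\<Union>i. closure (D i)) = std_simplex"
  proof
    show "(\<Union>i. closure (D i)) \<subseteq> std_simplex"
    proof (intro UN_least)
      fix i
      show "closure (D i) \<subseteq> std_simplex"
      proof (cases "i \<in> I")
        case True
        then have "closure (D i) \<subseteq> weight_cell I w i"
          by (intro closure_minimal upper polytope_imp_closed polytope_weight_cell)
        then show ?thesis by (auto simp: weight_cell_def)
      qed (simp add: empty)
    qed
    show "std_simplex \<subseteq> (\<Union>i. closure (D i))"
    proof
      fix x :: "real^'n" assume "x \<in> std_simplex"
      then obtain i where i: "i \<in> I" "x \<in> weight_cell I w i" using std_simplex_covered[OF I] by blast
      then have "x \<in> closure (weight_cell_interior I w i)" using weight_cell_subset_closure by blast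
      then show "x \<in> (\<Union>i. closure (D i))" using closure_mono[OF lower[OF i(1)]] by blast
    qed
  qed
qed

end

text \<open>In \<open>kill\<close> the comparison is available at some \<open>a\<close> strictly
  below \<open>c $ i\<close>. Type E turns this gap into a ratio of tails tending to 0; strict
  inequalities between the quotients by the weights always leave such a gap.\<close>

lemma attraction_domains_dissect:
  fixes F :: "'n::{finite,wellorder} \<Rightarrow> real \<Rightarrow> real"
  assumes comp: "competitors F A"
    and kill: "\<And>c i j a. c \<in> std_simplex_interior \<Longrightarrow> i \<in> A \<Longrightarrow> j \<in> A \<Longrightarrow> i \<noteq> j \<Longrightarrow> 0 < a \<Longrightarrow> a < c $ i \<Longrightarrow>
      beats (F i) a (F j) (c $ j) \<Longrightarrow> dies F c j"
    and outside: "\<And>c j. c \<in> std_simplex_interior \<Longrightarrow> j \<notin> A \<Longrightarrow> dies F c j"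
  shows "(\<forall>i. \<exists>P. polytope P \<and> rel_interior P \<subseteq> attraction_domain F i \<and> attraction_domain F i \<subseteq> P)
    \<and> (\<Union>i. closure (attraction_domain F i)) = std_simplex"
proof -
  interpret competitors F A by (rule comp)
  show ?thesis
  proof (rule weights)
    fix I :: "'n set" and w :: "'n \<Rightarrow> real"
    assume I: "I \<subseteq> A" "I \<noteq> {}" and w: "\<And>i. i \<in> I \<Longrightarrow> 0 < w i"
      and inner: "\<And>i j a b. i \<in> I \<Longrightarrow> j \<in> I \<Longrightarrow> 0 < a \<Longrightarrow> 0 < b \<Longrightarrow> b / w j < a / w i \<Longrightarrow> beat i a j b"
      and outer: "\<And>i j a b. i \<in> I \<Longrightarrow> j \<in> A \<Longrightarrow> j \<notin> I \<Longrightarrow> 0 < a \<Longrightarrow> 0 < b \<Longrightarrow> beat i a j b"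
    have cpos: "0 < c $ k" if "c \<in> std_simplex_interior" for c :: "real^('n::{finite,wellorder})" and k
      using that by (simp add: std_simplex_interior_def)
    have dies_inner: "dies F c j"
      if c: "c \<in> std_simplex_interior" and ij: "i \<in> I" "j \<in> I" "i \<noteq> j" and less: "c $ j * w i < c $ i * w j" for c i j
    proof -
      have "c $ j / w j < c $ i / w i" using less w ij by (simp add: divide_simps mult.commute)
      then obtain x where x: "c $ j / w j < x" "x < c $ i / w i" using dense by blast
      have x0: "0 < x" using x(1) cpos[OF c, of j] w[OF ij(2)] by (smt (verit) divide_pos_pos)
      have "beat i (x * w i) j (c $ j)"
        using x x0 ij w[OF ij(1)] cpos[OF c] by (intro inner) auto
      moreover have "x * w i < c $ i" using x(2) w[OF ij(1)] by (simp add: pos_less_divide_eq)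
      ultimately show ?thesis
        using kill[OF c, of i j "x * w i"] ij I(1) x0 w[OF ij(1)] by auto
    qed
    have dies_outer: "dies F c j" if c: "c \<in> std_simplex_interior" and i: "i \<in> I" and j: "j \<notin> I" for c i j
    proof (cases "j \<in> A")
      case True
      then show ?thesis
        using kill[OF c, of i j "c $ i / 2"] outer[OF i True j, of "c $ i / 2" "c $ j"] cpos[OF c] I(1) i j by auto
    next
      case False
      then show ?thesis by (rule outside[OF c])
    qed
    obtain i0 where i0: "i0 \<in> I" using I(2) by blast
    show ?thesis
    proof (rule dissection[where I = I and w = w, OF w I(2)])
      fix i assume i: "i \<in> I"
      show "weight_cell_interior I w i \<subseteq> attraction_domain F i"
      proof
        fix c assume "c \<in> weight_cell_interior I w i"
        then have c: "c \<in> std_simplex_interior" "\<And>j. j \<in> I \<Longrightarrow> j \<noteq> i \<Longrightarrow> c $ j * w i < c $ i * w j"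
          by (auto simp: weight_cell_interior_def)
        show "c \<in> attraction_domain F i"
        proof (rule attraction_domainI[OF c(1)])
          fix j assume "j \<noteq> i"
          then show "dies F c j"
            using dies_inner[OF c(1) i, of j] dies_outer[OF c(1) i, of j] c(2)[of j] by (cases "j \<in> I") auto
        qed
      qed
      show "attraction_domain F i \<subseteq> weight_cell I w i"
      proof
        fix c assume c: "c \<in> attraction_domain F i"
        then have ci: "c \<in> std_simplex_interior" by (simp add: attraction_domain_def)
        have "c $ j * w i \<le> c $ i * w j" if j: "j \<in> I" for j
        proof (rule ccontr)
          assume "\<not> c $ j * w i \<le> c $ i * w j"
          then have less: "c $ i * w j < c $ j * w i" by simp
          then have "j \<noteq> i" by auto
          from dies_inner[OF ci j i this less] c show False using dies_not_attraction_domain by blast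
        qed
        then show "c \<in> weight_cell I w i"
          using ci by (auto simp: weight_cell_def std_simplex_def std_simplex_interior_def less_imp_le)
      qed
    next
      fix i assume i: "i \<notin> I"
      show "attraction_domain F i = {}"
      proof (rule equals0I)
        fix c assume c: "c \<in> attraction_domain F i"
        then have "c \<in> std_simplex_interior" by (simp add: attraction_domain_def)
        from dies_outer[OF this i0 i] c show False using dies_not_attraction_domain by blast
      qed
    qed
  qed
qed

section \<open>The two regimes\<close>

text \<open>Transfers hypotheses at points of the simplex to normalised pairs
  \<open>(x, 1 - x)\<close>. With further agents present, half of the mass is left to them, which
  the factor \<open>q = 2\<close> undoes; the ratios then appear along the indices
  \<open>q * n\<close>.\<close>

lemma interior_point_on_line:
  fixes i j :: "'n::finite"
  assumes ij: "i \<noteq> j" and x: "0 < x" "x < 1"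
  obtains c :: "real^'n" and q :: nat where "c \<in> std_simplex_interior" "0 < q"
    "c $ i * real q = x" "c $ j * real q = 1 - x"
proof (cases "UNIV = {i, j}")
  case True
  define c :: "real^'n" where "c = (\<chi> k. if k = i then x else 1 - x)"
  have "c \<in> std_simplex_interior"
    using ij x by (simp add: std_simplex_interior_def True) (simp add: c_def)
  then show ?thesis using ij by (intro that[of c 1]) (auto simp: c_def)
next
  case False
  define R where "R = UNIV - {i, j}"
  have "R \<noteq> {}" using False by (auto simp: R_def)
  then have R: "0 < card R" by (simp add: card_gt_0_iff)
  define c :: "real^'n" where "c = (\<chi> k. if k = i then x / 2 else if k = j then (1 - x) / 2 else 1 / (2 * real (card R)))"
  have "(\<Sum>k\<in>UNIV. c $ k) = (\<Sum>k\<in>{i, j}. c $ k) + (\<Sum>k\<in>R. c $ k)"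
    unfolding R_def using sum.subset_diff[of "{i, j}" UNIV "\<lambda>k. c $ k"] by (simp add: add.commute)
  also have "(\<Sum>k\<in>R. c $ k) = (\<Sum>k\<in>R. 1 / (2 * real (card R)))"
    by (intro sum.cong) (auto simp: c_def R_def)
  also have "(\<Sum>k\<in>{i, j}. c $ k) + (\<Sum>k\<in>R. 1 / (2 * real (card R))) = 1"
    using ij R \<open>R \<noteq> {}\<close> by (simp add: c_def field_simps)
  finally have "c \<in> std_simplex_interior"
    using x R by (simp add: std_simplex_interior_def) (simp add: c_def)
  then show ?thesis using ij by (intro that[of c 2]) (auto simp: c_def)
qed

lemma ratio_seq_multiple:
  assumes "c $ i * real q = x" "c $ j * real q = 1 - x"
  shows "ratio_seq F c i j (q * n) = ereal (F i (x * real n) / F j ((1 - x) * real n))"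
  unfolding ratio_seq_def assms(2)[symmetric] unfolding assms(1)[symmetric] by (simp add: mult.assoc)

lemma strict_mono_times: "0 < q \<Longrightarrow> strict_mono (\<lambda>n :: nat. q * n)"
  by (simp add: strict_mono_def)

lemma dissection_typeE:
  fixes F :: "'n::{finite,wellorder} \<Rightarrow> real \<Rightarrow> real"
  assumes adm: "admissible_feedback F" and MPE: "\<forall>i. condM (F i) \<longrightarrow> typeP (F i) \<or> typeE (F i)"
    and ex: "\<exists>i. typeE (F i)"
    and osc: "\<forall>c\<in>std_simplex_interior. \<forall>i j.
      \<not> (liminf (ratio_seq F c i j) = 0 \<and> limsup (ratio_seq F c i j) = \<infinity>)"
  shows "(\<forall>i. \<exists>P. polytope P \<and> rel_interior P \<subseteq> attraction_domain F i \<and> attraction_domain F i \<subseteq> P)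
    \<and> (\<Union>i. closure (attraction_domain F i)) = std_simplex"
proof (rule attraction_domains_dissect)
  note Fpos = admissible_pos_real[OF adm] and mp = admissible_monotone_pieces[OF adm]
  have M: "condM (F i)" if "i \<in> {i. typeE (F i)}" for i using that by (auto simp: typeE_def)
  have mono: "monopolistic (F i)" if "i \<in> {i. typeE (F i)}" for i by (rule monopolisticI[OF adm M[OF that]])
  have exp: "exp_tail (F i)" if "i \<in> {i. typeE (F i)}" for i using that typeE_exp_tail by blast
  have osc': "\<not> (liminf (\<lambda>n. ereal (F i (x * real n) / F j ((1 - x) * real n))) = 0
        \<and> limsup (\<lambda>n. ereal (F i (x * real n) / F j ((1 - x) * real n))) = \<infinity>)"
    if ij: "i \<noteq> j" and x: "0 < x" "x < 1" for i j x
  proof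
    assume bad: "liminf (\<lambda>n. ereal (F i (x * real n) / F j ((1 - x) * real n))) = 0
        \<and> limsup (\<lambda>n. ereal (F i (x * real n) / F j ((1 - x) * real n))) = \<infinity>"
    obtain c :: "real^('n::{finite,wellorder})" and q where c: "c \<in> std_simplex_interior" "0 < q"
      and cq: "c $ i * real q = x" "c $ j * real q = 1 - x"
      using interior_point_on_line[OF ij x] by blast
    have eq: "ratio_seq F c i j \<circ> (\<lambda>n. q * n) = (\<lambda>n. ereal (F i (x * real n) / F j ((1 - x) * real n)))"
      using ratio_seq_multiple[OF cq, of F] by (simp add: fun_eq_iff)
    \<comment> \<open>Oscillation along a subsequence forces oscillation of the full sequence: its
      lower limit is not larger and its upper limit not smaller. Eventual positivity makes the lower
      limit exactly 0.\<close>
    have "liminf (ratio_seq F c i j) \<le> 0"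
      using liminf_subseq_mono[OF strict_mono_times[OF c(2)], of "ratio_seq F c i j"] bad by (simp only: eq)
    moreover have "0 \<le> liminf (ratio_seq F c i j)"
    proof (rule Liminf_bounded)
      have "0 < c $ i" "0 < c $ j" using c(1) by (auto simp: std_simplex_interior_def)
      then have "\<forall>\<^sub>F N in sequentially. 0 * real N + 1 \<le> c $ i * real N" "\<forall>\<^sub>F N in sequentially. 0 * real N + 1 \<le> c $ j * real N"
        by (intro eventually_linear_le; simp)+
      then show "\<forall>\<^sub>F N in sequentially. 0 \<le> ratio_seq F c i j N"
      proof eventually_elim
        case (elim N)
        then show ?case
          using Fpos[of "c $ i * real N" i] Fpos[of "c $ j * real N" j] by (simp add: ratio_seq_def)
      qed
    qed
    ultimately have "liminf (ratio_seq F c i j) = 0" by simp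
    moreover have "limsup (ratio_seq F c i j) = \<infinity>"
      using limsup_subseq_mono[OF strict_mono_times[OF c(2)], of "ratio_seq F c i j"] bad by (simp add: eq)
    ultimately show False using osc c(1) by blast
  qed
  show "competitors F {i. typeE (F i)}"
  proof (rule competitors.intro)
    fix i j assume i: "i \<in> {i. typeE (F i)}" and j: "j \<in> {i. typeE (F i)}" and ij: "i \<noteq> j"
    show "dichotomy (F i) (F j)"
      by (rule exp_tail_dichotomy[OF mono[OF i] mp exp[OF i] mono[OF j] mp exp[OF j] Fpos Fpos osc'[OF ij]])
  qed (use ex mono exp exp_tail_poly_tail in auto)
  fix c :: "real^('n::{finite,wellorder})" assume c: "c \<in> std_simplex_interior"
  have cpos: "0 < c $ k" for k using c by (simp add: std_simplex_interior_def)
  {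
    fix i j a assume i: "i \<in> {i. typeE (F i)}" and j: "j \<in> {i. typeE (F i)}" and ij: "i \<noteq> j"
      and a: "0 < a" "a < c $ i" and beats: "beats (F i) a (F j) (c $ j)"
    interpret i: monopolistic "F i" by (rule mono[OF i])
    interpret j: monopolistic "F j" by (rule mono[OF j])
    obtain p where p: "0 \<le> p" "p < 1" "\<forall>\<^sub>F N in sequentially. tail_at (F i) a N \<le> p * tail_at (F j) (c $ j) N"
      using beatsE[OF beats mono[OF j] cpos] .
    \<comment> \<open>The given comparison at \<open>a\<close> bounds the ratio by a constant below
      1; the move from \<open>a\<close> to \<open>c $ i\<close> multiplies it by an arbitrarily
      small \<open>e\<close>.\<close>
    have "(\<lambda>N. tail_at (F i) (c $ i) N / tail_at (F j) (c $ j) N) \<longlonglongrightarrow> 0"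
    proof (rule order_tendstoI)
      fix e :: real assume e: "e < 0"
      show "\<forall>\<^sub>F N in sequentially. e < tail_at (F i) (c $ i) N / tail_at (F j) (c $ j) N"
        using eventually_ge_at_top[of 1]
      proof eventually_elim
        case (elim N)
        then have "0 < tail_at (F i) (c $ i) N / tail_at (F j) (c $ j) N"
          using cpos by (intro divide_pos_pos i.tail_at_pos j.tail_at_pos)
        with e show ?case by linarith
      qed
    next
      fix e :: real assume e: "0 < e"
      show "\<forall>\<^sub>F N in sequentially. tail_at (F i) (c $ i) N / tail_at (F j) (c $ j) N < e"
        using i.exp_tail_at_ratio[OF exp[OF i] a e] p(3) eventually_ge_at_top[of 1]
      proof eventually_elim
        case (elim N)
        have "0 < tail_at (F j) (c $ j) N" using cpos elim by (intro j.tail_at_pos)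
        moreover have "p * tail_at (F j) (c $ j) N < 1 * tail_at (F j) (c $ j) N"
          using p calculation by (intro mult_strict_right_mono) auto
        then have "e * tail_at (F i) a N < e * tail_at (F j) (c $ j) N"
          using elim e by (intro mult_strict_left_mono) auto
        ultimately show ?case using elim by (simp add: pos_divide_less_eq)
      qed
    qed
    then show "dies F c j"
      unfolding tail_at_def by (intro dies_tail_ratio[OF adm M[OF i] M[OF j] ij c])
  }
  fix j assume j: "j \<notin> {i. typeE (F i)}"
  obtain i where i: "i \<in> {i. typeE (F i)}" using ex by blast
  have ij: "i \<noteq> j" using i j by auto
  show "dies F c j"
  proof (cases "condM (F j)")
    case True
    then have P: "typeP (F j)" using MPE j by blast
    show ?thesis
      using exp_tail_typeP_ratio[OF mono[OF i] exp[OF i] monopolisticI[OF adm True] P cpos cpos, of i j]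
      unfolding tail_at_def by (intro dies_tail_ratio[OF adm M[OF i] True ij c])
  next
    case False
    then show ?thesis by (rule dies_not_condM[OF adm M[OF i] _ c])
  qed
qed

lemma dissection_typeP:
  fixes F :: "'n::{finite,wellorder} \<Rightarrow> real \<Rightarrow> real"
  assumes adm: "admissible_feedback F" and someM: "\<exists>i. condM (F i)"
    and P: "\<And>i. condM (F i) \<Longrightarrow> typeP (F i)"
    and bound: "\<And>i. typeP (F i) \<Longrightarrow> limsup (\<lambda>k. ereal (1 / real k * F i (real k) * tail_sum (F i) k)) < \<infinity>"
    and lim: "\<forall>c\<in>std_simplex_interior. \<forall>i j. \<exists>L::ereal. 0 \<le> L \<and> (ratio_seq F c i j \<longlongrightarrow> L) sequentially"
  shows "(\<forall>i. \<exists>P. polytope P \<and> rel_interior P \<subseteq> attraction_domain F i \<and> attraction_domain F i \<subseteq> P)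
    \<and> (\<Union>i. closure (attraction_domain F i)) = std_simplex"
proof (rule attraction_domains_dissect)
  note Fpos = admissible_pos_real[OF adm]
  have mono: "monopolistic (F i)" if "i \<in> {i. condM (F i)}" for i
    using that by (intro monopolisticI[OF adm]) simp
  have poly: "poly_tail (F i)" if i: "i \<in> {i. condM (F i)}" for i
  proof -
    have "condM (F i)" using i by simp
    obtain C where C: "0 < C" "\<forall>\<^sub>F k in sequentially. 1 / real k * F i (real k) * tail_sum (F i) k \<le> C"
      by (rule limsup_finite_bound[OF bound[OF P[OF \<open>condM (F i)\<close>]]])
    have "\<forall>\<^sub>F k in sequentially. F i (real k) * tail_sum (F i) k \<le> C * real k"
      using C(2) eventually_ge_at_top[of 1] by eventually_elim (auto simp: field_simps)
    with C(1) show ?thesis by (auto simp: poly_tail_def)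
  qed
  have cont: "continuous_on {0<..} (F i)" for i
  proof -
    obtain f' where "\<forall>x\<in>{0<..}. (F i has_real_derivative f' x) (at x)"
      using adm unfolding admissible_feedback_def C1_on_def by blast
    then have "\<forall>x\<in>{0<..}. isCont (F i) x" by (blast intro: DERIV_isCont)
    then show ?thesis by (rule continuous_at_imp_continuous_on)
  qed
  have lim': "\<exists>L::ereal. 0 \<le> L \<and> ((\<lambda>n. ereal (F i (x * real n) / F j ((1 - x) * real n))) \<longlongrightarrow> L) sequentially"
    if ij: "i \<noteq> j" and x: "0 < x" "x < 1" for i j x
  proof -
    obtain c :: "real^('n::{finite,wellorder})" and q where c: "c \<in> std_simplex_interior" "0 < q"
      and cq: "c $ i * real q = x" "c $ j * real q = 1 - x"
      using interior_point_on_line[OF ij x] by blast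
    obtain L where L: "0 \<le> L" "(ratio_seq F c i j \<longlongrightarrow> L) sequentially" using lim c(1) by blast
    have "((\<lambda>n. ratio_seq F c i j (q * n)) \<longlongrightarrow> L) sequentially"
      using LIMSEQ_subseq_LIMSEQ[OF L(2) strict_mono_times[OF c(2)]] by (simp add: o_def)
    then show ?thesis using L(1) unfolding ratio_seq_multiple[OF cq] by blast
  qed
  show "competitors F {i. condM (F i)}"
  proof (rule competitors.intro)
    fix i j assume i: "i \<in> {i. condM (F i)}" and j: "j \<in> {i. condM (F i)}" and ij: "i \<noteq> j"
    show "dichotomy (F i) (F j)"
      by (rule ratio_limit_dichotomy[OF mono[OF i] poly[OF i] cont mono[OF j] poly[OF j] cont Fpos Fpos lim'[OF ij]])
  qed (use someM mono poly in auto)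
  fix c :: "real^('n::{finite,wellorder})" assume c: "c \<in> std_simplex_interior"
  have cpos: "0 < c $ k" for k using c by (simp add: std_simplex_interior_def)
  {
    fix i j a assume i: "i \<in> {i. condM (F i)}" and j: "j \<in> {i. condM (F i)}" and ij: "i \<noteq> j"
      and a: "0 < a" "a < c $ i" and beats: "beats (F i) a (F j) (c $ j)"
    interpret i: monopolistic "F i" by (rule mono[OF i])
    obtain p where p: "0 \<le> p" "p < 1" "\<forall>\<^sub>F N in sequentially. tail_at (F i) a N \<le> p * tail_at (F j) (c $ j) N"
      using beatsE[OF beats mono[OF j] cpos] .
    have "\<forall>\<^sub>F N in sequentially. tail_at (F i) (c $ i) N \<le> p * tail_at (F j) (c $ j) N"
      using p(3) eventually_ge_at_top[of 1]
    proof eventually_elim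
      case (elim N)
      have "tail_at (F i) (c $ i) N \<le> tail_at (F i) a N"
        using a elim by (intro i.tail_at_le mult_right_mono) auto
      with elim show ?case by linarith
    qed
    then show "dies F c j"
      unfolding tail_at_def using i j by (intro dies_typeP[OF adm P P ij c p(2)]) auto
  }
  fix j assume "j \<notin> {i. condM (F i)}"
  then show "dies F c j" using someM dies_not_condM[OF adm _ _ c] by blast
qed

theorem mainTheorem8:
  fixes F :: "'n::{finite,wellorder} \<Rightarrow> real \<Rightarrow> real"
  assumes A2: "CARD('n) \<ge> 2"
    and adm: "admissible_feedback F"
    and someM: "\<exists>i. condM (F i)"
    and MPE: "\<forall>i. condM (F i) \<longrightarrow> typeP (F i) \<or> typeE (F i)"
    and cases:
      "((\<exists>i. typeE (F i)) \<and>
        (\<forall>c\<in>std_simplex_interior. \<forall>i j.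
           \<not> (liminf (ratio_seq F c i j) = 0 \<and> limsup (ratio_seq F c i j) = \<infinity>)))
       \<or>
       ((\<forall>i. \<not> typeE (F i)) \<and>
        (\<forall>i. typeP (F i) \<longrightarrow>
           limsup (\<lambda>k. ereal (1 / real k * F i (real k) * tail_sum (F i) k)) < \<infinity>) \<and>
        (\<forall>c\<in>std_simplex_interior. \<forall>i j.
           \<exists>L::ereal. 0 \<le> L \<and> (ratio_seq F c i j \<longlongrightarrow> L) sequentially))"
  shows "(\<forall>i. \<exists>P. polytope P \<and> rel_interior P \<subseteq> attraction_domain F i \<and> attraction_domain F i \<subseteq> P)
       \<and> (\<Union>i. closure (attraction_domain F i)) = std_simplex
       \<and> (\<forall>i j. i \<noteq> j \<longrightarrow> attraction_domain F i \<inter> attraction_domain F j = {})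
       \<and> (\<forall>i. \<not> condM (F i) \<longrightarrow> attraction_domain F i = {})"
proof -
  have "(\<forall>i. \<exists>P. polytope P \<and> rel_interior P \<subseteq> attraction_domain F i \<and> attraction_domain F i \<subseteq> P)
      \<and> (\<Union>i. closure (attraction_domain F i)) = std_simplex"
    using cases
  proof
    assume "(\<exists>i. typeE (F i)) \<and> (\<forall>c\<in>std_simplex_interior. \<forall>i j.
        \<not> (liminf (ratio_seq F c i j) = 0 \<and> limsup (ratio_seq F c i j) = \<infinity>))"
    then show ?thesis by (intro dissection_typeE[OF adm MPE]) blast+
  next
    assume "(\<forall>i. \<not> typeE (F i)) \<and>
        (\<forall>i. typeP (F i) \<longrightarrow> limsup (\<lambda>k. ereal (1 / real k * F i (real k) * tail_sum (F i) k)) < \<infinity>) \<and>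
        (\<forall>c\<in>std_simplex_interior. \<forall>i j. \<exists>L::ereal. 0 \<le> L \<and> (ratio_seq F c i j \<longlongrightarrow> L) sequentially)"
    \<comment> \<open>Without agents of type E, every agent satisfying (M) is of type P.\<close>
    then show ?thesis using MPE by (intro dissection_typeP[OF adm someM]) blast+
  qed
  moreover have "attraction_domain F i = {}" if "\<not> condM (F i)" for i
  proof (rule equals0I)
    fix c assume c: "c \<in> attraction_domain F i"
    then have "c \<in> std_simplex_interior" by (simp add: attraction_domain_def)
    then have "dies F c i" using someM that dies_not_condM[OF adm] by blast
    with c show False using dies_not_attraction_domain by blast
  qed
  ultimately show ?thesis using attraction_domain_disjoint by blast
qed

end
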